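(* Let $\mathscr{C}$ be an arbitrary small category. For any contravariant natural system of groups $\mathcal{G}:(\mathfrak{F}\mathscr{C})^{op}\to\mathrm{Grp}$ on $\mathscr{C}$ there exist natural isomorphisms $$H^{BW}_n(\mathscr{C},\mathcal{G})\cong\mathrm{colim}^{(\mathfrak{F}\mathscr{C})^{op}}_n\mathcal{G}\quad\text{for all } n\geq0.$$
   Context: The factorization category $\mathfrak{F}\mathscr{C}$ of a small category $\mathscr{C}$ has as objects the morphisms of $\mathscr{C}$; a morphism $f\to g$ is a pair $(\alpha,\beta)$ of morphisms of $\mathscr{C}$ with $\alpha:\mathrm{dom}\,g\to\mathrm{dom}\,f$, $\beta:\mathrm{cod}\,f\to\mathrm{cod}\,g$ and $g=\beta f\alpha$; the composite of $f\xrightarrow{(\alpha,\beta)}g\xrightarrow{(\alpha',\beta')}h$ is $(\alpha\alpha',\beta'\beta)$. A contravariant natural system of groups on $\mathscr{C}$ is a functor $\mathcal{G}:(\mathfrak{F}\mathscr{C})^{op}\to\mathrm{Grp}$. For a small category $\mathscr{K}$ and a functor (group diagram) $\mathcal{G}:\mathscr{K}\to\mathrm{Grp}$, the simplicial replacement is the simplicial group $C_*(\mathscr{K},\mathcal{G})$ with $C_n(\mathscr{K},\mathcal{G})=\star_{c_0\to\cdots\to c_n}\mathcal{G}(c_0)$ (free product over $n$-simplices of the nerve), where $d^0_n$ sends $(c_0\xrightarrow{\alpha_1}c_1\to\cdots\to c_n,x)$ to $(c_1\to\cdots\to c_n,\mathcal{G}(\alpha_1)(x))$, $d^i_n$ for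 $i>0$ takes the $i$-th face of the nerve simplex and keeps $x$, and $s^i_n$ inserts the identity of $c_i$ and keeps $x$. Define $\mathrm{colim}^{\mathscr{K}}_n\mathcal{G}:=\pi_n(C_*(\mathscr{K},\mathcal{G}))$, $n\ge0$. For a simplicial set $X$, $\Delta\downarrow X$ is its category of simplices (objects $([n],x\in X_n)$; morphisms $([m],y)\to([n],x)$ are $\alpha:[m]\to[n]$ with $X(\alpha)(x)=y$), $Q_X:\Delta\downarrow X\to\Delta$ is the forgetful functor, and for $\mathcal{H}:(\Delta\downarrow X)^{op}\to\mathrm{Grp}$ the non-Abelian Gabriel-Zisman homology is $H_n(X,\mathcal{H}):=\mathrm{colim}^{\Delta^{op}}_n\,\mathrm{Lan}^{Q_X^{op}}\mathcal{H}$, with $\mathrm{Lan}^{Q_X^{op}}$ the left Kan extension along $Q_X^{op}$. Let $B\mathscr{C}$ be the nerve of $\mathscr{C}$. Identify $\Delta\downarrow B\mathscr{C}$ with the category of functors $\sigma:[m]\to\mathscr{C}$, $m\ge0$, with morphisms from $\sigma:[m]\to\mathscr{C}$ to $\tau:[n]\to\mathscr{C}$ being maps $\alpha:[m]\to[n]$ in $\Delta$ with $\tau\alpha=\sigma$. The functor $\delta:\Delta\downarrow B\mathscr{C}\to\mathfrak{F}\mathscr{C}$ sends $\sigma$ to the morphism $\sigma(0\le m):\sigma(0)\to\sigma(m)$ and $\alpha:\sigma\to\tau$ to $(\tau(0\le\alpha(0)),\tau(\alpha(m)\le n)):\sigma(0\le m)\to\tau(0\le n)$. The non-Abelian Baues-Wirsching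 homology is $H^{BW}_n(\mathscr{C},\mathcal{G}):=H_n(B\mathscr{C},\mathcal{G}\circ\delta^{op})$, $n\ge0$. *)

theory Defs
  imports "HOL-Algebra.Coset"
begin

section \<open>Small categories and functors\<close>

record ('o, 'm) cat =
  Obj :: "'o set"
  Arr :: "'m set"
  Dom :: "'m \<Rightarrow> 'o"
  Cod :: "'m \<Rightarrow> 'o"
  Id :: "'o \<Rightarrow> 'm"
  Comp :: "'m \<Rightarrow> 'm \<Rightarrow> 'm"

text \<open>\<open>Comp K g f\<close> is the composite \<open>g f\<close> (first \<open>f\<close>, then \<open>g\<close>).\<close>

locale category =
  fixes K :: "('o, 'm) cat"
  assumes Dom_in: "f \<in> Arr K \<Longrightarrow> Dom K f \<in> Obj K"
    and Cod_in: "f \<in> Arr K \<Longrightarrow> Cod K f \<in> Obj K"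
    and Id_in: "c \<in> Obj K \<Longrightarrow> Id K c \<in> Arr K"
    and Dom_Id: "c \<in> Obj K \<Longrightarrow> Dom K (Id K c) = c"
    and Cod_Id: "c \<in> Obj K \<Longrightarrow> Cod K (Id K c) = c"
    and Comp_in: "\<lbrakk>f \<in> Arr K; g \<in> Arr K; Cod K f = Dom K g\<rbrakk> \<Longrightarrow> Comp K g f \<in> Arr K"
    and Dom_Comp: "\<lbrakk>f \<in> Arr K; g \<in> Arr K; Cod K f = Dom K g\<rbrakk> \<Longrightarrow> Dom K (Comp K g f) = Dom K f"
    and Cod_Comp: "\<lbrakk>f \<in> Arr K; g \<in> Arr K; Cod K f = Dom K g\<rbrakk> \<Longrightarrow> Cod K (Comp K g f) = Cod K g"
    and Comp_Id: "f \<in> Arr K \<Longrightarrow> Comp K f (Id K (Dom K f)) = f"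
    and Id_Comp: "f \<in> Arr K \<Longrightarrow> Comp K (Id K (Cod K f)) f = f"
    and Comp_assoc: "\<lbrakk>f \<in> Arr K; g \<in> Arr K; h \<in> Arr K; Cod K f = Dom K g; Cod K g = Dom K h\<rbrakk>
      \<Longrightarrow> Comp K h (Comp K g f) = Comp K (Comp K h g) f"

definition op_cat :: "('o, 'm) cat \<Rightarrow> ('o, 'm) cat" where
  "op_cat K = \<lparr>Obj = Obj K, Arr = Arr K, Dom = Cod K, Cod = Dom K, Id = Id K,
     Comp = (\<lambda>g f. Comp K f g)\<rparr>"

text \<open>A functor \<open>A \<rightarrow> B\<close> and its opposite \<open>A\<^sup>o\<^sup>p \<rightarrow> B\<^sup>o\<^sup>p\<close> are given by the same data, so
  no separate notation for opposite functors is introduced.\<close>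

record ('o, 'm, 'p, 'q) func =
  fobj :: "'o \<Rightarrow> 'p"
  fmap :: "'m \<Rightarrow> 'q"

definition is_functor :: "('o, 'm) cat \<Rightarrow> ('p, 'q) cat \<Rightarrow> ('o, 'm, 'p, 'q) func \<Rightarrow> bool" where
  "is_functor A B F \<longleftrightarrow>
     (\<forall>c \<in> Obj A. fobj F c \<in> Obj B \<and> fmap F (Id A c) = Id B (fobj F c)) \<and>
     (\<forall>f \<in> Arr A. fmap F f \<in> Arr B \<and> Dom B (fmap F f) = fobj F (Dom A f) \<and>
        Cod B (fmap F f) = fobj F (Cod A f)) \<and>
     (\<forall>f \<in> Arr A. \<forall>g \<in> Arr A. Cod A f = Dom A g \<longrightarrow>
        fmap F (Comp A g f) = Comp B (fmap F g) (fmap F f))"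


section \<open>Diagrams of groups\<close>

record ('o, 'm, 'g) diagram =
  gobj :: "'o \<Rightarrow> 'g monoid"
  gmap :: "'m \<Rightarrow> 'g \<Rightarrow> 'g"

definition group_diagram :: "('o, 'm) cat \<Rightarrow> ('o, 'm, 'g) diagram \<Rightarrow> bool" where
  "group_diagram K D \<longleftrightarrow>
     (\<forall>c \<in> Obj K. group (gobj D c) \<and> (\<forall>x \<in> carrier (gobj D c). gmap D (Id K c) x = x)) \<and>
     (\<forall>f \<in> Arr K. gmap D f \<in> hom (gobj D (Dom K f)) (gobj D (Cod K f))) \<and>
     (\<forall>f \<in> Arr K. \<forall>g \<in> Arr K. Cod K f = Dom K g \<longrightarrow>
        (\<forall>x \<in> carrier (gobj D (Dom K f)). gmap D (Comp K g f) x = gmap D g (gmap D f x)))"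

definition nat_trans ::
  "('o, 'm) cat \<Rightarrow> ('o, 'm, 'g) diagram \<Rightarrow> ('o, 'm, 'h) diagram \<Rightarrow> ('o \<Rightarrow> 'g \<Rightarrow> 'h) \<Rightarrow> bool" where
  "nat_trans K D E t \<longleftrightarrow>
     (\<forall>c \<in> Obj K. t c \<in> hom (gobj D c) (gobj E c)) \<and>
     (\<forall>f \<in> Arr K. \<forall>x \<in> carrier (gobj D (Dom K f)).
        t (Cod K f) (gmap D f x) = gmap E f (t (Dom K f) x))"

definition precomp :: "('p, 'q, 'g) diagram \<Rightarrow> ('o, 'm, 'p, 'q) func \<Rightarrow> ('o, 'm, 'g) diagram" where
  "precomp D F = \<lparr>gobj = (\<lambda>c. gobj D (fobj F c)), gmap = (\<lambda>f. gmap D (fmap F f))\<rparr>"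


section \<open>Free products and colimits of groups\<close>

text \<open>The group generated by letters \<open>(i, x)\<close> with \<open>i \<in> I\<close> and \<open>x \<in> G i\<close>, subject to the relations
  of each \<open>G i\<close> and to the identification of the letters related by \<open>R\<close>. It is realised as a quotient
  of the monoid of words; inverses exist because the letters have inverses.\<close>

definition letters :: "'i set \<Rightarrow> ('i \<Rightarrow> 'g monoid) \<Rightarrow> ('i \<times> 'g) set" where
  "letters I G = (SIGMA i:I. carrier (G i))"

inductive word_eq ::
  "'i set \<Rightarrow> ('i \<Rightarrow> 'g monoid) \<Rightarrow> (('i \<times> 'g) \<times> ('i \<times> 'g)) set \<Rightarrow>
     ('i \<times> 'g) list \<Rightarrow> ('i \<times> 'g) list \<Rightarrow> bool"
  for I G R where
    refl: "w \<in> lists (letters I G) \<Longrightarrow> word_eq I G R w w"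
  | sym: "word_eq I G R v w \<Longrightarrow> word_eq I G R w v"
  | trans: "word_eq I G R u v \<Longrightarrow> word_eq I G R v w \<Longrightarrow> word_eq I G R u w"
  | one: "\<lbrakk>u \<in> lists (letters I G); v \<in> lists (letters I G); i \<in> I\<rbrakk>
      \<Longrightarrow> word_eq I G R (u @ [(i, \<one>\<^bsub>G i\<^esub>)] @ v) (u @ v)"
  | mult: "\<lbrakk>u \<in> lists (letters I G); v \<in> lists (letters I G); i \<in> I; x \<in> carrier (G i); y \<in> carrier (G i)\<rbrakk>
      \<Longrightarrow> word_eq I G R (u @ [(i, x), (i, y)] @ v) (u @ [(i, x \<otimes>\<^bsub>G i\<^esub> y)] @ v)"
  | ident: "\<lbrakk>u \<in> lists (letters I G); v \<in> lists (letters I G); a \<in> letters I G; b \<in> letters I G; (a, b) \<in> R\<rbrakk>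
      \<Longrightarrow> word_eq I G R (u @ [a] @ v) (u @ [b] @ v)"

definition word_rel ::
  "'i set \<Rightarrow> ('i \<Rightarrow> 'g monoid) \<Rightarrow> (('i \<times> 'g) \<times> ('i \<times> 'g)) set \<Rightarrow> ('i \<times> 'g) list rel" where
  "word_rel I G R = {(u, v). word_eq I G R u v}"

definition word_group ::
  "'i set \<Rightarrow> ('i \<Rightarrow> 'g monoid) \<Rightarrow> (('i \<times> 'g) \<times> ('i \<times> 'g)) set \<Rightarrow> ('i \<times> 'g) list set monoid" where
  "word_group I G R =
     \<lparr>carrier = lists (letters I G) // word_rel I G R,
      mult = (\<lambda>A B. word_rel I G R `` {u @ v |u v. u \<in> A \<and> v \<in> B}),
      one = word_rel I G R `` {[]}\<rparr>"

text \<open>The homomorphism into \<open>word_group I G R\<close> sending each generator \<open>a\<close> to the generator \<open>f a\<close>.\<close>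

definition word_map ::
  "'i set \<Rightarrow> ('i \<Rightarrow> 'g monoid) \<Rightarrow> (('i \<times> 'g) \<times> ('i \<times> 'g)) set \<Rightarrow> ('j \<times> 'h \<Rightarrow> 'i \<times> 'g) \<Rightarrow>
     ('j \<times> 'h) list set \<Rightarrow> ('i \<times> 'g) list set" where
  "word_map I G R f A = word_rel I G R `` (map f ` A)"

abbreviation free_product :: "'i set \<Rightarrow> ('i \<Rightarrow> 'g monoid) \<Rightarrow> ('i \<times> 'g) list set monoid" where
  "free_product I G \<equiv> word_group I G {}"

definition colim_rel :: "('o, 'm) cat \<Rightarrow> ('o, 'm, 'g) diagram \<Rightarrow> (('o \<times> 'g) \<times> ('o \<times> 'g)) set" where
  "colim_rel J D = {((Dom J f, x), (Cod J f, gmap D f x)) |f x.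
     f \<in> Arr J \<and> x \<in> carrier (gobj D (Dom J f))}"

definition colimit :: "('o, 'm) cat \<Rightarrow> ('o, 'm, 'g) diagram \<Rightarrow> ('o \<times> 'g) list set monoid" where
  "colimit J D = word_group (Obj J) (gobj D) (colim_rel J D)"


section \<open>Left Kan extensions\<close>

text \<open>The comma category \<open>S \<down> d\<close> of a functor \<open>S: A \<rightarrow> B\<close> over \<open>d\<close>: objects are pairs
  \<open>(a, \<beta>: S a \<rightarrow> d)\<close>.\<close>

definition comma_cat ::
  "('o, 'm) cat \<Rightarrow> ('p, 'q) cat \<Rightarrow> ('o, 'm, 'p, 'q) func \<Rightarrow> 'p \<Rightarrow>
     ('o \<times> 'q, ('o \<times> 'q) \<times> 'm \<times> ('o \<times> 'q)) cat" where
  "comma_cat A B S d =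
     \<lparr>Obj = {(a, \<beta>). a \<in> Obj A \<and> \<beta> \<in> Arr B \<and> Dom B \<beta> = fobj S a \<and> Cod B \<beta> = d},
      Arr = {((a, \<beta>), \<alpha>, (a', \<beta>')). a \<in> Obj A \<and> \<beta> \<in> Arr B \<and> Dom B \<beta> = fobj S a \<and> Cod B \<beta> = d \<and>
               a' \<in> Obj A \<and> \<beta>' \<in> Arr B \<and> Dom B \<beta>' = fobj S a' \<and> Cod B \<beta>' = d \<and>
               \<alpha> \<in> Arr A \<and> Dom A \<alpha> = a \<and> Cod A \<alpha> = a' \<and> Comp B \<beta>' (fmap S \<alpha>) = \<beta>},
      Dom = fst,
      Cod = (\<lambda>f. snd (snd f)),
      Id = (\<lambda>(a, \<beta>). ((a, \<beta>), Id A a, (a, \<beta>))),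
      Comp = (\<lambda>(y, \<alpha>', z) (x, \<alpha>, y'). (x, Comp A \<alpha>' \<alpha>, z))\<rparr>"

definition comma_diagram ::
  "('o, 'm, 'g) diagram \<Rightarrow> ('o \<times> 'q, ('o \<times> 'q) \<times> 'm \<times> ('o \<times> 'q), 'g) diagram" where
  "comma_diagram F = \<lparr>gobj = (\<lambda>(a, \<beta>). gobj F a), gmap = (\<lambda>(x, \<alpha>, y). gmap F \<alpha>)\<rparr>"

text \<open>The left Kan extension of \<open>F: A \<rightarrow> Grp\<close> along \<open>S: A \<rightarrow> B\<close>, as the pointwise colimit over the
  comma categories; the universal property is proved in \<open>Lan_universal\<close> below.\<close>

definition Lan ::
  "('o, 'm) cat \<Rightarrow> ('p, 'q) cat \<Rightarrow> ('o, 'm, 'p, 'q) func \<Rightarrow> ('o, 'm, 'g) diagram \<Rightarrow>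
     ('p, 'q, (('o \<times> 'q) \<times> 'g) list set) diagram" where
  "Lan A B S F =
     \<lparr>gobj = (\<lambda>d. colimit (comma_cat A B S d) (comma_diagram F)),
      gmap = (\<lambda>\<gamma>. word_map (Obj (comma_cat A B S (Cod B \<gamma>))) (gobj (comma_diagram F))
                (colim_rel (comma_cat A B S (Cod B \<gamma>)) (comma_diagram F))
                (\<lambda>((a, \<beta>), x). ((a, Comp B \<gamma> \<beta>), x)))\<rparr>"

definition Lan_unit ::
  "('o, 'm) cat \<Rightarrow> ('p, 'q) cat \<Rightarrow> ('o, 'm, 'p, 'q) func \<Rightarrow> ('o, 'm, 'g) diagram \<Rightarrow>
     'o \<Rightarrow> 'g \<Rightarrow> (('o \<times> 'q) \<times> 'g) list set" where
  "Lan_unit A B S F a x =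
     word_rel (Obj (comma_cat A B S (fobj S a))) (gobj (comma_diagram F))
       (colim_rel (comma_cat A B S (fobj S a)) (comma_diagram F)) `` {[((a, Id B (fobj S a)), x)]}"

text \<open>The action of \<open>Lan\<close> on a natural transformation \<open>t: F \<rightarrow> F'\<close>.\<close>

definition Lan_map ::
  "('o, 'm) cat \<Rightarrow> ('p, 'q) cat \<Rightarrow> ('o, 'm, 'p, 'q) func \<Rightarrow> ('o, 'm, 'h) diagram \<Rightarrow>
     ('o \<Rightarrow> 'g \<Rightarrow> 'h) \<Rightarrow> 'p \<Rightarrow> (('o \<times> 'q) \<times> 'g) list set \<Rightarrow> (('o \<times> 'q) \<times> 'h) list set" where
  "Lan_map A B S F' t d =
     word_map (Obj (comma_cat A B S d)) (gobj (comma_diagram F'))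
       (colim_rel (comma_cat A B S d) (comma_diagram F'))
       (\<lambda>((a, \<beta>), x). ((a, \<beta>), t a x))"


section \<open>The simplex category, simplicial sets and nerves\<close>

text \<open>The object \<open>[n]\<close> is the number \<open>n\<close>; a morphism \<open>[m] \<rightarrow> [n]\<close> is \<open>(m, f, n)\<close> with \<open>f\<close> a monotone map
  \<open>{0, \<dots>, m} \<rightarrow> {0, \<dots>, n}\<close>, made extensional outside \<open>{0, \<dots>, m}\<close>.\<close>

type_synonym darr = "nat \<times> (nat \<Rightarrow> nat) \<times> nat"

definition Delta :: "(nat, darr) cat" where
  "Delta =
     \<lparr>Obj = UNIV,
      Arr = {(m, f, n). f \<in> {..m} \<rightarrow>\<^sub>E {..n} \<and> mono_on {..m} f},
      Dom = (\<lambda>(m, f, n). m),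
      Cod = (\<lambda>(m, f, n). n),
      Id = (\<lambda>n. (n, restrict id {..n}, n)),
      Comp = (\<lambda>(l', g, n) (m, f, l). (m, compose {..m} g f, n))\<rparr>"

text \<open>\<open>coface n i\<close> is the injection \<open>[n - 1] \<rightarrow> [n]\<close> missing \<open>i\<close> and \<open>codegen n i\<close> is the surjection
  \<open>[n + 1] \<rightarrow> [n]\<close> repeating \<open>i\<close>.\<close>

definition coface :: "nat \<Rightarrow> nat \<Rightarrow> darr" where
  "coface n i = (n - 1, restrict (\<lambda>k. if k < i then k else Suc k) {..n - 1}, n)"

definition codegen :: "nat \<Rightarrow> nat \<Rightarrow> darr" where
  "codegen n i = (Suc n, restrict (\<lambda>k. if k \<le> i then k else k - 1) {..Suc n}, n)"

record 'x sset =
  simplices :: "nat \<Rightarrow> 'x set"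
  act :: "darr \<Rightarrow> 'x \<Rightarrow> 'x"

definition simplicial_set :: "'x sset \<Rightarrow> bool" where
  "simplicial_set X \<longleftrightarrow>
     (\<forall>\<alpha> \<in> Arr Delta. act X \<alpha> ` simplices X (Cod Delta \<alpha>) \<subseteq> simplices X (Dom Delta \<alpha>)) \<and>
     (\<forall>n. \<forall>x \<in> simplices X n. act X (Id Delta n) x = x) \<and>
     (\<forall>\<alpha> \<in> Arr Delta. \<forall>\<beta> \<in> Arr Delta. Cod Delta \<alpha> = Dom Delta \<beta> \<longrightarrow>
        (\<forall>x \<in> simplices X (Cod Delta \<beta>). act X (Comp Delta \<beta> \<alpha>) x = act X \<alpha> (act X \<beta> x)))"

text \<open>The category of simplices \<open>\<Delta> \<down> X\<close>.\<close>

definition simplex_cat :: "'x sset \<Rightarrow> (nat \<times> 'x, (nat \<times> 'x) \<times> darr \<times> (nat \<times> 'x)) cat" where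
  "simplex_cat X =
     \<lparr>Obj = {(n, x). x \<in> simplices X n},
      Arr = {((m, y), \<alpha>, (n, x)). \<alpha> \<in> Arr Delta \<and> Dom Delta \<alpha> = m \<and> Cod Delta \<alpha> = n \<and>
               x \<in> simplices X n \<and> y \<in> simplices X m \<and> act X \<alpha> x = y},
      Dom = fst,
      Cod = (\<lambda>f. snd (snd f)),
      Id = (\<lambda>(n, x). ((n, x), Id Delta n, (n, x))),
      Comp = (\<lambda>(y, \<beta>, z) (x, \<alpha>, y'). (x, Comp Delta \<beta> \<alpha>, z))\<rparr>"

definition simplex_forget ::
  "(nat \<times> 'x, (nat \<times> 'x) \<times> darr \<times> (nat \<times> 'x), nat, darr) func" where
  "simplex_forget = \<lparr>fobj = fst, fmap = (\<lambda>(y, \<alpha>, x). \<alpha>)\<rparr>"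

text \<open>The poset \<open>[n]\<close> as a category; the arrow \<open>i \<le> j\<close> is the pair \<open>(i, j)\<close>.\<close>

definition ord_cat :: "nat \<Rightarrow> (nat, nat \<times> nat) cat" where
  "ord_cat n =
     \<lparr>Obj = {..n}, Arr = {(i, j). i \<le> j \<and> j \<le> n}, Dom = fst, Cod = snd,
      Id = (\<lambda>i. (i, i)), Comp = (\<lambda>g f. (fst f, snd g))\<rparr>"

type_synonym ('o, 'm) nsimplex = "(nat, nat \<times> nat, 'o, 'm) func"

text \<open>The \<open>n\<close>-simplices of the nerve are the functors \<open>[n] \<rightarrow> K\<close>; extensionality makes equality of
  records coincide with equality of functors.\<close>

definition nerve :: "('o, 'm) cat \<Rightarrow> ('o, 'm) nsimplex sset" where
  "nerve K =
     \<lparr>simplices = (\<lambda>n. {\<sigma>. is_functor (ord_cat n) K \<sigma> \<and>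
                fobj \<sigma> \<in> extensional (Obj (ord_cat n)) \<and> fmap \<sigma> \<in> extensional (Arr (ord_cat n))}),
      act = (\<lambda>(m, f, n) \<sigma>.
        \<lparr>fobj = restrict (\<lambda>i. fobj \<sigma> (f i)) (Obj (ord_cat m)),
         fmap = restrict (\<lambda>(i, j). fmap \<sigma> (f i, f j)) (Arr (ord_cat m))\<rparr>)\<rparr>"


section \<open>Simplicial groups and their homotopy groups\<close>

record 'a sgroup =
  sgrp :: "nat \<Rightarrow> 'a monoid"
  face :: "nat \<Rightarrow> nat \<Rightarrow> 'a \<Rightarrow> 'a"
  degen :: "nat \<Rightarrow> nat \<Rightarrow> 'a \<Rightarrow> 'a"

text \<open>\<open>face S n i\<close> is \<open>d\<^sup>i\<^sub>n: S\<^sub>n \<rightarrow> S\<^sub>n\<^sub>-\<^sub>1\<close> (\<open>n > 0\<close>) and \<open>degen S n i\<close> is \<open>s\<^sup>i\<^sub>n: S\<^sub>n \<rightarrow> S\<^sub>n\<^sub>+\<^sub>1\<close>.\<close>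

locale simplicial_group =
  fixes S :: "'a sgroup"
  assumes grp: "group (sgrp S n)"
    and face_hom: "i \<le> Suc n \<Longrightarrow> face S (Suc n) i \<in> hom (sgrp S (Suc n)) (sgrp S n)"
    and degen_hom: "i \<le> n \<Longrightarrow> degen S n i \<in> hom (sgrp S n) (sgrp S (Suc n))"
    and face_face: "\<lbrakk>i < j; j \<le> Suc (Suc n); x \<in> carrier (sgrp S (Suc (Suc n)))\<rbrakk>
      \<Longrightarrow> face S (Suc n) i (face S (Suc (Suc n)) j x) = face S (Suc n) (j - 1) (face S (Suc (Suc n)) i x)"
    and face_degen_less: "\<lbrakk>i < j; j \<le> Suc n; x \<in> carrier (sgrp S (Suc n))\<rbrakk>
      \<Longrightarrow> face S (Suc (Suc n)) i (degen S (Suc n) j x) = degen S n (j - 1) (face S (Suc n) i x)"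
    and face_degen_id: "\<lbrakk>i = j \<or> i = Suc j; j \<le> n; x \<in> carrier (sgrp S n)\<rbrakk>
      \<Longrightarrow> face S (Suc n) i (degen S n j x) = x"
    and face_degen_gr: "\<lbrakk>Suc j < i; i \<le> Suc (Suc n); x \<in> carrier (sgrp S (Suc n))\<rbrakk>
      \<Longrightarrow> face S (Suc (Suc n)) i (degen S (Suc n) j x) = degen S n j (face S (Suc n) (i - 1) x)"
    and degen_degen: "\<lbrakk>i \<le> j; j \<le> n; x \<in> carrier (sgrp S n)\<rbrakk>
      \<Longrightarrow> degen S (Suc n) i (degen S n j x) = degen S (Suc n) (Suc j) (degen S n i x)"

text \<open>Homotopy groups of the underlying Kan complex, based at the unit: \<open>n\<close>-simplices all of whose
  faces are trivial, modulo simplicial homotopy. The group structure is induced by that of \<open>S\<^sub>n\<close>; for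
  \<open>n > 0\<close> it is the usual one on homotopy groups. The relation with the Moore complex is
  \<open>homotopy_group_Moore\<close> below.\<close>

definition spheres :: "'a sgroup \<Rightarrow> nat \<Rightarrow> 'a set" where
  "spheres S n = {x \<in> carrier (sgrp S n). n > 0 \<longrightarrow> (\<forall>i \<le> n. face S n i x = \<one>\<^bsub>sgrp S (n - 1)\<^esub>)}"

definition homotopic :: "'a sgroup \<Rightarrow> nat \<Rightarrow> 'a rel" where
  "homotopic S n = {(x, y). x \<in> spheres S n \<and> y \<in> spheres S n \<and>
     (\<exists>z \<in> carrier (sgrp S (Suc n)). (\<forall>i < n. face S (Suc n) i z = \<one>\<^bsub>sgrp S n\<^esub>) \<and>
        face S (Suc n) n z = x \<and> face S (Suc n) (Suc n) z = y)}"

definition homotopy_group :: "'a sgroup \<Rightarrow> nat \<Rightarrow> 'a set monoid" where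
  "homotopy_group S n =
     \<lparr>carrier = spheres S n // homotopic S n,
      mult = (\<lambda>A B. homotopic S n `` {x \<otimes>\<^bsub>sgrp S n\<^esub> y |x y. x \<in> A \<and> y \<in> B}),
      one = homotopic S n `` {\<one>\<^bsub>sgrp S n\<^esub>}\<rparr>"

text \<open>The map induced by a simplicial homomorphism into \<open>T\<close> with \<open>n\<close>-th component \<open>f\<close>.\<close>

definition homotopy_map :: "'b sgroup \<Rightarrow> nat \<Rightarrow> ('a \<Rightarrow> 'b) \<Rightarrow> 'a set \<Rightarrow> 'b set" where
  "homotopy_map T n f A = homotopic T n `` (f ` A)"


section \<open>The simplicial replacement and its homotopy groups\<close>

abbreviation replacement_group ::
  "('o, 'm) cat \<Rightarrow> ('o, 'm, 'g) diagram \<Rightarrow> nat \<Rightarrow> (('o, 'm) nsimplex \<times> 'g) list set monoid" where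
  "replacement_group K D n \<equiv> free_product (simplices (nerve K) n) (\<lambda>\<sigma>. gobj D (fobj \<sigma> 0))"

abbreviation replacement_map ::
  "('o, 'm) cat \<Rightarrow> ('o, 'm, 'g) diagram \<Rightarrow> nat \<Rightarrow>
     ('i \<times> 'h \<Rightarrow> ('o, 'm) nsimplex \<times> 'g) \<Rightarrow>
     ('i \<times> 'h) list set \<Rightarrow> (('o, 'm) nsimplex \<times> 'g) list set" where
  "replacement_map K D n f \<equiv> word_map (simplices (nerve K) n) (\<lambda>\<sigma>. gobj D (fobj \<sigma> 0)) {} f"

definition replacement ::
  "('o, 'm) cat \<Rightarrow> ('o, 'm, 'g) diagram \<Rightarrow> (('o, 'm) nsimplex \<times> 'g) list set sgroup" where
  "replacement K D =
     \<lparr>sgrp = replacement_group K D,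
      face = (\<lambda>n i. replacement_map K D (n - 1)
        (\<lambda>(\<sigma>, x). (act (nerve K) (coface n i) \<sigma>, if i = 0 then gmap D (fmap \<sigma> (0, 1)) x else x))),
      degen = (\<lambda>n i. replacement_map K D (Suc n)
        (\<lambda>(\<sigma>, x). (act (nerve K) (codegen n i) \<sigma>, x)))\<rparr>"

definition colim_n ::
  "('o, 'm) cat \<Rightarrow> ('o, 'm, 'g) diagram \<Rightarrow> nat \<Rightarrow> (('o, 'm) nsimplex \<times> 'g) list set set monoid" where
  "colim_n K D n = homotopy_group (replacement K D) n"

text \<open>The action of \<open>colim\<^sub>n\<close> on a natural transformation \<open>t: D \<rightarrow> D'\<close>.\<close>

definition colim_n_map ::
  "('o, 'm) cat \<Rightarrow> ('o, 'm, 'h) diagram \<Rightarrow> ('o \<Rightarrow> 'g \<Rightarrow> 'h) \<Rightarrow> nat \<Rightarrow>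
     (('o, 'm) nsimplex \<times> 'g) list set set \<Rightarrow> (('o, 'm) nsimplex \<times> 'h) list set set" where
  "colim_n_map K D' t n =
     homotopy_map (replacement K D') n
       (replacement_map K D' n (\<lambda>(\<sigma>, x). (\<sigma>, t (fobj \<sigma> 0) x)))"


section \<open>Non-Abelian Gabriel-Zisman homology\<close>

definition GZ_homology ::
  "'x sset \<Rightarrow> (nat \<times> 'x, (nat \<times> 'x) \<times> darr \<times> (nat \<times> 'x), 'g) diagram \<Rightarrow> nat \<Rightarrow> _ monoid" where
  "GZ_homology X H n =
     colim_n (op_cat Delta) (Lan (op_cat (simplex_cat X)) (op_cat Delta) simplex_forget H) n"

definition GZ_map ::
  "'x sset \<Rightarrow> (nat \<times> 'x, (nat \<times> 'x) \<times> darr \<times> (nat \<times> 'x), 'h) diagram \<Rightarrow>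
     (nat \<times> 'x \<Rightarrow> 'g \<Rightarrow> 'h) \<Rightarrow> nat \<Rightarrow> _ \<Rightarrow> _" where
  "GZ_map X H' t n =
     colim_n_map (op_cat Delta) (Lan (op_cat (simplex_cat X)) (op_cat Delta) simplex_forget H')
       (Lan_map (op_cat (simplex_cat X)) (op_cat Delta) simplex_forget H' t) n"


section \<open>Factorization categories and non-Abelian Baues-Wirsching homology\<close>

text \<open>The arrow \<open>(\<alpha>, \<beta>): f \<rightarrow> g\<close> is recorded as \<open>(f, (\<alpha>, \<beta>), g)\<close>.\<close>

definition fact_cat :: "('o, 'm) cat \<Rightarrow> ('m, 'm \<times> ('m \<times> 'm) \<times> 'm) cat" where
  "fact_cat C =
     \<lparr>Obj = Arr C,
      Arr = {(f, (\<alpha>, \<beta>), g). f \<in> Arr C \<and> g \<in> Arr C \<and> \<alpha> \<in> Arr C \<and> \<beta> \<in> Arr C \<and>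
               Dom C \<alpha> = Dom C g \<and> Cod C \<alpha> = Dom C f \<and>
               Dom C \<beta> = Cod C f \<and> Cod C \<beta> = Cod C g \<and>
               g = Comp C \<beta> (Comp C f \<alpha>)},
      Dom = fst,
      Cod = (\<lambda>u. snd (snd u)),
      Id = (\<lambda>f. (f, (Id C (Dom C f), Id C (Cod C f)), f)),
      Comp = (\<lambda>(g, (\<alpha>', \<beta>'), h) (f, (\<alpha>, \<beta>), g'). (f, (Comp C \<alpha> \<alpha>', Comp C \<beta>' \<beta>), h))\<rparr>"

text \<open>Natural systems of groups, with the group elements taken from \<open>'g\<close>.\<close>

abbreviation natural_system :: "('o, 'm) cat \<Rightarrow> ('m, 'm \<times> ('m \<times> 'm) \<times> 'm, 'g) diagram \<Rightarrow> bool" where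
  "natural_system C \<equiv> group_diagram (op_cat (fact_cat C))"

definition delta_fun ::
  "(nat \<times> ('o, 'm) nsimplex, (nat \<times> ('o, 'm) nsimplex) \<times> darr \<times> (nat \<times> ('o, 'm) nsimplex),
    'm, 'm \<times> ('m \<times> 'm) \<times> 'm) func" where
  "delta_fun =
     \<lparr>fobj = (\<lambda>(m, \<sigma>). fmap \<sigma> (0, m)),
      fmap = (\<lambda>((m, \<sigma>), (m', \<alpha>, n'), (n, \<tau>)).
        (fmap \<sigma> (0, m), (fmap \<tau> (0, \<alpha> 0), fmap \<tau> (\<alpha> m, n)), fmap \<tau> (0, n)))\<rparr>"

definition BW_homology ::
  "('o, 'm) cat \<Rightarrow> ('m, 'm \<times> ('m \<times> 'm) \<times> 'm, 'g) diagram \<Rightarrow> nat \<Rightarrow> _ monoid" where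
  "BW_homology C \<G> n = GZ_homology (nerve C) (precomp \<G> delta_fun) n"

definition BW_map ::
  "('o, 'm) cat \<Rightarrow> ('m, 'm \<times> ('m \<times> 'm) \<times> 'm, 'h) diagram \<Rightarrow> ('m \<Rightarrow> 'g \<Rightarrow> 'h) \<Rightarrow> nat \<Rightarrow> _ \<Rightarrow> _" where
  "BW_map C \<G>' t n =
     GZ_map (nerve C) (precomp \<G>' delta_fun) (\<lambda>c. t (fobj delta_fun c)) n"


section \<open>Universal property of presented groups\<close>

lemma word_eq_lists:
  "word_eq I G R v w \<Longrightarrow> (\<And>i. i \<in> I \<Longrightarrow> group (G i)) \<Longrightarrow> v \<in> lists (letters I G) \<and> w \<in> lists (letters I G)"
proof (induction rule: word_eq.induct)
  case (one u v i) then show ?case by (auto simp: letters_def intro: monoid.one_closed group.is_monoid)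
next
  case (mult u v i x y) then show ?case by (auto simp: letters_def intro: monoid.m_closed group.is_monoid)
qed auto

locale word_presentation =
  fixes I :: "'i set" and G :: "'i \<Rightarrow> 'g monoid" and R :: "(('i \<times> 'g) \<times> ('i \<times> 'g)) set"
  assumes groups: "i \<in> I \<Longrightarrow> group (G i)"
begin

abbreviation "W \<equiv> lists (letters I G)"

lemma eqD: "word_eq I G R v w \<Longrightarrow> v \<in> W \<and> w \<in> W"
  using word_eq_lists groups by blast

lemma equiv_word_rel: "equiv W (word_rel I G R)"
  by (rule equivI) (auto simp: word_rel_def refl_on_def sym_def trans_def dest: eqD
      intro: word_eq.intros)

lemma eq_append_left: "word_eq I G R v w \<Longrightarrow> u \<in> W \<Longrightarrow> word_eq I G R (u @ v) (u @ w)"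
proof (induction rule: word_eq.induct)
  case (one a b i) then show ?case using word_eq.one[of "u @ a" I G b i R] by simp
next
  case (mult a b i x y) then show ?case using word_eq.mult[of "u @ a" I G b i x y R] by simp
next
  case (ident a b x y) then show ?case using word_eq.ident[of "u @ a" I G b x y R] by simp
qed (auto simp: in_lists_conv_set intro!: word_eq.refl intro: word_eq.sym word_eq.trans)

lemma eq_append_right: "word_eq I G R v w \<Longrightarrow> u \<in> W \<Longrightarrow> word_eq I G R (v @ u) (w @ u)"
proof (induction rule: word_eq.induct)
  case (one a b i) then show ?case using word_eq.one[of a I G "b @ u" i R] by simp
next
  case (mult a b i x y) then show ?case using word_eq.mult[of a I G "b @ u" i x y R] by simp
next
  case (ident a b x y) then show ?case using word_eq.ident[of a I G "b @ u" x y R] by simp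
qed (auto simp: in_lists_conv_set intro!: word_eq.refl intro: word_eq.sym word_eq.trans)

lemma eq_append: "word_eq I G R v w \<Longrightarrow> word_eq I G R v' w' \<Longrightarrow> word_eq I G R (v @ v') (w @ w')"
  by (meson eqD eq_append_left eq_append_right word_eq.trans)

definition cls :: "('i \<times> 'g) list \<Rightarrow> ('i \<times> 'g) list set" where
  "cls w = word_rel I G R `` {w}"

lemma cls_eq_iff: "v \<in> W \<Longrightarrow> w \<in> W \<Longrightarrow> cls v = cls w \<longleftrightarrow> word_eq I G R v w"
  unfolding cls_def using eq_equiv_class_iff[OF equiv_word_rel] by (auto simp: word_rel_def)

lemma cls_self: "w \<in> W \<Longrightarrow> w \<in> cls w"
  by (simp add: cls_def word_rel_def word_eq.refl)

lemma in_cls: "v \<in> cls w \<longleftrightarrow> word_eq I G R w v"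
  by (simp add: cls_def word_rel_def)

lemma carrier_eq: "carrier (word_group I G R) = cls ` W"
  by (auto simp: word_group_def quotient_def cls_def)

lemma one_eq: "\<one>\<^bsub>word_group I G R\<^esub> = cls []"
  by (simp add: word_group_def cls_def)

lemma mult_cls: "v \<in> W \<Longrightarrow> w \<in> W \<Longrightarrow> cls v \<otimes>\<^bsub>word_group I G R\<^esub> cls w = cls (v @ w)"
proof -
  assume vw: "v \<in> W" "w \<in> W"
  have "word_rel I G R `` {u @ u' |u u'. u \<in> cls v \<and> u' \<in> cls w} = cls (v @ w)" (is "?L = ?R")
  proof
    show "?L \<subseteq> ?R"
    proof
      fix x assume "x \<in> ?L"
      then obtain u u' where "word_eq I G R v u" "word_eq I G R w u'" "word_eq I G R (u @ u') x"
        by (auto simp: in_cls word_rel_def)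
      then show "x \<in> ?R" using eq_append word_eq.trans by (metis in_cls)
    qed
    show "?R \<subseteq> ?L" using cls_self vw by (auto simp: cls_def)
  qed
  then show ?thesis by (simp add: word_group_def)
qed

lemma word_group_group: "group (word_group I G R)"
proof (rule groupI)
  fix x assume "x \<in> carrier (word_group I G R)"
  then obtain w where w: "w \<in> W" "x = cls w" by (auto simp: carrier_eq)
  have "\<exists>v \<in> W. word_eq I G R (v @ w) []" using w(1)
  proof (induction w)
    case Nil then show ?case by (auto intro: word_eq.refl)
  next
    case (Cons a w)
    then obtain v where v: "v \<in> W" "word_eq I G R (v @ w) []" by auto
    obtain i g where a: "a = (i, g)" "i \<in> I" "g \<in> carrier (G i)" using Cons by (auto simp: letters_def)
    interpret Gi: group "G i" by (rule groups[OF a(2)])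
    let ?b = "(i, inv\<^bsub>G i\<^esub> g)"
    have 1: "word_eq I G R (v @ [?b, a] @ w) (v @ [(i, \<one>\<^bsub>G i\<^esub>)] @ w)"
      using word_eq.mult[of v I G w i "inv\<^bsub>G i\<^esub> g" g R] v(1) Cons.hyps a Cons.prems by simp
    have 2: "word_eq I G R (v @ [(i, \<one>\<^bsub>G i\<^esub>)] @ w) (v @ w)"
      using v(1) a Cons.prems Cons.hyps by (intro word_eq.one) auto
    have "word_eq I G R ((v @ [?b]) @ a # w) []" using word_eq.trans[OF word_eq.trans[OF 1 2] v(2)] by simp
    moreover have "v @ [?b] \<in> W" using v a by (auto simp: letters_def)
    ultimately show ?case by blast
  qed
  then show "\<exists>y\<in>carrier (word_group I G R). y \<otimes>\<^bsub>word_group I G R\<^esub> x = \<one>\<^bsub>word_group I G R\<^esub>"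
    using w by (auto simp: carrier_eq one_eq mult_cls cls_eq_iff)
qed (unfold carrier_eq one_eq, ((elim imageE, simp add: mult_cls) | simp)+)

definition gen :: "'i \<Rightarrow> 'g \<Rightarrow> ('i \<times> 'g) list set" where "gen i x = cls [(i, x)]"

lemma gen_hom: "i \<in> I \<Longrightarrow> gen i \<in> hom (G i) (word_group I G R)"
proof (rule homI)
  fix x assume "i \<in> I" "x \<in> carrier (G i)"
  then show "gen i x \<in> carrier (word_group I G R)" by (auto simp: carrier_eq gen_def letters_def)
next
  fix x y assume *: "i \<in> I" "x \<in> carrier (G i)" "y \<in> carrier (G i)"
  then interpret Gi: group "G i" using groups by blast
  show "gen i (x \<otimes>\<^bsub>G i\<^esub> y) = gen i x \<otimes>\<^bsub>word_group I G R\<^esub> gen i y"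
    using * word_eq.mult[of "[]" I G "[]" i x y R]
    by (simp add: gen_def mult_cls letters_def cls_eq_iff word_eq.sym)
qed

lemma hom_unique:
  assumes H: "group H" and h: "h \<in> hom (word_group I G R) H" and k: "k \<in> hom (word_group I G R) H"
    and eq: "\<And>i x. i \<in> I \<Longrightarrow> x \<in> carrier (G i) \<Longrightarrow> h (gen i x) = k (gen i x)"
    and c: "c \<in> carrier (word_group I G R)"
  shows "h c = k c"
proof -
  have "h (cls w) = k (cls w)" if "w \<in> W" for w using that
  proof (induction w)
    case Nil
    then show ?case using hom_one[OF h word_group_group H] hom_one[OF k word_group_group H]
      by (simp add: one_eq)
  next
    case (Cons a w)
    then have a: "[a] \<in> W" "w \<in> W" by auto
    have e: "cls (a # w) = cls [a] \<otimes>\<^bsub>word_group I G R\<^esub> cls w" using mult_cls[OF a] by simp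
    have "h (cls [a]) = k (cls [a])" using eq a by (auto simp: gen_def letters_def)
    then show ?case unfolding e using Cons a h k
      by (simp add: hom_mult carrier_eq)
  qed
  then show ?thesis using c by (auto simp: carrier_eq)
qed

definition lift :: "'h monoid \<Rightarrow> ('i \<Rightarrow> 'g \<Rightarrow> 'h) \<Rightarrow> ('i \<times> 'g) list \<Rightarrow> 'h" where
  "lift H f w = foldr (\<lambda>(i, x) r. f i x \<otimes>\<^bsub>H\<^esub> r) w \<one>\<^bsub>H\<^esub>"

context
  fixes H :: "'h monoid" and f
  assumes H: "group H" and f: "\<And>i. i \<in> I \<Longrightarrow> f i \<in> hom (G i) H"
    and R: "\<And>i x j y. ((i, x), (j, y)) \<in> R \<Longrightarrow> (i, x) \<in> letters I G \<Longrightarrow> (j, y) \<in> letters I G \<Longrightarrow> f i x = f j y"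
begin

lemma lift_closed: "w \<in> W \<Longrightarrow> lift H f w \<in> carrier H"
proof (induction w)
  interpret H: group H by (rule H)
  case Nil then show ?case by (simp add: lift_def)
next
  interpret H: group H by (rule H)
  case (Cons a w)
  obtain i x where a: "a = (i, x)" "i \<in> I" "x \<in> carrier (G i)" using Cons by (auto simp: letters_def)
  have "f i x \<in> carrier H" using hom_in_carrier[OF f[OF a(2)] a(3)] .
  then show ?case using Cons a by (simp add: lift_def)
qed

lemma lift_append: "u \<in> W \<Longrightarrow> v \<in> W \<Longrightarrow> lift H f (u @ v) = lift H f u \<otimes>\<^bsub>H\<^esub> lift H f v"
proof (induction u)
  interpret H: group H by (rule H)
  case Nil then show ?case using lift_closed by (simp add: lift_def)
next
  interpret H: group H by (rule H)
  case (Cons a u)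
  obtain i x where a: "a = (i, x)" "i \<in> I" "x \<in> carrier (G i)" using Cons by (auto simp: letters_def)
  have "f i x \<in> carrier H" using a f hom_in_carrier by fast
  then show ?case using Cons a lift_closed[of u] lift_closed[of v] by (simp add: lift_def H.m_assoc)
qed

lemma lift_eq: "word_eq I G R v w \<Longrightarrow> lift H f v = lift H f w"
proof (induction rule: word_eq.induct)
  case (one u v i)
  interpret H: group H by (rule H)
  interpret Gi: group "G i" using one groups by blast
  have "f i \<one>\<^bsub>G i\<^esub> = \<one>\<^bsub>H\<^esub>" using hom_one[OF f[OF one(3)] groups[OF one(3)] H] .
  then have "lift H f ([(i, \<one>\<^bsub>G i\<^esub>)] @ v) = lift H f v" using lift_closed one by (simp add: lift_def)
  moreover have "[(i, \<one>\<^bsub>G i\<^esub>)] @ v \<in> W" using one by (auto simp: letters_def)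
  ultimately show ?case using one lift_append by metis
next
  case (mult u v i x y)
  interpret H: group H by (rule H)
  interpret Gi: group "G i" using mult groups by blast
  have m: "f i x \<in> carrier H" "f i y \<in> carrier H" using mult f hom_in_carrier by fast+
  have "lift H f ([(i, x), (i, y)] @ v) = lift H f ([(i, x \<otimes>\<^bsub>G i\<^esub> y)] @ v)"
    using lift_closed[of v] mult m hom_mult[OF f[OF mult(3)]] by (simp add: lift_def H.m_assoc)
  moreover have "[(i, x), (i, y)] @ v \<in> W" "[(i, x \<otimes>\<^bsub>G i\<^esub> y)] @ v \<in> W" using mult by (auto simp: letters_def)
  ultimately show ?case using mult(1) lift_append by metis
next
  case (ident u v a b)
  obtain i x j y where ab: "a = (i, x)" "b = (j, y)" by fastforce
  have "lift H f ([a] @ v) = lift H f ([b] @ v)" using R ident ab by (simp add: lift_def)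
  moreover have "[a] @ v \<in> W" "[b] @ v \<in> W" using ident by auto
  ultimately show ?case using ident(1) lift_append by metis
qed auto

lemma hom_exists:
  "\<exists>h \<in> hom (word_group I G R) H. (\<forall>i \<in> I. \<forall>x \<in> carrier (G i). h (gen i x) = f i x)"
proof -
  interpret H: group H by (rule H)
  define h where "h A = lift H f (SOME w. w \<in> A)" for A
  have h: "h (cls w) = lift H f w" if "w \<in> W" for w
    unfolding h_def using someI[of "\<lambda>v. v \<in> cls w", OF cls_self[OF that]] lift_eq by (simp add: in_cls)
  show ?thesis
  proof (intro bexI[of _ h] ballI homI)
    fix i x assume "i \<in> I" "x \<in> carrier (G i)"
    then show "h (gen i x) = f i x" using hom_in_carrier[OF f] by (simp add: gen_def h letters_def) (simp add: lift_def)
  qed (unfold carrier_eq, (elim imageE, simp add: h mult_cls lift_closed lift_append)+)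
qed

end

end

text \<open>Universal property of \<open>word_group\<close>; for \<open>R = {}\<close> it is that of the free product.\<close>

lemma word_group_universal:
  fixes H :: "'h monoid"
  assumes "\<And>i. i \<in> I \<Longrightarrow> group (G i)" and "group H" and "\<And>i. i \<in> I \<Longrightarrow> f i \<in> hom (G i) H"
    and "\<And>i x j y. ((i, x), (j, y)) \<in> R \<Longrightarrow> (i, x) \<in> letters I G \<Longrightarrow> (j, y) \<in> letters I G \<Longrightarrow> f i x = f j y"
  shows "\<exists>h \<in> hom (word_group I G R) H. (\<forall>i \<in> I. \<forall>x \<in> carrier (G i). h (word_rel I G R `` {[(i, x)]}) = f i x) \<and>
    (\<forall>k \<in> hom (word_group I G R) H.
       (\<forall>i \<in> I. \<forall>x \<in> carrier (G i). k (word_rel I G R `` {[(i, x)]}) = f i x) \<longrightarrow>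
       (\<forall>c \<in> carrier (word_group I G R). k c = h c))"
proof -
  interpret word_presentation I G R using assms(1) by (simp add: word_presentation_def)
  obtain h where h: "h \<in> hom (word_group I G R) H" "\<forall>i \<in> I. \<forall>x \<in> carrier (G i). h (gen i x) = f i x"
    using hom_exists[of H f] assms(2-4) by blast
  then show ?thesis
    using hom_unique[OF assms(2)] unfolding gen_def cls_def by (intro bexI[of _ h]) auto
qed

lemma word_group_group:
  "(\<And>i. i \<in> I \<Longrightarrow> group (G i)) \<Longrightarrow> group (word_group I G R)"
  using word_presentation.word_group_group[of I G R] by (simp add: word_presentation_def)

lemma word_map_hom:
  assumes G: "\<And>i. i \<in> I \<Longrightarrow> group (G i)" and G': "\<And>i. i \<in> I' \<Longrightarrow> group (G' i)"
    and f: "\<And>i. i \<in> I \<Longrightarrow> k i \<in> I' \<and> f i \<in> hom (G i) (G' (k i))"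
    and R: "\<And>i x j y. ((i, x), (j, y)) \<in> R \<Longrightarrow> (i, x) \<in> letters I G \<Longrightarrow> (j, y) \<in> letters I G \<Longrightarrow>
        word_eq I' G' R' [(k i, f i x)] [(k j, f j y)]"
    and g: "\<And>i x. (i, x) \<in> letters I G \<Longrightarrow> g (i, x) = (k i, f i x)"
  shows "word_map I' G' R' g \<in> hom (word_group I G R) (word_group I' G' R')"
    and "w \<in> lists (letters I G) \<Longrightarrow>
      word_map I' G' R' g (word_rel I G R `` {w}) = word_rel I' G' R' `` {map g w}"
    and "w \<in> lists (letters I G) \<Longrightarrow> map g w \<in> lists (letters I' G')"
proof -
  interpret A: word_presentation I G R using G by (simp add: word_presentation_def)
  interpret B: word_presentation I' G' R' using G' by (simp add: word_presentation_def)
  have gl: "g a \<in> letters I' G'" if "a \<in> letters I G" for a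
    using that f g by (cases a) (auto simp: letters_def intro: hom_in_carrier)
  then have ml: "map g w \<in> B.W" if "w \<in> A.W" for w using that by auto
  have m: "word_eq I' G' R' (map g v) (map g w)" if "word_eq I G R v w" for v w using that
  proof (induction rule: word_eq.induct)
    case (refl w) then show ?case using ml by (simp add: word_eq.refl)
  next
    case (one u v i)
    have "f i \<one>\<^bsub>G i\<^esub> = \<one>\<^bsub>G' (k i)\<^esub>" using hom_one f[OF one(3)] G[OF one(3)] G' by blast
    moreover have "(i, \<one>\<^bsub>G i\<^esub>) \<in> letters I G" using one(3) G by (auto simp: letters_def intro: monoid.one_closed group.is_monoid)
    ultimately show ?case using word_eq.one[of "map g u" I' G' "map g v" "k i" R'] ml[OF one(1)] ml[OF one(2)] f[OF one(3)] g
      by simp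
  next
    case (mult u v i x y)
    have "(i, x) \<in> letters I G" "(i, y) \<in> letters I G" "(i, x \<otimes>\<^bsub>G i\<^esub> y) \<in> letters I G"
      using mult G by (auto simp: letters_def intro: monoid.m_closed group.is_monoid)
    moreover have "f i x \<in> carrier (G' (k i))" "f i y \<in> carrier (G' (k i))" using mult f hom_in_carrier by fast+
    ultimately show ?case using word_eq.mult[of "map g u" I' G' "map g v" "k i" "f i x" "f i y" R'] ml[OF mult(1)] ml[OF mult(2)]
        f[OF mult(3)] g mult hom_mult[of "f i" "G i" "G' (k i)" x y] by simp
  next
    case (ident u v a b)
    obtain i x j y where ab: "a = (i, x)" "b = (j, y)" by fastforce
    have "word_eq I' G' R' [g a] [g b]" using R ident g ab by simp
    from B.eq_append_left[OF B.eq_append_right[OF this ml[OF ident(2)]] ml[OF ident(1)]] show ?case by simp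
  qed (auto intro: word_eq.sym word_eq.trans)
  show 2: "word_map I' G' R' g (word_rel I G R `` {w}) = word_rel I' G' R' `` {map g w}" if "w \<in> A.W" for w
    using that m[of w] word_eq.refl[of w I G R]
    by (auto simp: word_map_def word_rel_def intro: word_eq.sym word_eq.trans)
  show "w \<in> lists (letters I G) \<Longrightarrow> map g w \<in> lists (letters I' G')" for w by (rule ml)
  show "word_map I' G' R' g \<in> hom (word_group I G R) (word_group I' G' R')"
    by (intro homI; unfold A.carrier_eq B.carrier_eq; elim imageE;
        simp add: A.mult_cls B.mult_cls 2[folded A.cls_def B.cls_def] ml)
qed


section \<open>The categories and functors above are categories and functors\<close>

lemma op_cat_sel [simp]:
  "Obj (op_cat K) = Obj K" "Arr (op_cat K) = Arr K" "Dom (op_cat K) = Cod K" "Cod (op_cat K) = Dom K"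
  "Id (op_cat K) = Id K" "Comp (op_cat K) g f = Comp K f g"
  by (simp_all add: op_cat_def)

lemma category_op: "category K \<Longrightarrow> category (op_cat K)"
  by (simp add: category_def)

lemma Delta_sel [simp]:
  "Obj Delta = UNIV" "(m, f, n) \<in> Arr Delta \<longleftrightarrow> f \<in> {..m} \<rightarrow>\<^sub>E {..n} \<and> mono_on {..m} f"
  "Dom Delta (m, f, n) = m" "Cod Delta (m, f, n) = n" "Id Delta n = (n, restrict id {..n}, n)"
  "Comp Delta (l', g, n) (m, f, l) = (m, compose {..m} g f, n)"
  by (simp_all add: Delta_def)

lemma category_Delta: "category Delta"
proof
  fix f g :: darr assume "f \<in> Arr Delta" "g \<in> Arr Delta" "Cod Delta f = Dom Delta g"
  moreover obtain a b c a' b' c' where "f = (a, b, c)" "g = (a', b', c')" by (metis prod_cases3)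
  ultimately show "Comp Delta g f \<in> Arr Delta" "Dom Delta (Comp Delta g f) = Dom Delta f"
    "Cod Delta (Comp Delta g f) = Cod Delta g"
    by (auto simp: compose_def PiE_def Pi_def extensional_def mono_on_def)
next
  fix f assume "f \<in> Arr Delta"
  moreover obtain a b c where "f = (a, b, c)" by (metis prod_cases3)
  ultimately show "Comp Delta f (Id Delta (Dom Delta f)) = f" "Comp Delta (Id Delta (Cod Delta f)) f = f"
    by (auto simp: compose_def PiE_def Pi_def extensional_def mono_on_def fun_eq_iff)
next
  fix f g h :: darr assume "f \<in> Arr Delta" "g \<in> Arr Delta" "h \<in> Arr Delta" "Cod Delta f = Dom Delta g" "Cod Delta g = Dom Delta h"
  moreover obtain a b c a' b' c' where "f = (a, b, c)" "g = (a', b', c')" by (metis prod_cases3)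
  moreover obtain a'' b'' c'' where "h = (a'', b'', c'')" by (metis prod_cases3)
  ultimately show "Comp Delta h (Comp Delta g f) = Comp Delta (Comp Delta h g) f"
    by (auto simp: compose_def PiE_def Pi_def extensional_def mono_on_def fun_eq_iff)
qed (auto simp: mono_on_def)

lemma fact_arr [simp]:
  "(f, (\<alpha>, \<beta>), g) \<in> Arr (fact_cat C) \<longleftrightarrow> f \<in> Arr C \<and> g \<in> Arr C \<and> \<alpha> \<in> Arr C \<and> \<beta> \<in> Arr C \<and>
     Dom C \<alpha> = Dom C g \<and> Cod C \<alpha> = Dom C f \<and> Dom C \<beta> = Cod C f \<and> Cod C \<beta> = Cod C g \<and> g = Comp C \<beta> (Comp C f \<alpha>)"
  and fact_sel [simp]: "Obj (fact_cat C) = Arr C" "Dom (fact_cat C) u = fst u" "Cod (fact_cat C) u = snd (snd u)"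
  "Id (fact_cat C) f = (f, (Id C (Dom C f), Id C (Cod C f)), f)"
  "Comp (fact_cat C) (g', (\<alpha>', \<beta>'), h) (f, (\<alpha>, \<beta>), g'') = (f, (Comp C \<alpha> \<alpha>', Comp C \<beta>' \<beta>), h)"
  by (simp_all add: fact_cat_def)

lemma (in category) category_fact: "category (fact_cat K)"
proof
  fix u v assume uv: "u \<in> Arr (fact_cat K)" "v \<in> Arr (fact_cat K)" "Cod (fact_cat K) u = Dom (fact_cat K) v"
  obtain f \<alpha> \<beta> g \<alpha>' \<beta>' h where e: "u = (f, (\<alpha>, \<beta>), g)" "v = (g, (\<alpha>', \<beta>'), h)"
    using uv(3) by (metis fact_sel(2,3) fst_conv snd_conv prod_cases4)
  note u = uv(1)[unfolded e fact_arr] and v = uv(2)[unfolded e fact_arr]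
    have t: "f \<in> Arr K" "h \<in> Arr K" "Dom K \<alpha>' = Dom K h" "Cod K \<beta>' = Cod K h" "\<alpha> \<in> Arr K" "\<alpha>' \<in> Arr K" "\<beta> \<in> Arr K" "\<beta>' \<in> Arr K"
      "Cod K \<alpha>' = Dom K \<alpha>" "Cod K \<alpha> = Dom K f" "Cod K f = Dom K \<beta>" "Cod K \<beta> = Dom K \<beta>'"
      using u v by (metis)+
  have "h = Comp K \<beta>' (Comp K g \<alpha>')" "g = Comp K \<beta> (Comp K f \<alpha>)" using u v by blast+
  then have "h = Comp K \<beta>' (Comp K (Comp K \<beta> (Comp K f \<alpha>)) \<alpha>')" by metis
  also have "\<dots> = Comp K (Comp K \<beta>' \<beta>) (Comp K f (Comp K \<alpha> \<alpha>'))"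
  proof -
    show ?thesis
      using t Comp_assoc[of \<alpha>' "Comp K f \<alpha>" \<beta>] Comp_assoc[of \<alpha>' \<alpha> f] Comp_assoc[of "Comp K f (Comp K \<alpha> \<alpha>')" \<beta> \<beta>']
      by (simp add: Comp_in Dom_Comp Cod_Comp)
  qed
  finally show "Comp (fact_cat K) v u \<in> Arr (fact_cat K)"
    using t unfolding e fact_sel fact_arr by (intro conjI) (simp_all add: Comp_in Dom_Comp Cod_Comp)
  show "Dom (fact_cat K) (Comp (fact_cat K) v u) = Dom (fact_cat K) u"
    "Cod (fact_cat K) (Comp (fact_cat K) v u) = Cod (fact_cat K) v" by (simp_all add: e)
next
  fix u assume u: "u \<in> Arr (fact_cat K)"
  obtain f \<alpha> \<beta> g where e: "u = (f, (\<alpha>, \<beta>), g)" by (metis surj_pair)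
  note u = u[unfolded e fact_arr]
  show "Dom (fact_cat K) u \<in> Obj (fact_cat K)" "Cod (fact_cat K) u \<in> Obj (fact_cat K)" using u by (metis e fact_sel fst_conv snd_conv)+
  have "Comp K \<alpha> (Id K (Dom K g)) = \<alpha>" "Comp K (Id K (Cod K g)) \<beta> = \<beta>" "Comp K (Id K (Dom K f)) \<alpha> = \<alpha>" "Comp K \<beta> (Id K (Cod K f)) = \<beta>"
    using u Comp_Id Id_Comp by metis+
  then show "Comp (fact_cat K) u (Id (fact_cat K) (Dom (fact_cat K) u)) = u"
    "Comp (fact_cat K) (Id (fact_cat K) (Cod (fact_cat K) u)) u = u" by (simp_all add: e)
next
  fix u v w assume *: "u \<in> Arr (fact_cat K)" "v \<in> Arr (fact_cat K)" "w \<in> Arr (fact_cat K)"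
    "Cod (fact_cat K) u = Dom (fact_cat K) v" "Cod (fact_cat K) v = Dom (fact_cat K) w"
  obtain f \<alpha> \<beta> g \<alpha>' \<beta>' h where e: "u = (f, (\<alpha>, \<beta>), g)" "v = (g, (\<alpha>', \<beta>'), h)"
    using *(4) by (metis fact_sel(2,3) fst_conv snd_conv prod_cases4)
  obtain \<alpha>'' \<beta>'' k where e': "w = (h, (\<alpha>'', \<beta>''), k)"
    using *(5) e by (metis fact_sel(2,3) fst_conv snd_conv prod_cases4)
  note u = *(1)[unfolded e fact_arr] and v = *(2)[unfolded e fact_arr] and w = *(3)[unfolded e' fact_arr]
  show "Comp (fact_cat K) w (Comp (fact_cat K) v u) = Comp (fact_cat K) (Comp (fact_cat K) w v) u"
    unfolding e e' fact_sel using u v w Comp_assoc[of \<alpha>'' \<alpha>' \<alpha>] Comp_assoc[of \<beta> \<beta>' \<beta>''] by simp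
qed (auto simp: Id_in Dom_Id Cod_Id Dom_in Cod_in Comp_Id Id_Comp)

lemma simplex_cat_category:
  assumes "simplicial_set X" shows "category (simplex_cat X)"
proof -
  interpret D: category Delta by (rule category_Delta)
  note D = D.Dom_in D.Cod_in D.Id_in D.Dom_Id D.Cod_Id D.Comp_in D.Dom_Comp D.Cod_Comp D.Comp_Id D.Id_Comp D.Comp_assoc
  have D1: "Id Delta n \<in> Arr Delta" "Dom Delta (Id Delta n) = n" "Cod Delta (Id Delta n) = n" for n
    by (auto simp: mono_on_def)
  show ?thesis
    using assms
    by unfold_locales (auto simp: simplex_cat_def simplicial_set_def D D1 simp del: Delta_sel)
qed

lemma is_functor_forget: "is_functor (simplex_cat X) Delta simplex_forget"
  by (auto simp: is_functor_def simplex_cat_def simplex_forget_def simp del: Delta_sel(2-6)) 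

lemma ord_sel [simp]:
  "Obj (ord_cat n) = {..n}" "(i, j) \<in> Arr (ord_cat n) \<longleftrightarrow> i \<le> j \<and> j \<le> n"
  "Dom (ord_cat n) = fst" "Cod (ord_cat n) = snd" "Id (ord_cat n) i = (i, i)"
  "Comp (ord_cat n) g f = (fst f, snd g)"
  by (simp_all add: ord_cat_def)

lemma category_ord: "category (ord_cat n)"
  by unfold_locales (auto simp: ord_cat_def)

lemma nerve_iff:
  "\<sigma> \<in> simplices (nerve K) n \<longleftrightarrow>
     (\<forall>i \<le> n. fobj \<sigma> i \<in> Obj K \<and> fmap \<sigma> (i, i) = Id K (fobj \<sigma> i)) \<and>
     (\<forall>i j. i \<le> j \<longrightarrow> j \<le> n \<longrightarrow> fmap \<sigma> (i, j) \<in> Arr K \<and> Dom K (fmap \<sigma> (i, j)) = fobj \<sigma> i \<and> Cod K (fmap \<sigma> (i, j)) = fobj \<sigma> j) \<and>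
     (\<forall>i j k. i \<le> j \<longrightarrow> j \<le> k \<longrightarrow> k \<le> n \<longrightarrow> Comp K (fmap \<sigma> (j, k)) (fmap \<sigma> (i, j)) = fmap \<sigma> (i, k)) \<and>
     (\<forall>i. \<not> i \<le> n \<longrightarrow> fobj \<sigma> i = undefined) \<and>
     (\<forall>i j. \<not> (i \<le> j \<and> j \<le> n) \<longrightarrow> fmap \<sigma> (i, j) = undefined)"
proof -
  have 1: "(\<forall>x \<in> Arr (ord_cat n). P x) \<longleftrightarrow> (\<forall>i j. i \<le> j \<longrightarrow> j \<le> n \<longrightarrow> P (i, j))" for P
    by auto
  have 2: "(\<forall>f \<in> Arr (ord_cat n). \<forall>g \<in> Arr (ord_cat n). Cod (ord_cat n) f = Dom (ord_cat n) g \<longrightarrow>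
        fmap \<sigma> (Comp (ord_cat n) g f) = Comp K (fmap \<sigma> g) (fmap \<sigma> f)) \<longleftrightarrow>
     (\<forall>i j k. i \<le> j \<longrightarrow> j \<le> k \<longrightarrow> k \<le> n \<longrightarrow> Comp K (fmap \<sigma> (j, k)) (fmap \<sigma> (i, j)) = fmap \<sigma> (i, k))"
    unfolding 1 by simp (metis le_trans)
  have 3: "(\<forall>x. x \<notin> Arr (ord_cat n) \<longrightarrow> P x) \<longleftrightarrow> (\<forall>i j. \<not> (i \<le> j \<and> j \<le> n) \<longrightarrow> P (i, j))" for P
    by auto
  show ?thesis
    unfolding nerve_def is_functor_def extensional_def mem_Collect_eq sset.simps
    unfolding 2
    unfolding 3 1
    by (simp only: ord_sel Ball_def atMost_iff fst_conv snd_conv conj_assoc)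
qed

lemma nerve_act [simp]:
  "fobj (act (nerve K) (m, f, n) \<sigma>) = restrict (\<lambda>i. fobj \<sigma> (f i)) {..m}"
  "fmap (act (nerve K) (m, f, n) \<sigma>) = restrict (\<lambda>(i, j). fmap \<sigma> (f i, f j)) (Arr (ord_cat m))"
  by (simp_all add: nerve_def)

lemma nsimplex_eqI:
  fixes \<sigma> \<tau> :: "('o, 'm) nsimplex"
  assumes "\<And>i. fobj \<sigma> i = fobj \<tau> i" "\<And>i j. fmap \<sigma> (i, j) = fmap \<tau> (i, j)" shows "\<sigma> = \<tau>"
  using assms by (intro func.equality) (auto simp: fun_eq_iff)

lemma nerve_simplicial_set: "simplicial_set (nerve K)"
  unfolding simplicial_set_def
proof (intro conjI ballI allI impI)
  fix \<alpha> :: darr assume a: "\<alpha> \<in> Arr Delta"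
  obtain m f n where f: "\<alpha> = (m, f, n)" by (metis prod_cases3)
  have "f i \<le> n" if "i \<le> m" for i using a f that by auto
  moreover have "f i \<le> f j" if "i \<le> j" "j \<le> m" for i j using a f that by (auto simp: mono_on_def)
  ultimately show "act (nerve K) \<alpha> ` simplices (nerve K) (Cod Delta \<alpha>) \<subseteq> simplices (nerve K) (Dom Delta \<alpha>)"
    unfolding f by (auto simp: nerve_iff simp del: Delta_sel(2))
next
  fix n \<sigma> assume "\<sigma> \<in> simplices (nerve K) n"
  then show "act (nerve K) (Id Delta n) \<sigma> = \<sigma>"
    by (intro nsimplex_eqI) (auto simp: nerve_iff)
next
  fix \<alpha> \<beta> :: darr and \<sigma> assume *: "\<alpha> \<in> Arr Delta" "\<beta> \<in> Arr Delta" "Cod Delta \<alpha> = Dom Delta \<beta>" "\<sigma> \<in> simplices (nerve K) (Cod Delta \<beta>)"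
  obtain a f b g c where f: "\<alpha> = (a, f, b)" "\<beta> = (b, g, c)" using *(3) by (metis Delta_sel(3,4) prod_cases3)
  have "f i \<le> b" if "i \<le> a" for i using *(1) f that by auto
  moreover have "f i \<le> f j" if "i \<le> j" "j \<le> a" for i j using *(1) f that by (auto simp: mono_on_def)
  ultimately show "act (nerve K) (Comp Delta \<beta> \<alpha>) \<sigma> = act (nerve K) \<alpha> (act (nerve K) \<beta> \<sigma>)"
    unfolding f by (intro nsimplex_eqI) (auto simp: compose_def simp del: Delta_sel(2))
qed

lemma (in category) delta_functor: "is_functor (simplex_cat (nerve K)) (fact_cat K) delta_fun"
proof -
  have arr: "fmap \<tau> (i, j) \<in> Arr K" "Dom K (fmap \<tau> (i, j)) = fobj \<tau> i" "Cod K (fmap \<tau> (i, j)) = fobj \<tau> j"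
    if "\<tau> \<in> simplices (nerve K) n" "i \<le> j" "j \<le> n" for \<tau> n i j using that by (auto simp: nerve_iff)
  have comp: "Comp K (fmap \<tau> (j, k)) (fmap \<tau> (i, j)) = fmap \<tau> (i, k)"
    if "\<tau> \<in> simplices (nerve K) n" "i \<le> j" "j \<le> k" "k \<le> n" for \<tau> n i j k
  proof -
    show ?thesis using that by (auto simp: nerve_iff)
  qed
  show ?thesis
    unfolding is_functor_def
  proof (intro conjI ballI impI)
    fix c assume c: "c \<in> Obj (simplex_cat (nerve K))"
    then obtain m \<sigma> where m: "c = (m, \<sigma>)" "\<sigma> \<in> simplices (nerve K) m" by (auto simp: simplex_cat_def)
    show "fobj delta_fun c \<in> Obj (fact_cat K)" "fmap delta_fun (Id (simplex_cat (nerve K)) c) = Id (fact_cat K) (fobj delta_fun c)"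
      using m arr[OF m(2), of 0 m] m(2)[unfolded nerve_iff] by (auto simp: fact_cat_def delta_fun_def simplex_cat_def)
  next
    fix u assume "u \<in> Arr (simplex_cat (nerve K))"
    then obtain m f n \<sigma> \<tau> where u: "u = ((m, \<sigma>), (m, f, n), (n, \<tau>))" and *: "(m, f, n) \<in> Arr Delta" "\<tau> \<in> simplices (nerve K) n"
      "\<sigma> \<in> simplices (nerve K) m" "act (nerve K) (m, f, n) \<tau> = \<sigma>" by (auto simp: simplex_cat_def simp del: Delta_sel(2))
    have le: "f 0 \<le> f m" "f m \<le> n" "f 0 \<le> n" using *(1) by (auto simp: mono_on_def)
    have s: "fmap \<sigma> (0, m) = fmap \<tau> (f 0, f m)" using *(4) by auto
    show "Dom (fact_cat K) (fmap delta_fun u) = fobj delta_fun (Dom (simplex_cat (nerve K)) u)"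
      "Cod (fact_cat K) (fmap delta_fun u) = fobj delta_fun (Cod (simplex_cat (nerve K)) u)"
      by (auto simp: u fact_cat_def delta_fun_def simplex_cat_def)
    show "fmap delta_fun u \<in> Arr (fact_cat K)"
      using le by (simp add: u fact_cat_def delta_fun_def s arr[OF *(2)] comp[OF *(2)])
  next
    fix u v assume uv: "u \<in> Arr (simplex_cat (nerve K))" "v \<in> Arr (simplex_cat (nerve K))" "Cod (simplex_cat (nerve K)) u = Dom (simplex_cat (nerve K)) v"
    then obtain m f n \<sigma> \<tau> where u: "u = ((m, \<sigma>), (m, f, n), (n, \<tau>))" and *: "(m, f, n) \<in> Arr Delta" "\<tau> \<in> simplices (nerve K) n"
      "\<sigma> \<in> simplices (nerve K) m" "act (nerve K) (m, f, n) \<tau> = \<sigma>" by (auto simp: simplex_cat_def simp del: Delta_sel(2))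
    from uv u obtain g k \<rho> where v: "v = ((n, \<tau>), (n, g, k), (k, \<rho>))" and **: "(n, g, k) \<in> Arr Delta" "\<rho> \<in> simplices (nerve K) k"
      "act (nerve K) (n, g, k) \<rho> = \<tau>" by (auto simp: simplex_cat_def simp del: Delta_sel(2))
    have le: "f 0 \<le> f m" "f m \<le> n" "f 0 \<le> n" using *(1) by (auto simp: mono_on_def)
    have le': "g 0 \<le> g (f 0)" "g (f m) \<le> g n" "g n \<le> k" using **(1) le by (auto simp: mono_on_def)
    have le'': "g 0 \<le> k" "g (f 0) \<le> k" "g (f m) \<le> k" "g (f 0) \<le> g (f m)" using **(1) le by (auto simp: mono_on_def)
    have t: "fmap \<tau> (i, j) = fmap \<rho> (g i, g j)" if "i \<le> j" "j \<le> n" for i j using **(3) that by auto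
    show "fmap delta_fun (Comp (simplex_cat (nerve K)) v u) = Comp (fact_cat K) (fmap delta_fun v) (fmap delta_fun u)"
      using le le' le'' by (simp add: u v fact_cat_def delta_fun_def simplex_cat_def t comp[OF **(2)] compose_def)
  qed
qed

lemma precomp_diagram:
  assumes "category A" "is_functor A B F" "group_diagram B D" shows "group_diagram A (precomp D F)"
  using assms unfolding group_diagram_def is_functor_def precomp_def
  by (simp add: category.Cod_in category.Dom_in) metis

lemma is_functor_op: "is_functor A B F \<Longrightarrow> is_functor (op_cat A) (op_cat B) F"
  by (auto simp: is_functor_def)


section \<open>Universal property of left Kan extensions\<close>

locale Lan_setup = A: category A + B: category B
  for A :: "('o, 'm) cat" and B :: "('p, 'q) cat" +
  fixes S :: "('o, 'm, 'p, 'q) func" and F :: "('o, 'm, 'g) diagram"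
  assumes S: "is_functor A B S" and F: "group_diagram A F"
begin

abbreviation "I d \<equiv> Obj (comma_cat A B S d)"
abbreviation "G \<equiv> gobj (comma_diagram F) :: 'o \<times> 'q \<Rightarrow> 'g monoid"
abbreviation "R d \<equiv> colim_rel (comma_cat A B S d) (comma_diagram F)"

lemma I_iff [simp]: "(a, \<beta>) \<in> I d \<longleftrightarrow> a \<in> Obj A \<and> \<beta> \<in> Arr B \<and> Dom B \<beta> = fobj S a \<and> Cod B \<beta> = d"
  by (simp add: comma_cat_def)

lemma G_eq [simp]: "G (a, \<beta>) = gobj F a"
  by (simp add: comma_diagram_def)

lemma R_iff:
  "(((a, \<beta>), x), ((a', \<beta>'), y)) \<in> R d \<longleftrightarrow> (a, \<beta>) \<in> I d \<and> (a', \<beta>') \<in> I d \<and> x \<in> carrier (gobj F a) \<and>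
     (\<exists>\<alpha> \<in> Arr A. Dom A \<alpha> = a \<and> Cod A \<alpha> = a' \<and> Comp B \<beta>' (fmap S \<alpha>) = \<beta> \<and> y = gmap F \<alpha> x)"
  unfolding colim_rel_def by (force simp: comma_cat_def comma_diagram_def)

lemma groups: "i \<in> I d \<Longrightarrow> group (G i)"
  using F by (cases i) (simp add: group_diagram_def)

sublocale P: word_presentation "I d" G "R d" for d
  by (rule word_presentation.intro) (rule groups)

abbreviation "L \<equiv> Lan A B S F"

lemma gobj_Lan: "gobj L d = word_group (I d) G (R d)"
  by (simp add: Lan_def colimit_def)

lemma S_arr: "\<alpha> \<in> Arr A \<Longrightarrow> fmap S \<alpha> \<in> Arr B \<and> Dom B (fmap S \<alpha>) = fobj S (Dom A \<alpha>) \<and> Cod B (fmap S \<alpha>) = fobj S (Cod A \<alpha>)"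
  using S by (simp add: is_functor_def)

lemma S_obj: "a \<in> Obj A \<Longrightarrow> fobj S a \<in> Obj B"
  using S by (simp add: is_functor_def)

lemma gmap_Lan:
  assumes \<gamma>: "\<gamma> \<in> Arr B"
  shows "gmap L \<gamma> \<in> hom (gobj L (Dom B \<gamma>)) (gobj L (Cod B \<gamma>))"
    and "(a, \<beta>) \<in> I (Dom B \<gamma>) \<Longrightarrow> x \<in> carrier (gobj F a) \<Longrightarrow>
      gmap L \<gamma> (P.gen (Dom B \<gamma>) (a, \<beta>) x) = P.gen (Cod B \<gamma>) (a, Comp B \<gamma> \<beta>) x"
proof -
  let ?k = "\<lambda>(a, \<beta>). (a, Comp B \<gamma> \<beta>)"
  have 1: "i \<in> I (Dom B \<gamma>) \<Longrightarrow> ?k i \<in> I (Cod B \<gamma>) \<and> (\<lambda>x. x) \<in> hom (G i) (G (?k i))" for i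
    using \<gamma> by (cases i) (auto simp: B.Comp_in B.Dom_Comp B.Cod_Comp hom_def)
  have 2: "word_eq (I (Cod B \<gamma>)) G (R (Cod B \<gamma>)) [(?k i, x)] [(?k j, y)]"
    if "((i, x), (j, y)) \<in> R (Dom B \<gamma>)" "(i, x) \<in> letters (I (Dom B \<gamma>)) G" "(j, y) \<in> letters (I (Dom B \<gamma>)) G" for i x j y
  proof -
    obtain a \<beta> a' \<beta>' where e: "i = (a, \<beta>)" "j = (a', \<beta>')" by fastforce
    from that(1) obtain \<alpha> where \<alpha>: "\<alpha> \<in> Arr A" "Dom A \<alpha> = a" "Cod A \<alpha> = a'" "Comp B \<beta>' (fmap S \<alpha>) = \<beta>" "y = gmap F \<alpha> x"
      by (auto simp: e R_iff)
    have l: "(?k i, x) \<in> letters (I (Cod B \<gamma>)) G" "(?k j, y) \<in> letters (I (Cod B \<gamma>)) G"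
      using that 1[of i] 1[of j] by (auto simp: letters_def e)
    have "Comp B (Comp B \<gamma> \<beta>') (fmap S \<alpha>) = Comp B \<gamma> \<beta>"
      using \<alpha> B.Comp_assoc[of "fmap S \<alpha>" \<beta>' \<gamma>] S_arr[of \<alpha>] that \<gamma> by (auto simp: e letters_def)
    then have "((?k i, x), (?k j, y)) \<in> R (Cod B \<gamma>)"
      using l \<alpha> by (auto simp: e R_iff letters_def)
    then show ?thesis using word_eq.ident[of "[]" "I (Cod B \<gamma>)" G "[]"] l by simp
  qed
  note W = word_map_hom[of "I (Dom B \<gamma>)" G "I (Cod B \<gamma>)" G ?k "\<lambda>i x. x" "R (Dom B \<gamma>)" "R (Cod B \<gamma>)" "\<lambda>((a, \<beta>), x). ((a, Comp B \<gamma> \<beta>), x)"]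
  have L: "gmap L \<gamma> = word_map (I (Cod B \<gamma>)) G (R (Cod B \<gamma>)) (\<lambda>((a, \<beta>), x). ((a, Comp B \<gamma> \<beta>), x))"
    by (simp add: Lan_def)
  show "gmap L \<gamma> \<in> hom (gobj L (Dom B \<gamma>)) (gobj L (Cod B \<gamma>))"
    unfolding L gobj_Lan by (rule W(1)) (use groups 1 2 in \<open>auto simp: letters_def\<close>)
  show "gmap L \<gamma> (P.gen (Dom B \<gamma>) (a, \<beta>) x) = P.gen (Cod B \<gamma>) (a, Comp B \<gamma> \<beta>) x"
    if "(a, \<beta>) \<in> I (Dom B \<gamma>)" "x \<in> carrier (gobj F a)"
  proof -
    have "gmap L \<gamma> (P.gen (Dom B \<gamma>) (a, \<beta>) x) = word_rel (I (Cod B \<gamma>)) G (R (Cod B \<gamma>)) `` {map (\<lambda>((a, \<beta>), x). ((a, Comp B \<gamma> \<beta>), x)) [((a, \<beta>), x)]}"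
      unfolding L P.gen_def P.cls_def by (rule W(2)) (use groups 1 2 that in \<open>auto simp: letters_def\<close>)
    then show ?thesis by (simp add: P.gen_def P.cls_def)
  qed
qed

lemma Lan_group: "group (gobj L d)"
  unfolding gobj_Lan by (rule P.word_group_group)

lemma gen_closed: "(a, \<beta>) \<in> I d \<Longrightarrow> x \<in> carrier (gobj F a) \<Longrightarrow> P.gen d (a, \<beta>) x \<in> carrier (gobj L d)"
  unfolding gobj_Lan using hom_in_carrier[OF P.gen_hom, of "(a, \<beta>)" d x] by simp

lemma Lan_hom_unique:
  assumes "group H" "h \<in> hom (gobj L d) H" "k \<in> hom (gobj L d) H"
    "\<And>a \<beta> x. (a, \<beta>) \<in> I d \<Longrightarrow> x \<in> carrier (gobj F a) \<Longrightarrow> h (P.gen d (a, \<beta>) x) = k (P.gen d (a, \<beta>) x)"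
    "c \<in> carrier (gobj L d)"
  shows "h c = k c"
proof (rule P.hom_unique[OF assms(1), where h = h and k = k and c = c and d = d])
  show "h (P.gen d i x) = k (P.gen d i x)" if "i \<in> I d" "x \<in> carrier (G i)" for i x
    using that assms(4) by (cases i) simp
qed (use assms(2,3,5) in \<open>simp_all add: gobj_Lan\<close>)

lemma Lan_diagram: "group_diagram B L"
  unfolding group_diagram_def
proof (intro conjI ballI impI)
  fix c x assume c: "c \<in> Obj B" and x: "x \<in> carrier (gobj L c)"
  have "gmap L (Id B c) \<in> hom (gobj L c) (gobj L c)" using gmap_Lan(1)[OF B.Id_in[OF c]] c by (simp add: B.Dom_Id B.Cod_Id)
  moreover have "(\<lambda>x. x) \<in> hom (gobj L c) (gobj L c)" by (simp add: hom_def)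
  ultimately show "gmap L (Id B c) x = x"
  proof (rule Lan_hom_unique[OF Lan_group _ _ _ x])
    fix a \<beta> x assume *: "(a, \<beta>) \<in> I c" "x \<in> carrier (gobj F a)"
    then have "Comp B (Id B c) \<beta> = \<beta>" using B.Id_Comp[of \<beta>] by simp
    then show "gmap L (Id B c) (P.gen c (a, \<beta>) x) = P.gen c (a, \<beta>) x"
      using gmap_Lan(2)[OF B.Id_in[OF c], of a \<beta> x] * c by (simp add: B.Dom_Id B.Cod_Id)
  qed
next
  fix f g x assume fg: "f \<in> Arr B" "g \<in> Arr B" "Cod B f = Dom B g" and x: "x \<in> carrier (gobj L (Dom B f))"
  note c = B.Comp_in[OF fg] B.Dom_Comp[OF fg] B.Cod_Comp[OF fg]
  have "gmap L (Comp B g f) \<in> hom (gobj L (Dom B f)) (gobj L (Cod B g))" using gmap_Lan(1)[OF c(1)] c by simp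
  moreover have "(\<lambda>x. gmap L g (gmap L f x)) \<in> hom (gobj L (Dom B f)) (gobj L (Cod B g))"
    using gmap_Lan(1)[OF fg(1)] gmap_Lan(1)[OF fg(2)] fg(3) by (simp add: hom_def Pi_def)
  ultimately show "gmap L (Comp B g f) x = gmap L g (gmap L f x)"
  proof (rule Lan_hom_unique[OF Lan_group _ _ _ x])
    fix a \<beta> x assume *: "(a, \<beta>) \<in> I (Dom B f)" "x \<in> carrier (gobj F a)"
    then have "Comp B (Comp B g f) \<beta> = Comp B g (Comp B f \<beta>)" using B.Comp_assoc[of \<beta> f g] fg by simp
    moreover have "(a, Comp B f \<beta>) \<in> I (Dom B g)" using * fg by (simp add: B.Comp_in B.Dom_Comp B.Cod_Comp)
    ultimately show "gmap L (Comp B g f) (P.gen (Dom B f) (a, \<beta>) x) = gmap L g (gmap L f (P.gen (Dom B f) (a, \<beta>) x))"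
      using gmap_Lan(2)[OF c(1), of a \<beta> x] gmap_Lan(2)[OF fg(1), of a \<beta> x] gmap_Lan(2)[OF fg(2), of a "Comp B f \<beta>" x] * c fg by simp
  qed
qed (use Lan_group gmap_Lan in auto)

lemma unit_eq: "Lan_unit A B S F a x = P.gen (fobj S a) (a, Id B (fobj S a)) x"
  by (simp add: Lan_unit_def P.gen_def P.cls_def)

lemma unit_in: "a \<in> Obj A \<Longrightarrow> (a, Id B (fobj S a)) \<in> I (fobj S a)"
  by (simp add: B.Id_in B.Dom_Id B.Cod_Id S_obj)

lemma unit_natural: "nat_trans A F (precomp L S) (Lan_unit A B S F)"
  unfolding nat_trans_def
proof (intro conjI ballI)
  fix c assume "c \<in> Obj A"
  then show "Lan_unit A B S F c \<in> hom (gobj F c) (gobj (precomp L S) c)"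
    using P.gen_hom[OF unit_in] by (simp add: precomp_def gobj_Lan unit_eq[abs_def])
next
  fix f x assume f: "f \<in> Arr A" and x: "x \<in> carrier (gobj F (Dom A f))"
  note s = S_arr[OF f]
  have o: "Dom A f \<in> Obj A" "Cod A f \<in> Obj A" using f A.Dom_in A.Cod_in by auto
  have y: "gmap F f x \<in> carrier (gobj F (Cod A f))" 
    by (rule hom_in_carrier[OF _ x]) (use F f in \<open>simp add: group_diagram_def\<close>)
  let ?d = "fobj S (Cod A f)"
  have 1: "(Dom A f, fmap S f) \<in> I ?d" using o s by simp
  have "(((Dom A f, fmap S f), x), ((Cod A f, Id B ?d), gmap F f x)) \<in> R ?d"
    unfolding R_iff using 1 unit_in[OF o(2)] x f s B.Id_Comp[of "fmap S f"] by auto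
  then have "word_eq (I ?d) G (R ?d) [((Dom A f, fmap S f), x)] [((Cod A f, Id B ?d), gmap F f x)]"
    using word_eq.ident[of "[]" "I ?d" G "[]"] 1 unit_in[OF o(2)] x y by (simp add: letters_def)
  then have "P.gen ?d (Dom A f, fmap S f) x = P.gen ?d (Cod A f, Id B ?d) (gmap F f x)"
    using P.cls_eq_iff P.eqD unfolding P.gen_def by blast
  moreover have "gmap L (fmap S f) (P.gen (fobj S (Dom A f)) (Dom A f, Id B (fobj S (Dom A f))) x) = P.gen ?d (Dom A f, fmap S f) x"
    using gmap_Lan(2)[of "fmap S f" "Dom A f" "Id B (fobj S (Dom A f))" x] s unit_in[OF o(1)] x B.Comp_Id[of "fmap S f"] by simp
  ultimately show "Lan_unit A B S F (Cod A f) (gmap F f x) = gmap (precomp L S) f (Lan_unit A B S F (Dom A f) x)"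
    by (simp add: precomp_def unit_eq)
qed

lemma universal:
  fixes M :: "('p, 'q, 'h) diagram"
  assumes M: "group_diagram B M" and s: "nat_trans A F (precomp M S) s"
  shows "\<exists>t. nat_trans B L M t \<and>
    (\<forall>a \<in> Obj A. \<forall>x \<in> carrier (gobj F a). t (fobj S a) (Lan_unit A B S F a x) = s a x) \<and>
    (\<forall>t'. nat_trans B L M t' \<and>
       (\<forall>a \<in> Obj A. \<forall>x \<in> carrier (gobj F a). t' (fobj S a) (Lan_unit A B S F a x) = s a x) \<longrightarrow>
       (\<forall>d \<in> Obj B. \<forall>c \<in> carrier (gobj L d). t' d c = t d c))"
proof -
  let ?f = "\<lambda>(a, \<beta>) x. gmap M \<beta> (s a x)"
  have M_grp: "group (gobj M d)" if "d \<in> Obj B" for d using M that by (simp add: group_diagram_def)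
  have M_hom: "gmap M \<gamma> \<in> hom (gobj M (Dom B \<gamma>)) (gobj M (Cod B \<gamma>))" if "\<gamma> \<in> Arr B" for \<gamma> using M that by (simp add: group_diagram_def)
  have M_comp: "gmap M (Comp B g f) x = gmap M g (gmap M f x)"
    if "f \<in> Arr B" "g \<in> Arr B" "Cod B f = Dom B g" "x \<in> carrier (gobj M (Dom B f))" for f g x
    using M that by (simp add: group_diagram_def)
  have s_hom: "s a \<in> hom (gobj F a) (gobj M (fobj S a))" if "a \<in> Obj A" for a using s that by (simp add: nat_trans_def precomp_def)
  have s_nat: "s (Cod A \<alpha>) (gmap F \<alpha> x) = gmap M (fmap S \<alpha>) (s (Dom A \<alpha>) x)" if "\<alpha> \<in> Arr A" "x \<in> carrier (gobj F (Dom A \<alpha>))" for \<alpha> x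
    using s that by (simp add: nat_trans_def precomp_def)
  have f: "?f i \<in> hom (G i) (gobj M d)" if id: "i \<in> I d" for i d
  proof -
    obtain a \<beta> where i: "i = (a, \<beta>)" "(a, \<beta>) \<in> I d" using id by (metis surj_pair)
    have "gmap M \<beta> \<circ> s a \<in> hom (gobj F a) (gobj M d)" using i s_hom[of a] M_hom[of \<beta>] by (auto intro: hom_compose)
    then show ?thesis by (simp add: i o_def)
  qed
  have "\<exists>h. h \<in> hom (gobj L d) (gobj M d) \<and> (\<forall>i \<in> I d. \<forall>x \<in> carrier (G i). h (P.gen d i x) = ?f i x)" if d: "d \<in> Obj B" for d
  proof -
    have "?f i x = ?f j y" if r: "((i, x), (j, y)) \<in> R d" for i x j y
    proof -
      obtain a \<beta> a' \<beta>' where e: "i = (a, \<beta>)" "j = (a', \<beta>')" by fastforce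
      from r obtain \<alpha> where \<alpha>: "\<alpha> \<in> Arr A" "Dom A \<alpha> = a" "Cod A \<alpha> = a'" "Comp B \<beta>' (fmap S \<alpha>) = \<beta>" "y = gmap F \<alpha> x"
        and x: "x \<in> carrier (gobj F a)" and b: "\<beta>' \<in> Arr B" "Dom B \<beta>' = fobj S a'" and a: "a \<in> Obj A"
        by (auto simp: e R_iff)
      have "s a x \<in> carrier (gobj M (fobj S a))" using s_hom[OF a] x by (rule hom_in_carrier)
      then have "gmap M \<beta> (s a x) = gmap M \<beta>' (gmap M (fmap S \<alpha>) (s a x))"
        using M_comp[of "fmap S \<alpha>" \<beta>' "s a x"] S_arr[OF \<alpha>(1)] b \<alpha> by simp
      then show ?thesis using s_nat[OF \<alpha>(1), of x] \<alpha> x by (simp add: e)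
    qed
    then show ?thesis using P.hom_exists[OF M_grp[OF d], of d ?f] f unfolding gobj_Lan by (simp only: Bex_def)
  qed
  then have "\<forall>d. \<exists>h. d \<in> Obj B \<longrightarrow> h \<in> hom (gobj L d) (gobj M d) \<and> (\<forall>i \<in> I d. \<forall>x \<in> carrier (G i). h (P.gen d i x) = ?f i x)"
    by blast
  from choice[OF this] obtain t where t': "\<And>d. d \<in> Obj B \<Longrightarrow> t d \<in> hom (gobj L d) (gobj M d) \<and>
    (\<forall>i \<in> I d. \<forall>x \<in> carrier (G i). t d (P.gen d i x) = ?f i x)" by blast
  have t: "t d \<in> hom (gobj L d) (gobj M d)" if "d \<in> Obj B" for d using t'[OF that] by blast
  have tg: "t d (P.gen d (a, \<beta>) x) = gmap M \<beta> (s a x)"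
    if "d \<in> Obj B" "(a, \<beta>) \<in> I d" "x \<in> carrier (gobj F a)" for d a \<beta> x
    using bspec[OF bspec[OF conjunct2[OF t'[OF that(1)]] that(2)], of x] that(3) by simp
  have "nat_trans B L M t"
    unfolding nat_trans_def
  proof (intro conjI ballI)
    fix \<gamma> c assume \<gamma>: "\<gamma> \<in> Arr B" and c: "c \<in> carrier (gobj L (Dom B \<gamma>))"
    have o: "Dom B \<gamma> \<in> Obj B" "Cod B \<gamma> \<in> Obj B" using \<gamma> B.Dom_in B.Cod_in by auto
    have "t (Cod B \<gamma>) \<circ> gmap L \<gamma> \<in> hom (gobj L (Dom B \<gamma>)) (gobj M (Cod B \<gamma>))"
      using hom_compose[OF gmap_Lan(1)[OF \<gamma>] t[OF o(2)]] .
    moreover have "gmap M \<gamma> \<circ> t (Dom B \<gamma>) \<in> hom (gobj L (Dom B \<gamma>)) (gobj M (Cod B \<gamma>))"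
      using hom_compose[OF t[OF o(1)] M_hom[OF \<gamma>]] .
    ultimately have "(t (Cod B \<gamma>) \<circ> gmap L \<gamma>) c = (gmap M \<gamma> \<circ> t (Dom B \<gamma>)) c"
    proof (rule Lan_hom_unique[OF M_grp[OF o(2)] _ _ _ c])
      fix a \<beta> x assume *: "(a, \<beta>) \<in> I (Dom B \<gamma>)" "x \<in> carrier (gobj F a)"
      have **: "(a, Comp B \<gamma> \<beta>) \<in> I (Cod B \<gamma>)" using * \<gamma> by (simp add: B.Comp_in B.Dom_Comp B.Cod_Comp)
      have "s a x \<in> carrier (gobj M (fobj S a))" using s_hom[of a] * hom_in_carrier by fastforce
      then show "(t (Cod B \<gamma>) \<circ> gmap L \<gamma>) (P.gen (Dom B \<gamma>) (a, \<beta>) x) = (gmap M \<gamma> \<circ> t (Dom B \<gamma>)) (P.gen (Dom B \<gamma>) (a, \<beta>) x)"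
        using * by (simp add: gmap_Lan(2)[OF \<gamma> *] tg[OF o(1) *] tg[OF o(2) ** *(2)] M_comp \<gamma> del: I_iff) (use M_comp[of \<beta> \<gamma>] \<gamma> in auto)
    qed
    then show "t (Cod B \<gamma>) (gmap L \<gamma> c) = gmap M \<gamma> (t (Dom B \<gamma>) c)" by simp
  qed (rule t)
  moreover have "t (fobj S a) (Lan_unit A B S F a x) = s a x" if "a \<in> Obj A" "x \<in> carrier (gobj F a)" for a x
    using tg[OF S_obj unit_in] that hom_in_carrier[OF s_hom] M S_obj by (simp add: unit_eq group_diagram_def)
  moreover have "t' d c = t d c"
    if t': "nat_trans B L M t'" and u: "\<forall>a \<in> Obj A. \<forall>x \<in> carrier (gobj F a). t' (fobj S a) (Lan_unit A B S F a x) = s a x"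
      and d: "d \<in> Obj B" and c: "c \<in> carrier (gobj L d)" for t' d c
  proof (rule Lan_hom_unique[OF M_grp[OF d] _ t[OF d] _ c])
    show "t' d \<in> hom (gobj L d) (gobj M d)" using t' d by (simp add: nat_trans_def)
    fix a \<beta> x assume *: "(a, \<beta>) \<in> I d" "x \<in> carrier (gobj F a)"
    have b: "\<beta> \<in> Arr B" "Cod B \<beta> = d" "Dom B \<beta> = fobj S a" "a \<in> Obj A" using * by auto
    have e: "gmap L \<beta> (Lan_unit A B S F a x) = P.gen d (a, \<beta>) x"
      using gmap_Lan(2)[OF b(1), of a "Id B (fobj S a)" x] b * unit_in[OF b(4)] B.Comp_Id[OF b(1)] by (simp add: unit_eq)
    have "Lan_unit A B S F a x \<in> carrier (gobj L (Dom B \<beta>))"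
      using gen_closed[OF unit_in[OF b(4)] *(2)] b by (simp add: unit_eq)
    then have "t' d (gmap L \<beta> (Lan_unit A B S F a x)) = gmap M \<beta> (t' (fobj S a) (Lan_unit A B S F a x))"
      using t' b unfolding nat_trans_def by metis
    then show "t' d (P.gen d (a, \<beta>) x) = t d (P.gen d (a, \<beta>) x)" using u b * tg[OF d *] e by simp
  qed
  ultimately show ?thesis by blast
qed

end

lemma Lan_diagram:
  "\<lbrakk>category A; category B; is_functor A B S; group_diagram A F\<rbrakk> \<Longrightarrow> group_diagram B (Lan A B S F)"
  by (rule Lan_setup.Lan_diagram) (simp add: Lan_setup_def Lan_setup_axioms_def)

lemma Lan_unit_natural:
  "\<lbrakk>category A; category B; is_functor A B S; group_diagram A F\<rbrakk>
    \<Longrightarrow> nat_trans A F (precomp (Lan A B S F) S) (Lan_unit A B S F)"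
  by (rule Lan_setup.unit_natural) (simp add: Lan_setup_def Lan_setup_axioms_def)

lemma Lan_universal:
  fixes M :: "('p, 'q, 'h) diagram"
  assumes "category A" "category B" "is_functor A B S" "group_diagram A F"
    and "group_diagram B M" and "nat_trans A F (precomp M S) s"
  shows "\<exists>t. nat_trans B (Lan A B S F) M t \<and>
    (\<forall>a \<in> Obj A. \<forall>x \<in> carrier (gobj F a). t (fobj S a) (Lan_unit A B S F a x) = s a x) \<and>
    (\<forall>t'. nat_trans B (Lan A B S F) M t' \<and>
       (\<forall>a \<in> Obj A. \<forall>x \<in> carrier (gobj F a). t' (fobj S a) (Lan_unit A B S F a x) = s a x) \<longrightarrow>
       (\<forall>d \<in> Obj B. \<forall>c \<in> carrier (gobj (Lan A B S F) d). t' d c = t d c))"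
  using Lan_setup.universal[of A B S F M s] assms by (simp add: Lan_setup_def Lan_setup_axioms_def)


section \<open>Simplicial groups, the Moore complex and simplicial replacements\<close>

definition boundaries :: "'a sgroup \<Rightarrow> nat \<Rightarrow> 'a set" where
  "boundaries S n = face S (Suc n) (Suc n) `
     {z \<in> carrier (sgrp S (Suc n)). \<forall>i \<le> n. face S (Suc n) i z = \<one>\<^bsub>sgrp S n\<^esub>}"

context simplicial_group
begin

lemma face_closed: "i \<le> Suc n \<Longrightarrow> x \<in> carrier (sgrp S (Suc n)) \<Longrightarrow> face S (Suc n) i x \<in> carrier (sgrp S n)"
  by (rule hom_in_carrier[OF face_hom])

lemma face_mult: "i \<le> Suc n \<Longrightarrow> x \<in> carrier (sgrp S (Suc n)) \<Longrightarrow> y \<in> carrier (sgrp S (Suc n)) \<Longrightarrow>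
    face S (Suc n) i (x \<otimes>\<^bsub>sgrp S (Suc n)\<^esub> y) = face S (Suc n) i x \<otimes>\<^bsub>sgrp S n\<^esub> face S (Suc n) i y"
  by (rule hom_mult[OF face_hom])

lemma face_one: "i \<le> Suc n \<Longrightarrow> face S (Suc n) i \<one>\<^bsub>sgrp S (Suc n)\<^esub> = \<one>\<^bsub>sgrp S n\<^esub>"
  using hom_one[OF face_hom grp grp] .

lemma face_inv: "i \<le> Suc n \<Longrightarrow> x \<in> carrier (sgrp S (Suc n)) \<Longrightarrow>
    face S (Suc n) i (inv\<^bsub>sgrp S (Suc n)\<^esub> x) = inv\<^bsub>sgrp S n\<^esub> face S (Suc n) i x"
  by (intro group_hom.hom_inv) (auto simp: group_hom_def group_hom_axioms_def grp face_hom)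

lemma degen_closed: "i \<le> n \<Longrightarrow> x \<in> carrier (sgrp S n) \<Longrightarrow> degen S n i x \<in> carrier (sgrp S (Suc n))"
  by (rule hom_in_carrier[OF degen_hom])

lemma degen_one: "i \<le> n \<Longrightarrow> degen S n i \<one>\<^bsub>sgrp S n\<^esub> = \<one>\<^bsub>sgrp S (Suc n)\<^esub>"
  using hom_one[OF degen_hom grp grp] .

lemma spheres_carrier: "x \<in> spheres S n \<Longrightarrow> x \<in> carrier (sgrp S n)"
  by (simp add: spheres_def)

lemma face_degen_sphere:
  assumes "x \<in> spheres S n" "i < n"
  shows "face S (Suc n) i (degen S n n x) = \<one>\<^bsub>sgrp S n\<^esub>"
proof -
  obtain m where m: "n = Suc m" using assms(2) by (cases n) auto
  have "face S (Suc n) i (degen S n n x) = degen S m m (face S n i x)"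
    using face_degen_less[of i n m x] assms m spheres_carrier by simp
  also have "face S n i x = \<one>\<^bsub>sgrp S m\<^esub>" using assms m by (simp add: spheres_def)
  finally show ?thesis using m degen_one by simp
qed

lemma spheres_subgroup: "subgroup (spheres S n) (sgrp S n)"
proof -
  interpret G: group "sgrp S n" by (rule grp)
  show ?thesis
  proof (cases n)
    case 0
    then have "spheres S n = carrier (sgrp S n)" by (auto simp: spheres_def)
    then show ?thesis using G.subgroup_self by simp
  next
    case (Suc m)
    interpret H: group "sgrp S m" by (rule grp)
    interpret K: group "sgrp S (Suc m)" by (rule grp)
    show ?thesis
      by (rule G.subgroupI) (use Suc in \<open>auto simp: spheres_def face_one face_mult face_inv intro!: exI[of _ "\<one>\<^bsub>sgrp S n\<^esub>"]\<close>)
  qed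
qed

lemma boundary_sphere: "boundaries S n \<subseteq> spheres S n"
proof
  fix y assume "y \<in> boundaries S n"
  then obtain z where z: "z \<in> carrier (sgrp S (Suc n))" "\<And>i. i \<le> n \<Longrightarrow> face S (Suc n) i z = \<one>\<^bsub>sgrp S n\<^esub>"
    "y = face S (Suc n) (Suc n) z" by (auto simp: boundaries_def)
  have "face S n i y = \<one>\<^bsub>sgrp S (n - 1)\<^esub>" if i: "n > 0" "i \<le> n" for i
  proof -
    obtain m where m: "n = Suc m" using i(1) by (cases n) auto
    show ?thesis using face_face[of i "Suc n" m z] i z m face_one[of n m] by simp
  qed
  then show "y \<in> spheres S n" using z face_closed by (simp add: spheres_def)
qed

lemma homotopic_iff:
  assumes x: "x \<in> spheres S n"
  shows "(x, y) \<in> homotopic S n \<longleftrightarrow> y \<in> boundaries S n #>\<^bsub>sgrp S n\<^esub> x"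
proof -
  interpret G: group "sgrp S n" by (rule grp)
  interpret G': group "sgrp S (Suc n)" by (rule grp)
  note xc = spheres_carrier[OF x] and sx = degen_closed[OF order_refl spheres_carrier[OF x]]
  have d: "face S (Suc n) n (degen S n n x) = x" "face S (Suc n) (Suc n) (degen S n n x) = x"
    using face_degen_id[of _ n n x] xc by auto
  show ?thesis
  proof
    assume "(x, y) \<in> homotopic S n"
    then obtain z where y: "y \<in> spheres S n" and z: "z \<in> carrier (sgrp S (Suc n))" "\<And>i. i < n \<Longrightarrow> face S (Suc n) i z = \<one>\<^bsub>sgrp S n\<^esub>"
      "face S (Suc n) n z = x" "face S (Suc n) (Suc n) z = y" by (auto simp: homotopic_def)
    let ?w = "z \<otimes>\<^bsub>sgrp S (Suc n)\<^esub> inv\<^bsub>sgrp S (Suc n)\<^esub> degen S n n x"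
    have "face S (Suc n) i ?w = \<one>\<^bsub>sgrp S n\<^esub>" if "i \<le> n" for i
      using that z sx xc d face_degen_sphere[OF x] by (cases "i = n") (auto simp: face_mult face_inv)
    moreover have "face S (Suc n) (Suc n) ?w = y \<otimes>\<^bsub>sgrp S n\<^esub> inv\<^bsub>sgrp S n\<^esub> x"
      using z sx d by (simp add: face_mult face_inv)
    ultimately have "y \<otimes>\<^bsub>sgrp S n\<^esub> inv\<^bsub>sgrp S n\<^esub> x \<in> boundaries S n"
      unfolding boundaries_def using z sx by (intro image_eqI[of _ _ ?w]) auto
    moreover have "y = (y \<otimes>\<^bsub>sgrp S n\<^esub> inv\<^bsub>sgrp S n\<^esub> x) \<otimes>\<^bsub>sgrp S n\<^esub> x"
      using xc spheres_carrier[OF y] by (simp add: G.m_assoc)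
    ultimately show "y \<in> boundaries S n #>\<^bsub>sgrp S n\<^esub> x" unfolding r_coset_def by blast
  next
    assume "y \<in> boundaries S n #>\<^bsub>sgrp S n\<^esub> x"
    then obtain h where h: "h \<in> boundaries S n" "y = h \<otimes>\<^bsub>sgrp S n\<^esub> x" by (auto simp: r_coset_def)
    then obtain z where z: "z \<in> carrier (sgrp S (Suc n))" "\<And>i. i \<le> n \<Longrightarrow> face S (Suc n) i z = \<one>\<^bsub>sgrp S n\<^esub>"
      "h = face S (Suc n) (Suc n) z" by (auto simp: boundaries_def)
    let ?w = "z \<otimes>\<^bsub>sgrp S (Suc n)\<^esub> degen S n n x"
    have "y \<in> spheres S n" using h boundary_sphere x subgroup.m_closed[OF spheres_subgroup] by blast
    moreover have "face S (Suc n) i ?w = \<one>\<^bsub>sgrp S n\<^esub>" if "i < n" for i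
      using that z sx face_degen_sphere[OF x] by (simp add: face_mult)
    moreover have "face S (Suc n) n ?w = x" "face S (Suc n) (Suc n) ?w = y"
      using z sx xc d h by (simp_all add: face_mult)
    ultimately show "(x, y) \<in> homotopic S n" unfolding homotopic_def using x z sx
      by (auto intro!: bexI[of _ ?w])
  qed
qed

abbreviation "sphere_group n \<equiv> (sgrp S n)\<lparr>carrier := spheres S n\<rparr>"

lemma boundaries_normal: "boundaries S n \<lhd> sphere_group n"
proof -
  interpret G: group "sgrp S n" by (rule grp)
  interpret G': group "sgrp S (Suc n)" by (rule grp)
  interpret Z: group "sphere_group n" by (rule G.subgroup_imp_group[OF spheres_subgroup])
  have "subgroup (boundaries S n) (sgrp S n)"
  proof (rule G.subgroupI)
    show "boundaries S n \<subseteq> carrier (sgrp S n)" using boundary_sphere spheres_carrier by blast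
    show "boundaries S n \<noteq> {}" unfolding boundaries_def using face_one[of _ n] by auto
    show "inv\<^bsub>sgrp S n\<^esub> a \<in> boundaries S n" if "a \<in> boundaries S n" for a
      using that unfolding boundaries_def by (auto simp: face_inv[symmetric] intro!: imageI) (simp add: face_inv)
    show "a \<otimes>\<^bsub>sgrp S n\<^esub> b \<in> boundaries S n" if "a \<in> boundaries S n" "b \<in> boundaries S n" for a b
      using that unfolding boundaries_def by (auto simp: face_mult[symmetric] intro!: imageI) (simp add: face_mult)
  qed
  then have B: "subgroup (boundaries S n) (sphere_group n)"
    using boundary_sphere G.subgroup_incl spheres_subgroup by blast
  have "x \<otimes>\<^bsub>sphere_group n\<^esub> h \<otimes>\<^bsub>sphere_group n\<^esub> inv\<^bsub>sphere_group n\<^esub> x \<in> boundaries S n"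
    if x: "x \<in> spheres S n" and h: "h \<in> boundaries S n" for x h
  proof -
    obtain z where z: "z \<in> carrier (sgrp S (Suc n))" "\<And>i. i \<le> n \<Longrightarrow> face S (Suc n) i z = \<one>\<^bsub>sgrp S n\<^esub>"
      "h = face S (Suc n) (Suc n) z" using h by (auto simp: boundaries_def)
    let ?s = "degen S n n x"
    have s: "?s \<in> carrier (sgrp S (Suc n))" using degen_closed spheres_carrier[OF x] by simp
    have d: "face S (Suc n) (Suc n) ?s = x" using face_degen_id[of _ n n x] spheres_carrier[OF x] by auto
    let ?w = "?s \<otimes>\<^bsub>sgrp S (Suc n)\<^esub> z \<otimes>\<^bsub>sgrp S (Suc n)\<^esub> inv\<^bsub>sgrp S (Suc n)\<^esub> ?s"
    have "face S (Suc n) i ?w = \<one>\<^bsub>sgrp S n\<^esub>" if "i \<le> n" for i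
      using that z s face_closed[of i n ?s] by (simp add: face_mult face_inv)
    moreover have "face S (Suc n) (Suc n) ?w = x \<otimes>\<^bsub>sgrp S n\<^esub> h \<otimes>\<^bsub>sgrp S n\<^esub> inv\<^bsub>sgrp S n\<^esub> x"
      using z s d by (simp add: face_mult face_inv)
    ultimately have "x \<otimes>\<^bsub>sgrp S n\<^esub> h \<otimes>\<^bsub>sgrp S n\<^esub> inv\<^bsub>sgrp S n\<^esub> x \<in> boundaries S n"
      unfolding boundaries_def using z s by (intro image_eqI[of _ _ ?w]) auto
    then show ?thesis using G.m_inv_consistent[OF spheres_subgroup x] by simp
  qed
  then show ?thesis using Z.normal_inv_iff B by auto
qed

lemma homotopy_class: "x \<in> spheres S n \<Longrightarrow> homotopic S n `` {x} = boundaries S n #>\<^bsub>sgrp S n\<^esub> x"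
  using homotopic_iff by auto

lemma rcos_restrict: "boundaries S n #>\<^bsub>sphere_group n\<^esub> x = boundaries S n #>\<^bsub>sgrp S n\<^esub> x"
  by (simp add: r_coset_def)

text \<open>The homotopy groups are the homology groups of the Moore complex.\<close>

lemma homotopy_group_Moore:
  "(\<lambda>A. A) \<in> iso (homotopy_group S n) (sphere_group n Mod boundaries S n)"
proof -
  interpret N: normal "boundaries S n" "sphere_group n" by (rule boundaries_normal)
  have c: "carrier (homotopy_group S n) = carrier (sphere_group n Mod boundaries S n)"
    by (auto simp: homotopy_group_def carrier_FactGroup quotient_def homotopy_class rcos_restrict)
  have "A \<otimes>\<^bsub>homotopy_group S n\<^esub> B = A <#>\<^bsub>sphere_group n\<^esub> B"
    if AB: "A \<in> carrier (homotopy_group S n)" "B \<in> carrier (homotopy_group S n)" for A B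
  proof -
    obtain x y where x: "x \<in> spheres S n" "A = boundaries S n #>\<^bsub>sphere_group n\<^esub> x"
      and y: "y \<in> spheres S n" "B = boundaries S n #>\<^bsub>sphere_group n\<^esub> y"
      using AB unfolding c carrier_FactGroup by auto
    have xy: "x \<otimes>\<^bsub>sgrp S n\<^esub> y \<in> spheres S n" using x y N.m_closed by simp
    have s: "A <#>\<^bsub>sphere_group n\<^esub> B = boundaries S n #>\<^bsub>sphere_group n\<^esub> (x \<otimes>\<^bsub>sgrp S n\<^esub> y)"
      using N.rcos_sum[of x y] x y by simp
    have "A \<otimes>\<^bsub>homotopy_group S n\<^esub> B = homotopic S n `` (A <#>\<^bsub>sphere_group n\<^esub> B)"
      by (simp add: homotopy_group_def set_mult_def) (rule arg_cong[of _ _ "\<lambda>X. homotopic S n `` X"], blast)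
    also have "\<dots> = (\<Union>w \<in> boundaries S n #>\<^bsub>sphere_group n\<^esub> (x \<otimes>\<^bsub>sgrp S n\<^esub> y). boundaries S n #>\<^bsub>sphere_group n\<^esub> w)"
    proof -
      have "w \<in> spheres S n" if "w \<in> boundaries S n #>\<^bsub>sphere_group n\<^esub> (x \<otimes>\<^bsub>sgrp S n\<^esub> y)" for w
        using N.r_coset_subset_G[of "boundaries S n" "x \<otimes>\<^bsub>sgrp S n\<^esub> y"] that xy boundary_sphere by auto
      then have "homotopic S n `` {w} = boundaries S n #>\<^bsub>sphere_group n\<^esub> w"
        if "w \<in> boundaries S n #>\<^bsub>sphere_group n\<^esub> (x \<otimes>\<^bsub>sgrp S n\<^esub> y)" for w
        using that homotopy_class by (simp only: rcos_restrict)
      then show ?thesis unfolding s by (subst Image_eq_UN) (rule SUP_cong, simp_all)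
    qed
    also have "\<dots> = boundaries S n #>\<^bsub>sphere_group n\<^esub> (x \<otimes>\<^bsub>sgrp S n\<^esub> y)"
    proof -
      let ?X = "boundaries S n #>\<^bsub>sphere_group n\<^esub> (x \<otimes>\<^bsub>sgrp S n\<^esub> y)"
      have "boundaries S n #>\<^bsub>sphere_group n\<^esub> w = ?X" if "w \<in> ?X" for w
        using N.repr_independence[OF that _ N.is_subgroup] xy by simp
      moreover have "x \<otimes>\<^bsub>sgrp S n\<^esub> y \<in> ?X" using N.rcos_self[OF _ N.is_subgroup] xy by simp
      ultimately show ?thesis by blast
    qed
    finally show ?thesis using s by simp
  qed
  then show ?thesis using c by (auto simp: iso_def hom_def bij_betw_def N.is_subgroup)
qed

lemma homotopy_group_group: "group (homotopy_group S n)"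
proof -
  interpret N: normal "boundaries S n" "sphere_group n" by (rule boundaries_normal)
  interpret Q: group "sphere_group n Mod boundaries S n" by (rule N.factorgroup_is_group)
  interpret G: group "sgrp S n" by (rule grp)
  note M = homotopy_group_Moore[of n, unfolded iso_def mem_Collect_eq]
  have c: "carrier (homotopy_group S n) = carrier (sphere_group n Mod boundaries S n)"
    using M by (auto simp: bij_betw_def)
  have m: "A \<otimes>\<^bsub>homotopy_group S n\<^esub> B = A \<otimes>\<^bsub>sphere_group n Mod boundaries S n\<^esub> B"
    if "A \<in> carrier (homotopy_group S n)" "B \<in> carrier (homotopy_group S n)" for A B
    using M that by (auto simp: hom_def)
  have o: "\<one>\<^bsub>homotopy_group S n\<^esub> = \<one>\<^bsub>sphere_group n Mod boundaries S n\<^esub>"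
    using homotopy_class[of "\<one>\<^bsub>sgrp S n\<^esub>" n] subgroup.one_closed[OF spheres_subgroup] boundary_sphere spheres_carrier
    by (auto simp: homotopy_group_def r_coset_def) (metis G.r_one spheres_carrier subsetD)+
  show ?thesis
    by (rule groupI) (use Q.l_inv_ex in \<open>auto simp: c m o Q.m_assoc simp del: one_FactGroup mult_FactGroup\<close>)
qed

end

lemma coface_arr: "i \<le> Suc n \<Longrightarrow> coface (Suc n) i \<in> Arr Delta" "i \<le> n \<Longrightarrow> codegen n i \<in> Arr Delta"
  by (auto simp: coface_def codegen_def mono_on_def)

lemma coface_sel [simp]: "Dom Delta (coface (Suc n) i) = n" "Cod Delta (coface n i) = n"
  "Dom Delta (codegen n i) = Suc n" "Cod Delta (codegen n i) = n"
  by (simp_all add: coface_def codegen_def)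

lemma cosimplicial:
  "i < j \<Longrightarrow> Comp Delta (coface (Suc (Suc n)) j) (coface (Suc n) i) = Comp Delta (coface (Suc (Suc n)) i) (coface (Suc n) (j - 1))"
  "i < j \<Longrightarrow> j \<le> Suc n \<Longrightarrow> Comp Delta (codegen (Suc n) j) (coface (Suc (Suc n)) i) = Comp Delta (coface (Suc n) i) (codegen n (j - 1))"
  "i = j \<or> i = Suc j \<Longrightarrow> j \<le> n \<Longrightarrow> Comp Delta (codegen n j) (coface (Suc n) i) = Id Delta n"
  "Suc j < i \<Longrightarrow> i \<le> Suc (Suc n) \<Longrightarrow> Comp Delta (codegen (Suc n) j) (coface (Suc (Suc n)) i) = Comp Delta (coface (Suc n) (i - 1)) (codegen n j)"
  "i \<le> j \<Longrightarrow> j \<le> n \<Longrightarrow> Comp Delta (codegen n j) (codegen (Suc n) i) = Comp Delta (codegen n i) (codegen (Suc n) (Suc j))"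
  by (auto simp: coface_def codegen_def compose_def fun_eq_iff)

locale replacement_setup = category K for K :: "('o, 'm) cat" +
  fixes D :: "('o, 'm, 'g) diagram"
  assumes D: "group_diagram K D"
begin

abbreviation "N \<equiv> simplices (nerve K)"
abbreviation "G \<equiv> (\<lambda>\<sigma>. gobj D (fobj \<sigma> 0)) :: ('o, 'm) nsimplex \<Rightarrow> 'g monoid"

lemma nobj: "\<sigma> \<in> N n \<Longrightarrow> i \<le> n \<Longrightarrow> fobj \<sigma> i \<in> Obj K" by (simp add: nerve_iff)

lemma narr: "\<sigma> \<in> N n \<Longrightarrow> i \<le> j \<Longrightarrow> j \<le> n \<Longrightarrow>
    fmap \<sigma> (i, j) \<in> Arr K \<and> Dom K (fmap \<sigma> (i, j)) = fobj \<sigma> i \<and> Cod K (fmap \<sigma> (i, j)) = fobj \<sigma> j"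
  by (simp add: nerve_iff)

lemma nid: "\<sigma> \<in> N n \<Longrightarrow> i \<le> n \<Longrightarrow> fmap \<sigma> (i, i) = Id K (fobj \<sigma> i)" by (simp add: nerve_iff)

lemma ncomp: "\<sigma> \<in> N n \<Longrightarrow> i \<le> j \<Longrightarrow> j \<le> k \<Longrightarrow> k \<le> n \<Longrightarrow> Comp K (fmap \<sigma> (j, k)) (fmap \<sigma> (i, j)) = fmap \<sigma> (i, k)"
  by (simp add: nerve_iff)

lemma groups: "\<sigma> \<in> N n \<Longrightarrow> group (G \<sigma>)"
  using D nobj[of \<sigma> n 0] by (simp add: group_diagram_def)

sublocale P: word_presentation "N n" G "{}" for n
  by (rule word_presentation.intro) (rule groups)

definition opr :: "darr \<Rightarrow> (('o, 'm) nsimplex \<times> 'g) list set \<Rightarrow> (('o, 'm) nsimplex \<times> 'g) list set" where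
  "opr \<alpha> = replacement_map K D (Dom Delta \<alpha>)
     (\<lambda>(\<sigma>, x). (act (nerve K) \<alpha> \<sigma>, gmap D (fmap \<sigma> (0, fst (snd \<alpha>) 0)) x))"

lemma opr:
  assumes \<alpha>: "\<alpha> \<in> Arr Delta"
  shows "opr \<alpha> \<in> hom (replacement_group K D (Cod Delta \<alpha>)) (replacement_group K D (Dom Delta \<alpha>))"
    and "\<sigma> \<in> N (Cod Delta \<alpha>) \<Longrightarrow> x \<in> carrier (G \<sigma>) \<Longrightarrow>
      opr \<alpha> (P.gen (Cod Delta \<alpha>) \<sigma> x) = P.gen (Dom Delta \<alpha>) (act (nerve K) \<alpha> \<sigma>) (gmap D (fmap \<sigma> (0, fst (snd \<alpha>) 0)) x)"
    and "\<sigma> \<in> N (Cod Delta \<alpha>) \<Longrightarrow> x \<in> carrier (G \<sigma>) \<Longrightarrow>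
      act (nerve K) \<alpha> \<sigma> \<in> N (Dom Delta \<alpha>) \<and> gmap D (fmap \<sigma> (0, fst (snd \<alpha>) 0)) x \<in> carrier (G (act (nerve K) \<alpha> \<sigma>))"
proof -
  obtain m f n where a: "\<alpha> = (m, f, n)" by (metis prod_cases3)
  have f0: "f 0 \<le> n" using \<alpha> a by auto
  let ?f = "\<lambda>\<sigma>. gmap D (fmap \<sigma> (0, fst (snd \<alpha>) 0))"
  have 1: "act (nerve K) \<alpha> \<sigma> \<in> N m \<and> ?f \<sigma> \<in> hom (G \<sigma>) (G (act (nerve K) \<alpha> \<sigma>))" if "\<sigma> \<in> N n" for \<sigma>
  proof
    show "act (nerve K) \<alpha> \<sigma> \<in> N m" using nerve_simplicial_set[of K] \<alpha> that a unfolding simplicial_set_def by fastforce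
    have "gmap D (fmap \<sigma> (0, f 0)) \<in> hom (gobj D (Dom K (fmap \<sigma> (0, f 0)))) (gobj D (Cod K (fmap \<sigma> (0, f 0))))"
      using D narr[OF that le0 f0] unfolding group_diagram_def by blast
    then show "?f \<sigma> \<in> hom (G \<sigma>) (G (act (nerve K) \<alpha> \<sigma>))" using narr[OF that le0 f0] by (simp add: a)
  qed
  note W = word_map_hom[of "N n" G "N m" G "act (nerve K) \<alpha>" ?f "{}" "{}" "\<lambda>(\<sigma>, x). (act (nerve K) \<alpha> \<sigma>, gmap D (fmap \<sigma> (0, fst (snd \<alpha>) 0)) x)"]
  show "opr \<alpha> \<in> hom (replacement_group K D (Cod Delta \<alpha>)) (replacement_group K D (Dom Delta \<alpha>))"
    unfolding a opr_def Delta_sel unfolding a[symmetric] by (rule W(1)) (use groups 1 in auto)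
  assume s: "\<sigma> \<in> N (Cod Delta \<alpha>)" "x \<in> carrier (G \<sigma>)"
  have "opr \<alpha> (word_rel (N n) G {} `` {[(\<sigma>, x)]}) = word_rel (N m) G {} `` {map (\<lambda>(\<sigma>, x). (act (nerve K) \<alpha> \<sigma>, gmap D (fmap \<sigma> (0, fst (snd \<alpha>) 0)) x)) [(\<sigma>, x)]}"
    unfolding a opr_def Delta_sel unfolding a[symmetric] by (rule W(2)) (use groups 1 s in \<open>auto simp: letters_def a\<close>)
  then show "opr \<alpha> (P.gen (Cod Delta \<alpha>) \<sigma> x) = P.gen (Dom Delta \<alpha>) (act (nerve K) \<alpha> \<sigma>) (gmap D (fmap \<sigma> (0, fst (snd \<alpha>) 0)) x)"
    unfolding P.gen_def P.cls_def by (simp add: a)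
  show "act (nerve K) \<alpha> \<sigma> \<in> N (Dom Delta \<alpha>) \<and> gmap D (fmap \<sigma> (0, fst (snd \<alpha>) 0)) x \<in> carrier (G (act (nerve K) \<alpha> \<sigma>))"
    using 1[of \<sigma>] s hom_in_carrier[of "?f \<sigma>" "G \<sigma>" "G (act (nerve K) \<alpha> \<sigma>)" x] by (simp add: a)
qed

lemma gmap_id: "c \<in> Obj K \<Longrightarrow> x \<in> carrier (gobj D c) \<Longrightarrow> gmap D (Id K c) x = x"
  using D by (simp add: group_diagram_def)

lemma opr_Id: "c \<in> carrier (replacement_group K D n) \<Longrightarrow> opr (Id Delta n) c = c"
proof -
  assume c: "c \<in> carrier (replacement_group K D n)"
  interpret Delta: category Delta by (rule category_Delta)
  have a: "Id Delta n \<in> Arr Delta" "Cod Delta (Id Delta n) = n" "Dom Delta (Id Delta n) = n"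
    using Delta.Id_in[of n] Delta.Dom_Id[of n] Delta.Cod_Id[of n] by simp_all
  note o = opr[OF a(1), unfolded a]
  have "(\<lambda>c. c) \<in> hom (replacement_group K D n) (replacement_group K D n)" by (simp add: hom_def)
  then show ?thesis
  proof (rule P.hom_unique[OF P.word_group_group o(1) _ _ c])
    fix \<sigma> x assume s: "\<sigma> \<in> N n" "x \<in> carrier (G \<sigma>)"
    have "act (nerve K) (Id Delta n) \<sigma> = \<sigma>" using nerve_simplicial_set[of K] s unfolding simplicial_set_def by blast
    then show "opr (Id Delta n) (P.gen n \<sigma> x) = P.gen n \<sigma> x"
      using o(2)[OF s] nid[OF s(1), of 0] gmap_id[OF nobj[OF s(1)] s(2)] by simp
  qed
qed

lemma opr_Comp:
  assumes \<alpha>: "\<alpha> \<in> Arr Delta" and \<beta>: "\<beta> \<in> Arr Delta" and e: "Cod Delta \<alpha> = Dom Delta \<beta>"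
    and c: "c \<in> carrier (replacement_group K D (Cod Delta \<beta>))"
  shows "opr \<alpha> (opr \<beta> c) = opr (Comp Delta \<beta> \<alpha>) c"
proof -
  interpret Delta: category Delta by (rule category_Delta)
  note a = Delta.Comp_in[OF \<alpha> \<beta> e] Delta.Dom_Comp[OF \<alpha> \<beta> e] Delta.Cod_Comp[OF \<alpha> \<beta> e]
  note o = opr[OF a(1), unfolded a]
  have h: "opr \<alpha> \<circ> opr \<beta> \<in> hom (replacement_group K D (Cod Delta \<beta>)) (replacement_group K D (Dom Delta \<alpha>))"
    using hom_compose[OF opr(1)[OF \<beta>]] opr(1)[OF \<alpha>] e by simp
  obtain m f n where a1: "\<alpha> = (m, f, n)" by (metis prod_cases3)
  obtain g k where b1: "\<beta> = (n, g, k)" using e a1 by (metis Delta_sel(3,4) prod_cases3)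
  have le: "f 0 \<le> n" "g 0 \<le> g (f 0)" "g (f 0) \<le> k" 
  proof -
    show "f 0 \<le> n" using \<alpha> a1 by auto
    then show "g 0 \<le> g (f 0)" using \<beta> b1 by (simp add: mono_on_def)
    show "g (f 0) \<le> k" using \<open>f 0 \<le> n\<close> \<beta> b1 by auto
  qed
  have "(opr \<alpha> \<circ> opr \<beta>) c = opr (Comp Delta \<beta> \<alpha>) c"
  proof (rule P.hom_unique[OF P.word_group_group h o(1) _ c])
    fix \<sigma> x assume s: "\<sigma> \<in> N (Cod Delta \<beta>)" "x \<in> carrier (G \<sigma>)"
    have sk: "\<sigma> \<in> N k" using s b1 by simp
    note t = opr(3)[OF \<beta> s, folded e]
    have "act (nerve K) (Comp Delta \<beta> \<alpha>) \<sigma> = act (nerve K) \<alpha> (act (nerve K) \<beta> \<sigma>)"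
      using nerve_simplicial_set[of K] \<alpha> \<beta> e s unfolding simplicial_set_def by blast
    moreover have "gmap D (fmap (act (nerve K) \<beta> \<sigma>) (0, fst (snd \<alpha>) 0)) (gmap D (fmap \<sigma> (0, fst (snd \<beta>) 0)) x)
      = gmap D (fmap \<sigma> (0, fst (snd (Comp Delta \<beta> \<alpha>)) 0)) x"
    proof -
      have ar: "fmap \<sigma> (0, g 0) \<in> Arr K" "fmap \<sigma> (g 0, g (f 0)) \<in> Arr K" "Cod K (fmap \<sigma> (0, g 0)) = Dom K (fmap \<sigma> (g 0, g (f 0)))"
        "Dom K (fmap \<sigma> (0, g 0)) = fobj \<sigma> 0"
        using narr[OF sk, of 0 "g 0"] narr[OF sk, of "g 0" "g (f 0)"] le by auto
      have "gmap D (Comp K (fmap \<sigma> (g 0, g (f 0))) (fmap \<sigma> (0, g 0))) x = gmap D (fmap \<sigma> (g 0, g (f 0))) (gmap D (fmap \<sigma> (0, g 0)) x)"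
        using D ar s(2) unfolding group_diagram_def by metis
      then show ?thesis using ncomp[OF sk, of 0 "g 0" "g (f 0)"] le by (simp add: a1 b1 compose_def)
    qed
    ultimately show "(opr \<alpha> \<circ> opr \<beta>) (P.gen (Cod Delta \<beta>) \<sigma> x) = opr (Comp Delta \<beta> \<alpha>) (P.gen (Cod Delta \<beta>) \<sigma> x)"
      using opr(2)[OF \<beta> s] opr(2)[OF \<alpha>] t o(2)[OF s] e by simp
  qed
  then show ?thesis by simp
qed

lemma word_map_cong:
  assumes "c \<in> carrier (replacement_group K D n)" "\<And>\<sigma> x. \<sigma> \<in> N n \<Longrightarrow> x \<in> carrier (G \<sigma>) \<Longrightarrow> f (\<sigma>, x) = g (\<sigma>, x)"
  shows "word_map I H R f c = word_map I H R g c"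
proof -
  have "c \<subseteq> lists (letters (N n) G)" 
  proof
    fix v assume v: "v \<in> c"
    obtain w where "c = P.cls n w" using assms(1) unfolding P.carrier_eq by blast
    then have "word_eq (N n) G {} w v" using v by (simp add: P.in_cls)
    then show "v \<in> lists (letters (N n) G)" using P.eqD by blast
  qed
  then have "map f w = map g w" if "w \<in> c" for w
    using that assms(2) by (fastforce simp: letters_def)
  then have "map f ` c = map g ` c" by (rule image_cong[OF HOL.refl])
  then show ?thesis by (simp add: word_map_def)
qed

lemma face_opr:
  assumes c: "c \<in> carrier (replacement_group K D (Suc n))"
  shows "face (replacement K D) (Suc n) i c = opr (coface (Suc n) i) c"
  unfolding replacement_def opr_def sgroup.simps coface_sel diff_Suc_1
proof (rule word_map_cong[OF c])
  fix \<sigma> x assume s: "\<sigma> \<in> N (Suc n)" "x \<in> carrier (G \<sigma>)"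
  then show "(case (\<sigma>, x) of (\<sigma>, x) \<Rightarrow> (act (nerve K) (coface (Suc n) i) \<sigma>, if i = 0 then gmap D (fmap \<sigma> (0, 1)) x else x)) =
    (case (\<sigma>, x) of (\<sigma>, x) \<Rightarrow> (act (nerve K) (coface (Suc n) i) \<sigma>, gmap D (fmap \<sigma> (0, fst (snd (coface (Suc n) i)) 0)) x))"
    using gmap_id[OF nobj[OF s(1)] s(2)] nid[OF s(1), of 0] by (simp add: coface_def)
qed

lemma degen_opr:
  assumes c: "c \<in> carrier (replacement_group K D n)"
  shows "degen (replacement K D) n i c = opr (codegen n i) c"
  unfolding replacement_def opr_def sgroup.simps coface_sel
proof (rule word_map_cong[OF c])
  fix \<sigma> x assume s: "\<sigma> \<in> N n" "x \<in> carrier (G \<sigma>)"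
  then show "(case (\<sigma>, x) of (\<sigma>, x) \<Rightarrow> (act (nerve K) (codegen n i) \<sigma>, x)) =
    (case (\<sigma>, x) of (\<sigma>, x) \<Rightarrow> (act (nerve K) (codegen n i) \<sigma>, gmap D (fmap \<sigma> (0, fst (snd (codegen n i)) 0)) x))"
    using gmap_id[OF nobj[OF s(1)] s(2)] nid[OF s(1), of 0] by (simp add: codegen_def)
qed

lemma sgrp_eq: "sgrp (replacement K D) n = replacement_group K D n"
  by (simp add: replacement_def)

lemma opr_closed: "\<alpha> \<in> Arr Delta \<Longrightarrow> c \<in> carrier (replacement_group K D (Cod Delta \<alpha>)) \<Longrightarrow> opr \<alpha> c \<in> carrier (replacement_group K D (Dom Delta \<alpha>))"
  by (rule hom_in_carrier[OF opr(1)])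

lemma opr_face: "i \<le> Suc n \<Longrightarrow> c \<in> carrier (replacement_group K D (Suc n)) \<Longrightarrow> opr (coface (Suc n) i) c \<in> carrier (replacement_group K D n)"
  using opr_closed[of "coface (Suc n) i" c] coface_arr by simp

lemma opr_degen: "i \<le> n \<Longrightarrow> c \<in> carrier (replacement_group K D n) \<Longrightarrow> opr (codegen n i) c \<in> carrier (replacement_group K D (Suc n))"
  using opr_closed[of "codegen n i" c] coface_arr by simp

lemma hom_cong: "f \<in> hom A B \<Longrightarrow> group A \<Longrightarrow> (\<And>x. x \<in> carrier A \<Longrightarrow> g x = f x) \<Longrightarrow> g \<in> hom A B"
  by (auto simp: hom_def Pi_def) (metis group.is_monoid monoid.m_closed)

lemma opr_swap:
  assumes "Comp Delta \<beta> \<alpha> = Comp Delta \<beta>' \<alpha>'" "\<alpha> \<in> Arr Delta" "\<beta> \<in> Arr Delta" "\<alpha>' \<in> Arr Delta" "\<beta>' \<in> Arr Delta"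
    "Cod Delta \<alpha> = Dom Delta \<beta>" "Cod Delta \<alpha>' = Dom Delta \<beta>'" "Cod Delta \<beta>' = Cod Delta \<beta>"
    "c \<in> carrier (replacement_group K D (Cod Delta \<beta>))"
  shows "opr \<alpha> (opr \<beta> c) = opr \<alpha>' (opr \<beta>' c)"
  using opr_Comp[of \<alpha> \<beta> c] opr_Comp[of \<alpha>' \<beta>' c] assms by simp

lemma simplicial: "simplicial_group (replacement K D)"
proof (rule simplicial_group.intro)
  show "group (sgrp (replacement K D) n)" for n unfolding sgrp_eq by (rule P.word_group_group)
  show "face (replacement K D) (Suc n) i \<in> hom (sgrp (replacement K D) (Suc n)) (sgrp (replacement K D) n)" if "i \<le> Suc n" for i n
    unfolding sgrp_eq using opr(1)[OF coface_arr(1)[OF that], unfolded coface_sel]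
    by (rule hom_cong[OF _ P.word_group_group]) (rule face_opr)
  show "degen (replacement K D) n i \<in> hom (sgrp (replacement K D) n) (sgrp (replacement K D) (Suc n))" if "i \<le> n" for i n
    unfolding sgrp_eq using opr(1)[OF coface_arr(2)[OF that], unfolded coface_sel]
    by (rule hom_cong[OF _ P.word_group_group]) (rule degen_opr)
  note s = sgrp_eq face_opr degen_opr opr_face opr_degen
  show "face (replacement K D) (Suc n) i (face (replacement K D) (Suc (Suc n)) j x) =
       face (replacement K D) (Suc n) (j - 1) (face (replacement K D) (Suc (Suc n)) i x)"
    if "i < j" "j \<le> Suc (Suc n)" "x \<in> carrier (sgrp (replacement K D) (Suc (Suc n)))" for i j n x
    using that by (simp add: s del: One_nat_def) (rule opr_swap[OF cosimplicial(1)], simp_all add: coface_arr)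
  show "face (replacement K D) (Suc (Suc n)) i (degen (replacement K D) (Suc n) j x) =
       degen (replacement K D) n (j - 1) (face (replacement K D) (Suc n) i x)"
    if "i < j" "j \<le> Suc n" "x \<in> carrier (sgrp (replacement K D) (Suc n))" for i j n x
    using that by (simp add: s del: One_nat_def) (rule opr_swap[OF cosimplicial(2)], simp_all add: coface_arr)
  show "face (replacement K D) (Suc n) i (degen (replacement K D) n j x) = x"
    if "i = j \<or> i = Suc j" "j \<le> n" "x \<in> carrier (sgrp (replacement K D) n)" for i j n x
  proof -
    have x: "x \<in> carrier (replacement_group K D n)" using that(3) by (simp add: sgrp_eq)
    have i: "i \<le> Suc n" using that by auto
    have "face (replacement K D) (Suc n) i (degen (replacement K D) n j x) = opr (coface (Suc n) i) (opr (codegen n j) x)"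
      by (simp add: degen_opr[OF x] face_opr[OF opr_degen[OF that(2) x]])
    also have "\<dots> = opr (Comp Delta (codegen n j) (coface (Suc n) i)) x"
      by (rule opr_Comp[OF coface_arr(1)[OF i] coface_arr(2)[OF that(2)]]) (simp_all add: x)
    also have "\<dots> = x" unfolding cosimplicial(3)[OF that(1,2)] by (rule opr_Id[OF x])
    finally show ?thesis .
  qed
  show "face (replacement K D) (Suc (Suc n)) i (degen (replacement K D) (Suc n) j x) =
       degen (replacement K D) n j (face (replacement K D) (Suc n) (i - 1) x)"
    if "Suc j < i" "i \<le> Suc (Suc n)" "x \<in> carrier (sgrp (replacement K D) (Suc n))" for i j n x
    using that by (simp add: s del: One_nat_def) (rule opr_swap[OF cosimplicial(4)], simp_all add: coface_arr)
  show "degen (replacement K D) (Suc n) i (degen (replacement K D) n j x) =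
       degen (replacement K D) (Suc n) (Suc j) (degen (replacement K D) n i x)"
    if "i \<le> j" "j \<le> n" "x \<in> carrier (sgrp (replacement K D) n)" for i j n x
    using that by (simp add: s del: One_nat_def) (rule opr_swap[OF cosimplicial(5)], simp_all add: coface_arr)
qed

end

lemma replacement_simplicial_group:
  "category K \<Longrightarrow> group_diagram K D \<Longrightarrow> simplicial_group (replacement K D)"
  by (rule replacement_setup.simplicial) (simp add: replacement_setup_def replacement_setup_axioms_def)

lemma colim_n_group: "category K \<Longrightarrow> group_diagram K D \<Longrightarrow> group (colim_n K D n)"
  unfolding colim_n_def by (rule simplicial_group.homotopy_group_group) (rule replacement_simplicial_group)

lemma BW_homology_group:
  assumes C: "category C" and G: "natural_system C \<G>" shows "group (BW_homology C \<G> n)"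
proof -
  have X: "category (op_cat (simplex_cat (nerve C)))"
    by (intro category_op simplex_cat_category nerve_simplicial_set)
  have "group_diagram (op_cat (simplex_cat (nerve C))) (precomp \<G> delta_fun)"
    using precomp_diagram[OF X is_functor_op[OF category.delta_functor[OF C]] G] .
  then show ?thesis unfolding BW_homology_def GZ_homology_def
    by (intro colim_n_group Lan_diagram X category_op category_Delta is_functor_op is_functor_forget)
qed

end

(*
  Write R(K, D) for the simplicial replacement, F for the opposite of the factorization category, and
  L for the simplicial group Lan(G o delta). Both R(Delta^op, L) and R(F, G) are compared with L through
  a bisimplicial group: for a simplicial set X and S: (Delta|X)^op -> K, let Z(p,q) be the free product
  of the groups D(k0) over all chains k0 -> ... -> kp in K, q-simplices e of X and arrows kp -> S(e).

  For fixed q the arrow kp -> S(e) can be appended to the chain, which is an extra degeneracy contracting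
  Z(-,q) onto the free product of the D(S(e)), that is onto Lan(D o S). For fixed p, if the simplicial set
  of all pairs (e, k -> S(e)) has an extra degeneracy for each k, it contracts Z(p,-) onto R(K, D).
  This applies to K = Delta^op with X a point (the pairs form a standard simplex) and to K = F, X = BC,
  S = delta (the pairs over f are the factorizations of f into q + 2 factors).

  The contractions are not natural in the other variable, so one needs that a bisimplicial group with
  aspherical rows has an aspherical diagonal. This is proved by dimension shifting: a suitable path object
  of the bisimplicial group maps onto it, has aspherical rows and diagonal, and the kernel again has
  aspherical rows.
*)
theory Submission
  imports Defs
begin

section \<open>Diagrams and their kernels\<close>

text \<open>The groups are non-abelian, so isomorphisms of homotopy groups are extracted from
  surjections of simplicial groups: these are fibrations, and the degreewise kernel is the fibre.
  The needed fragments of the long exact sequence are proved directly on spheres and boundaries.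

  Every contraction adds a vertex at the end of a simplex. This fits the convention that a boundary
  is the last face of a simplex whose other faces are trivial, and it leaves alone the start of a
  chain, where the group D(k0) sits. A contraction therefore only relabels free factors, and its
  face identities become statements about index sets.

  In the lowest degree a contraction collapses to a section composed with the augmentation, not to
  1. It becomes an extra degeneracy in the strict sense on the kernel of the augmentation, and it is
  this kernel that is shown to be aspherical.

  Simplicial groups are functors on Delta^op and kernels keep the element type. Path and loop
  objects thus stay in one HOL type, so that an induction on the degree can generalise over the
  bisimplicial group.\<close>

locale diagram = category K for K :: "('o, 'm) cat" +
  fixes D :: "('o, 'm, 'g) diagram"
  assumes D: "group_diagram K D"
begin

lemma grp: "c \<in> Obj K \<Longrightarrow> group (gobj D c)"
  using D by (simp add: group_diagram_def)

lemma hom: "f \<in> Arr K \<Longrightarrow> gmap D f \<in> hom (gobj D (Dom K f)) (gobj D (Cod K f))"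
  using D by (simp add: group_diagram_def)

lemma closed: "f \<in> Arr K \<Longrightarrow> x \<in> carrier (gobj D (Dom K f)) \<Longrightarrow> gmap D f x \<in> carrier (gobj D (Cod K f))"
  by (rule hom_in_carrier[OF hom])

lemma map_mult: "f \<in> Arr K \<Longrightarrow> x \<in> carrier (gobj D (Dom K f)) \<Longrightarrow> y \<in> carrier (gobj D (Dom K f)) \<Longrightarrow>
    gmap D f (x \<otimes>\<^bsub>gobj D (Dom K f)\<^esub> y) = gmap D f x \<otimes>\<^bsub>gobj D (Cod K f)\<^esub> gmap D f y"
  by (rule hom_mult[OF hom])

lemma map_one: "f \<in> Arr K \<Longrightarrow> gmap D f \<one>\<^bsub>gobj D (Dom K f)\<^esub> = \<one>\<^bsub>gobj D (Cod K f)\<^esub>"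
  by (rule hom_one[OF hom]) (simp_all add: grp Dom_in Cod_in)

lemma map_inv: "f \<in> Arr K \<Longrightarrow> x \<in> carrier (gobj D (Dom K f)) \<Longrightarrow>
    gmap D f (inv\<^bsub>gobj D (Dom K f)\<^esub> x) = inv\<^bsub>gobj D (Cod K f)\<^esub> gmap D f x"
  by (intro group_hom.hom_inv) (auto simp: group_hom_def group_hom_axioms_def grp hom Dom_in Cod_in)

lemma map_Id: "c \<in> Obj K \<Longrightarrow> x \<in> carrier (gobj D c) \<Longrightarrow> gmap D (Id K c) x = x"
  using D by (simp add: group_diagram_def)

lemma map_Comp: "f \<in> Arr K \<Longrightarrow> g \<in> Arr K \<Longrightarrow> Cod K f = Dom K g \<Longrightarrow> x \<in> carrier (gobj D (Dom K f)) \<Longrightarrow>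
    gmap D (Comp K g f) x = gmap D g (gmap D f x)"
  using D by (simp add: group_diagram_def)

end

lemma diagramI: "category K \<Longrightarrow> group_diagram K D \<Longrightarrow> diagram K D"
  by (simp add: diagram_def diagram_axioms_def)

text \<open>Shrinking carriers instead of forming new groups keeps the element type of
  \<open>X\<close>. Kernels can thus be iterated inside one type, as the induction in
  \<open>diag_aspherical\<close> requires.\<close>

definition kernel_diagram ::
  "('o, 'm, 'g) diagram \<Rightarrow> ('o, 'm, 'h) diagram \<Rightarrow> ('o \<Rightarrow> 'g \<Rightarrow> 'h) \<Rightarrow> ('o, 'm, 'g) diagram" where
  "kernel_diagram X Y t = \<lparr>gobj = (\<lambda>c. (gobj X c)\<lparr>carrier := {x \<in> carrier (gobj X c). t c x = \<one>\<^bsub>gobj Y c\<^esub>}\<rparr>),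
     gmap = gmap X\<rparr>"

lemma kernel_diagram_sel [simp]:
  "carrier (gobj (kernel_diagram X Y t) c) = {x \<in> carrier (gobj X c). t c x = \<one>\<^bsub>gobj Y c\<^esub>}"
  "\<one>\<^bsub>gobj (kernel_diagram X Y t) c\<^esub> = \<one>\<^bsub>gobj X c\<^esub>"
  "gmap (kernel_diagram X Y t) = gmap X"
  by (simp_all add: kernel_diagram_def)

lemma nat_transD:
  assumes "nat_trans K X Y t"
  shows "c \<in> Obj K \<Longrightarrow> t c \<in> hom (gobj X c) (gobj Y c)"
    and "f \<in> Arr K \<Longrightarrow> x \<in> carrier (gobj X (Dom K f)) \<Longrightarrow> t (Cod K f) (gmap X f x) = gmap Y f (t (Dom K f) x)"
  using assms by (simp_all add: nat_trans_def)

lemma group_diagram_kernel: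
  assumes K: "category K" and X: "group_diagram K X" and Y: "group_diagram K Y" and t: "nat_trans K X Y t"
  shows "group_diagram K (kernel_diagram X Y t)"
proof -
  interpret X: diagram K X by (rule diagramI[OF K X])
  interpret Y: diagram K Y by (rule diagramI[OF K Y])
  have "group (gobj (kernel_diagram X Y t) c)" if c: "c \<in> Obj K" for c
  proof -
    interpret group_hom "gobj X c" "gobj Y c" "t c"
      using c by (simp add: group_hom_def group_hom_axioms_def X.grp Y.grp nat_transD[OF t])
    show ?thesis using G.subgroup_imp_group[OF subgroup_kernel] by (simp add: kernel_diagram_def kernel_def)
  qed
  then show ?thesis
    unfolding group_diagram_def
  proof (intro conjI ballI impI; (elim CollectE conjE)?)
    fix f assume f: "f \<in> Arr K"
    have "gmap X f x \<in> carrier (gobj (kernel_diagram X Y t) (Cod K f))" if "x \<in> carrier (gobj (kernel_diagram X Y t) (Dom K f))" for x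
      using that nat_transD(2)[OF t f, of x] X.closed[OF f, of x] Y.map_one[OF f] by simp
    moreover have "mult (gobj (kernel_diagram X Y t) c) = mult (gobj X c)" for c by (simp add: kernel_diagram_def)
    ultimately show "gmap (kernel_diagram X Y t) f \<in> hom (gobj (kernel_diagram X Y t) (Dom K f)) (gobj (kernel_diagram X Y t) (Cod K f))"
      using X.map_mult[OF f] by (intro homI) (simp_all del: kernel_diagram_sel(1), simp)
  qed (simp_all add: X.map_Id X.map_Comp)
qed

lemma precomp_sel [simp]: "gobj (precomp D F) c = gobj D (fobj F c)" "gmap (precomp D F) f = gmap D (fmap F f)"
  by (simp_all add: precomp_def)

lemma precomp_kernel: "precomp (kernel_diagram X Y t) F = kernel_diagram (precomp X F) (precomp Y F) (\<lambda>c. t (fobj F c))"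
  by (simp add: precomp_def kernel_diagram_def)

lemma precomp_nat_trans:
  "is_functor A B F \<Longrightarrow> category A \<Longrightarrow> nat_trans B X Y t \<Longrightarrow> nat_trans A (precomp X F) (precomp Y F) (\<lambda>c. t (fobj F c))"
  by (simp add: nat_trans_def is_functor_def) (metis category.Cod_in category.Dom_in)


section \<open>Simplicial groups as diagrams\<close>

abbreviation SD :: "(nat, darr) cat" where "SD \<equiv> op_cat Delta"

lemma category_SD: "category SD"
  by (rule category_op[OF category_Delta])

text \<open>Working with functors on Delta^op turns diagonals, rows and decalage into
  precompositions; \<open>sg\<close> only passes to the record on which homotopy groups are
  defined.\<close>

definition sg :: "(nat, darr, 'g) diagram \<Rightarrow> 'g sgroup" where
  "sg L = \<lparr>sgrp = gobj L, face = (\<lambda>n i. gmap L (coface n i)), degen = (\<lambda>n i. gmap L (codegen n i))\<rparr>"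

lemma sg_sel [simp]: "sgrp (sg L) = gobj L" "face (sg L) n i = gmap L (coface n i)" "degen (sg L) n i = gmap L (codegen n i)"
  by (simp_all add: sg_def)

locale sdiagram =
  fixes L :: "(nat, darr, 'g) diagram"
  assumes L: "group_diagram SD L"
begin

sublocale diagram SD L
  by (rule diagramI[OF category_SD L])

lemma gmap_swap:
  assumes "Comp Delta \<beta> \<alpha> = Comp Delta \<beta>' \<alpha>'" "\<alpha> \<in> Arr Delta" "\<beta> \<in> Arr Delta" "\<alpha>' \<in> Arr Delta" "\<beta>' \<in> Arr Delta"
    "Cod Delta \<alpha> = Dom Delta \<beta>" "Cod Delta \<alpha>' = Dom Delta \<beta>'" "Cod Delta \<beta>' = Cod Delta \<beta>"
    "x \<in> carrier (gobj L (Cod Delta \<beta>))"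
  shows "gmap L \<alpha> (gmap L \<beta> x) = gmap L \<alpha>' (gmap L \<beta>' x)"
  using map_Comp[of \<beta> \<alpha> x] map_Comp[of \<beta>' \<alpha>' x] assms by simp

sublocale simplicial_group "sg L"
proof (rule simplicial_group.intro)
  show "group (sgrp (sg L) n)" for n using grp[of n] by simp
  show "i \<le> Suc n \<Longrightarrow> face (sg L) (Suc n) i \<in> hom (sgrp (sg L) (Suc n)) (sgrp (sg L) n)" for i n
    using hom[of "coface (Suc n) i"] coface_arr by simp
  show "i \<le> n \<Longrightarrow> degen (sg L) n i \<in> hom (sgrp (sg L) n) (sgrp (sg L) (Suc n))" for i n
    using hom[of "codegen n i"] coface_arr by simp
  show "face (sg L) (Suc n) i (face (sg L) (Suc (Suc n)) j x) = face (sg L) (Suc n) (j - 1) (face (sg L) (Suc (Suc n)) i x)"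
    if "i < j" "j \<le> Suc (Suc n)" "x \<in> carrier (sgrp (sg L) (Suc (Suc n)))" for i j n x
    using that by (simp del: One_nat_def) (rule gmap_swap[OF cosimplicial(1)], simp_all add: coface_arr)
  show "face (sg L) (Suc (Suc n)) i (degen (sg L) (Suc n) j x) = degen (sg L) n (j - 1) (face (sg L) (Suc n) i x)"
    if "i < j" "j \<le> Suc n" "x \<in> carrier (sgrp (sg L) (Suc n))" for i j n x
    using that by (simp del: One_nat_def) (rule gmap_swap[OF cosimplicial(2)], simp_all add: coface_arr)
  show "face (sg L) (Suc n) i (degen (sg L) n j x) = x"
    if "i = j \<or> i = Suc j" "j \<le> n" "x \<in> carrier (sgrp (sg L) n)" for i j n x
    using map_Comp[of "codegen n j" "coface (Suc n) i" x] that coface_arr(1)[of i n] coface_arr(2)[of j n] cosimplicial(3)[OF that(1,2)] map_Id[of n x]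
    by auto
  show "face (sg L) (Suc (Suc n)) i (degen (sg L) (Suc n) j x) = degen (sg L) n j (face (sg L) (Suc n) (i - 1) x)"
    if "Suc j < i" "i \<le> Suc (Suc n)" "x \<in> carrier (sgrp (sg L) (Suc n))" for i j n x
    using that by (simp del: One_nat_def) (rule gmap_swap[OF cosimplicial(4)], simp_all add: coface_arr)
  show "degen (sg L) (Suc n) i (degen (sg L) n j x) = degen (sg L) (Suc n) (Suc j) (degen (sg L) n i x)"
    if "i \<le> j" "j \<le> n" "x \<in> carrier (sgrp (sg L) n)" for i j n x
    using that by (simp del: One_nat_def) (rule gmap_swap[OF cosimplicial(5)], simp_all add: coface_arr)
qed

end

text \<open>Triviality of the \<open>n\<close>-th homotopy group, phrased on representatives. All
  0-simplices are spheres, so \<open>aspherical L 0\<close> means that \<open>L\<close> is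
  connected.\<close>

definition aspherical :: "(nat, darr, 'g) diagram \<Rightarrow> nat \<Rightarrow> bool" where
  "aspherical L n \<longleftrightarrow> spheres (sg L) n \<subseteq> boundaries (sg L) n"

lemma boundariesI:
  "\<lbrakk>z \<in> carrier (gobj L (Suc n)); \<And>i. i \<le> n \<Longrightarrow> gmap L (coface (Suc n) i) z = \<one>\<^bsub>gobj L n\<^esub>;
    gmap L (coface (Suc n) (Suc n)) z = x\<rbrakk> \<Longrightarrow> x \<in> boundaries (sg L) n"
  unfolding boundaries_def by (auto intro!: image_eqI[of _ _ z])

lemma boundariesE:
  assumes "x \<in> boundaries (sg L) n"
  obtains z where "z \<in> carrier (gobj L (Suc n))" "\<And>i. i \<le> n \<Longrightarrow> gmap L (coface (Suc n) i) z = \<one>\<^bsub>gobj L n\<^esub>"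
    "gmap L (coface (Suc n) (Suc n)) z = x"
  using assms unfolding boundaries_def by auto

lemma spheres_Suc: "x \<in> spheres (sg L) (Suc n) \<longleftrightarrow>
    x \<in> carrier (gobj L (Suc n)) \<and> (\<forall>i \<le> Suc n. gmap L (coface (Suc n) i) x = \<one>\<^bsub>gobj L n\<^esub>)"
  by (simp add: spheres_def)

lemma spheres_0: "spheres (sg L) 0 = carrier (gobj L 0)"
  by (simp add: spheres_def)

lemma spheres_kernel: "x \<in> spheres (sg (kernel_diagram X Y t)) n \<longleftrightarrow> x \<in> spheres (sg X) n \<and> t n x = \<one>\<^bsub>gobj Y n\<^esub>"
  by (cases n) (auto simp: spheres_0 spheres_Suc)

lemma (in simplicial_group) boundaries_subgroup: "subgroup (boundaries S n) (sgrp S n)"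
  using group.incl_subgroup[OF grp spheres_subgroup normal_imp_subgroup[OF boundaries_normal]] .

lemma (in simplicial_group) class_eq:
  assumes "x \<in> spheres S n" "y \<in> spheres S n"
  shows "homotopic S n `` {x} = homotopic S n `` {y} \<longleftrightarrow> x \<otimes>\<^bsub>sgrp S n\<^esub> inv\<^bsub>sgrp S n\<^esub> y \<in> boundaries S n"
proof -
  interpret G: group "sgrp S n" by (rule grp)
  note B = boundaries_subgroup[of n] and c = spheres_carrier[OF assms(1)] spheres_carrier[OF assms(2)]
  have "boundaries S n #>\<^bsub>sgrp S n\<^esub> x = boundaries S n #>\<^bsub>sgrp S n\<^esub> y \<longleftrightarrow> x \<in> boundaries S n #>\<^bsub>sgrp S n\<^esub> y"
    using G.repr_independence[OF _ c(2) B] G.rcos_self[OF c(1) B] by blast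
  then show ?thesis
    using subgroup.rcos_module[OF B G.group_axioms c(2,1)] assms by (simp add: homotopy_class)
qed

lemma (in simplicial_group) homotopy_carrier: "carrier (homotopy_group S n) = (\<lambda>x. homotopic S n `` {x}) ` spheres S n"
  by (auto simp: homotopy_group_def quotient_def)

lemma (in simplicial_group) class_mult:
  assumes "x \<in> spheres S n" "y \<in> spheres S n"
  shows "homotopic S n `` {x} \<otimes>\<^bsub>homotopy_group S n\<^esub> homotopic S n `` {y} = homotopic S n `` {x \<otimes>\<^bsub>sgrp S n\<^esub> y}"
proof -
  interpret N: normal "boundaries S n" "sphere_group n" by (rule boundaries_normal)
  have xy: "x \<otimes>\<^bsub>sgrp S n\<^esub> y \<in> spheres S n" using assms N.m_closed by simp
  have "homotopic S n `` {x} \<otimes>\<^bsub>homotopy_group S n\<^esub> homotopic S n `` {y} = homotopic S n `` {x} <#>\<^bsub>sphere_group n\<^esub> homotopic S n `` {y}"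
    using homotopy_group_Moore[of n] assms by (auto simp: iso_def hom_def homotopy_carrier)
  also have "\<dots> = boundaries S n #>\<^bsub>sphere_group n\<^esub> (x \<otimes>\<^bsub>sgrp S n\<^esub> y)"
    using N.rcos_sum[of x y] assms by (simp add: homotopy_class rcos_restrict)
  finally show ?thesis using xy by (simp add: homotopy_class rcos_restrict)
qed

section \<open>Simplicial homomorphisms and the induced maps on homotopy groups\<close>

locale smap = X: sdiagram X + Y: sdiagram Y
  for X :: "(nat, darr, 'g) diagram" and Y :: "(nat, darr, 'h) diagram" +
  fixes t :: "nat \<Rightarrow> 'g \<Rightarrow> 'h"
  assumes t: "nat_trans SD X Y t"
begin

lemma t_face: "i \<le> Suc n \<Longrightarrow> x \<in> carrier (gobj X (Suc n)) \<Longrightarrow> t n (gmap X (coface (Suc n) i) x) = gmap Y (coface (Suc n) i) (t (Suc n) x)"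
  using nat_transD(2)[OF t, of "coface (Suc n) i" x] coface_arr(1) by simp

lemma t_degen: "i \<le> n \<Longrightarrow> x \<in> carrier (gobj X n) \<Longrightarrow> t (Suc n) (gmap X (codegen n i) x) = gmap Y (codegen n i) (t n x)"
  using nat_transD(2)[OF t, of "codegen n i" x] coface_arr(2) by simp

sublocale th: group_hom "gobj X n" "gobj Y n" "t n" for n
  using nat_transD(1)[OF t, of n] X.grp Y.grp by (simp add: group_hom_def group_hom_axioms_def)

lemmas X_simps = X.face_closed[simplified] X.face_mult[simplified] X.face_inv[simplified] X.face_one[simplified] X.degen_closed[simplified]
  X.degen_one[simplified]
lemmas Y_simps = Y.face_closed[simplified] Y.face_mult[simplified] Y.face_inv[simplified] Y.face_one[simplified] Y.degen_closed[simplified]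
  Y.degen_one[simplified]

lemma t_boundaries: "x \<in> boundaries (sg X) n \<Longrightarrow> t n x \<in> boundaries (sg Y) n"
  by (elim boundariesE, rule_tac z = "t (Suc n) z" in boundariesI) (auto simp: t_face[symmetric])

lemma t_spheres: "x \<in> spheres (sg X) n \<Longrightarrow> t n x \<in> spheres (sg Y) n"
  by (cases n) (auto simp: spheres_0 spheres_Suc t_face[symmetric])

text \<open>\<open>homotopy_map\<close> yields the union of the classes of the images of all members
  of a class; these classes coincide because \<open>t\<close> maps boundaries to boundaries.\<close>

lemma homotopy_map_class:
  assumes x: "x \<in> spheres (sg X) n"
  shows "homotopy_map (sg Y) n (t n) (homotopic (sg X) n `` {x}) = homotopic (sg Y) n `` {t n x}"
proof -
  have "homotopic (sg Y) n `` {t n a} = homotopic (sg Y) n `` {t n x}" if a: "(x, a) \<in> homotopic (sg X) n" for a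
  proof -
    have as: "a \<in> spheres (sg X) n" using a by (simp add: homotopic_def)
    have c: "a \<in> carrier (gobj X n)" "x \<in> carrier (gobj X n)" using as x X.spheres_carrier by fastforce+
    have "a \<otimes>\<^bsub>gobj X n\<^esub> inv\<^bsub>gobj X n\<^esub> x \<in> boundaries (sg X) n"
      using a x subgroup.rcos_module[OF X.boundaries_subgroup X.simplicial_group_axioms[THEN simplicial_group.grp], of x n a] c
      by (simp add: X.homotopic_iff)
    then have "t n (a \<otimes>\<^bsub>gobj X n\<^esub> inv\<^bsub>gobj X n\<^esub> x) \<in> boundaries (sg Y) n" by (rule t_boundaries)
    then show ?thesis using c as x by (simp add: Y.class_eq t_spheres)
  qed
  moreover have "(x, x) \<in> homotopic (sg X) n"
    using x X.class_eq[OF x x] subgroup.rcos_module[OF X.boundaries_subgroup X.simplicial_group_axioms[THEN simplicial_group.grp], of x n x] X.spheres_carrier[OF x]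
      subgroup.one_closed[OF X.boundaries_subgroup[of n]]
    by (simp add: X.homotopic_iff)
  ultimately have "(\<Union>a \<in> homotopic (sg X) n `` {x}. homotopic (sg Y) n `` {t n a}) = homotopic (sg Y) n `` {t n x}"
    by blast
  then show ?thesis unfolding homotopy_map_def by (subst Image_eq_UN) (simp add: image_image)
qed

lemma homotopy_map_hom: "homotopy_map (sg Y) n (t n) \<in> hom (homotopy_group (sg X) n) (homotopy_group (sg Y) n)"
proof (rule homI)
  fix a b assume "a \<in> carrier (homotopy_group (sg X) n)" "b \<in> carrier (homotopy_group (sg X) n)"
  then obtain x y where *: "x \<in> spheres (sg X) n" "a = homotopic (sg X) n `` {x}" "y \<in> spheres (sg X) n" "b = homotopic (sg X) n `` {y}"
    by (auto simp: X.homotopy_carrier)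
  have c: "x \<in> carrier (gobj X n)" "y \<in> carrier (gobj X n)" using * X.spheres_carrier by fastforce+
  show "homotopy_map (sg Y) n (t n) (a \<otimes>\<^bsub>homotopy_group (sg X) n\<^esub> b) =
    homotopy_map (sg Y) n (t n) a \<otimes>\<^bsub>homotopy_group (sg Y) n\<^esub> homotopy_map (sg Y) n (t n) b"
    using * c subgroup.m_closed[OF X.spheres_subgroup *(1,3)]
    by (simp add: X.class_mult Y.class_mult homotopy_map_class t_spheres)
qed (auto simp: X.homotopy_carrier Y.homotopy_carrier homotopy_map_class t_spheres)

end

section \<open>Surjections as fibrations: fragments of the long exact sequence\<close>

locale surjection = smap X Y t
  for X :: "(nat, darr, 'g) diagram" and Y :: "(nat, darr, 'h) diagram" and t +
  assumes surj: "y \<in> carrier (gobj Y n) \<Longrightarrow> \<exists>x \<in> carrier (gobj X n). t n x = y"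
begin

text \<open>Surjections of simplicial groups are fibrations: the faces of a lift are normalised one after
  the other by dividing by degeneracies.\<close>

lemma lift_aux:
  assumes y: "y \<in> carrier (gobj Y (Suc n))" "\<And>i. i \<le> n \<Longrightarrow> gmap Y (coface (Suc n) i) y = \<one>\<^bsub>gobj Y n\<^esub>"
    and k: "k \<le> Suc n"
  shows "\<exists>x \<in> carrier (gobj X (Suc n)). t (Suc n) x = y \<and> (\<forall>i < k. gmap X (coface (Suc n) i) x = \<one>\<^bsub>gobj X n\<^esub>)"
  using k
proof (induction k)
  case 0 then show ?case using surj[OF y(1)] by auto
next
  case (Suc k)
  then obtain x where x: "x \<in> carrier (gobj X (Suc n))" "t (Suc n) x = y" "\<And>i. i < k \<Longrightarrow> gmap X (coface (Suc n) i) x = \<one>\<^bsub>gobj X n\<^esub>"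
    by auto
  let ?d = "gmap X (coface (Suc n) k) x"
  let ?s = "gmap X (codegen n k) ?d"
  let ?x = "x \<otimes>\<^bsub>gobj X (Suc n)\<^esub> inv\<^bsub>gobj X (Suc n)\<^esub> ?s"
  have d: "?d \<in> carrier (gobj X n)" using x Suc by (simp add: X_simps)
  then have s: "?s \<in> carrier (gobj X (Suc n))" using Suc by (simp add: X_simps)
  \<comment> \<open>Here k \<le> n, so the \<open>k\<close>-th face of \<open>y\<close> is trivial
    and the correction \<open>?s\<close> lies in the kernel of \<open>t\<close>.\<close>
  have "t (Suc n) ?s = \<one>\<^bsub>gobj Y (Suc n)\<^esub>" using x y Suc d by (simp add: t_face t_degen Y_simps)
  then have "t (Suc n) ?x = y" using x y(1) s by simp
  moreover have "gmap X (coface (Suc n) i) ?x = \<one>\<^bsub>gobj X n\<^esub>" if "i < Suc k" for i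
  proof (cases "i = k")
    case True
    have "gmap X (coface (Suc n) k) ?s = ?d" using X.face_degen_id[of k k n ?d] d Suc by simp
    then show ?thesis using True x s d Suc by (simp add: X_simps)
  next
    case False
    then have ik: "i < k" using that by simp
    then obtain m where m: "n = Suc m" "i < k" using Suc by (cases n) auto
    \<comment> \<open>For i < k the simplicial identities reduce the \<open>i\<close>-th face of the
      correction to an image of the \<open>i\<close>-th face of \<open>x\<close>, which is already
      trivial.\<close>
    have "gmap X (coface (Suc n) i) ?s = gmap X (codegen m (k - 1)) (gmap X (coface (Suc m) i) ?d)"
      using X.face_degen_less[of i k m ?d] d m Suc by simp
    also have "gmap X (coface (Suc m) i) ?d = gmap X (coface (Suc m) (k - 1)) (gmap X (coface (Suc n) i) x)"
      using X.face_face[of i k m x] x(1) m Suc by simp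
    also have "\<dots> = \<one>\<^bsub>gobj X m\<^esub>" using x(3)[of i] m Suc by (simp add: X_simps)
    finally have "gmap X (coface (Suc n) i) ?s = \<one>\<^bsub>gobj X n\<^esub>" using m Suc by (simp add: X_simps)
    then show ?thesis using x(1,3) s Suc m by (simp add: X_simps)
  qed
  ultimately show ?case using x(1) s by (intro bexI[of _ ?x]) auto
qed

lemma lift:
  assumes "y \<in> carrier (gobj Y (Suc n))" "\<And>i. i \<le> n \<Longrightarrow> gmap Y (coface (Suc n) i) y = \<one>\<^bsub>gobj Y n\<^esub>"
  obtains x where "x \<in> carrier (gobj X (Suc n))" "t (Suc n) x = y" "\<And>i. i \<le> n \<Longrightarrow> gmap X (coface (Suc n) i) x = \<one>\<^bsub>gobj X n\<^esub>"
  using lift_aux[OF assms order_refl] by (auto simp: less_Suc_eq_le)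

text \<open>Exactness of pi_(n+1)(Y) -> pi_n(ker t) -> pi_n(X). A sphere \<open>x\<close> of the
  kernel bounds some \<open>w\<close> in \<open>X\<close>, whose image in \<open>Y\<close> is a
  sphere of dimension n+1. A lift of a filling of that sphere corrects \<open>w\<close> into the
  kernel without changing its faces.\<close>

lemma kernel_aspherical:
  assumes AX: "aspherical X n" and AY: "aspherical Y (Suc n)"
  shows "aspherical (kernel_diagram X Y t) n"
  unfolding aspherical_def
proof
  fix x assume "x \<in> spheres (sg (kernel_diagram X Y t)) n"
  then have x: "x \<in> spheres (sg X) n" "t n x = \<one>\<^bsub>gobj Y n\<^esub>" by (simp_all add: spheres_kernel)
  then have "x \<in> boundaries (sg X) n" using AX by (auto simp: aspherical_def)
  then obtain w where w: "w \<in> carrier (gobj X (Suc n))" "\<And>i. i \<le> n \<Longrightarrow> gmap X (coface (Suc n) i) w = \<one>\<^bsub>gobj X n\<^esub>"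
    "gmap X (coface (Suc n) (Suc n)) w = x" by (elim boundariesE) blast
  have "t (Suc n) w \<in> spheres (sg Y) (Suc n)"
    using w x by (auto simp: spheres_Suc t_face[symmetric] le_Suc_eq)
  then have "t (Suc n) w \<in> boundaries (sg Y) (Suc n)" using AY by (auto simp: aspherical_def)
  then obtain v where v: "v \<in> carrier (gobj Y (Suc (Suc n)))"
    "\<And>i. i \<le> Suc n \<Longrightarrow> gmap Y (coface (Suc (Suc n)) i) v = \<one>\<^bsub>gobj Y (Suc n)\<^esub>"
    "gmap Y (coface (Suc (Suc n)) (Suc (Suc n))) v = t (Suc n) w" by (elim boundariesE) blast
  obtain u where u: "u \<in> carrier (gobj X (Suc (Suc n)))" "t (Suc (Suc n)) u = v"
    "\<And>i. i \<le> Suc n \<Longrightarrow> gmap X (coface (Suc (Suc n)) i) u = \<one>\<^bsub>gobj X (Suc n)\<^esub>"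
    using lift[OF v(1,2)] by blast
  let ?d = "gmap X (coface (Suc (Suc n)) (Suc (Suc n))) u"
  have d: "?d \<in> carrier (gobj X (Suc n))" using u by (simp add: X_simps)
  \<comment> \<open>All other faces of \<open>u\<close> are trivial, so its last face is a sphere;
    dividing by it does not disturb the faces of \<open>w\<close>.\<close>
  have f: "gmap X (coface (Suc n) i) ?d = \<one>\<^bsub>gobj X n\<^esub>" if "i \<le> Suc n" for i
    using X.face_face[of i "Suc (Suc n)" n u] that u X_simps(4) by simp
  let ?w = "w \<otimes>\<^bsub>gobj X (Suc n)\<^esub> inv\<^bsub>gobj X (Suc n)\<^esub> ?d"
  have "t (Suc n) ?w = \<one>\<^bsub>gobj Y (Suc n)\<^esub>" using w d u v by (simp add: t_face)
  then show "x \<in> boundaries (sg (kernel_diagram X Y t)) n"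
    using w d f X.spheres_carrier[OF x(1)] by (intro boundariesI[of ?w]) (simp_all add: X_simps)
qed

text \<open>Exactness of pi_n(X) -> pi_n(Y) -> pi_(n-1)(ker t), on spheres rather than classes. Take
  a lift of \<open>y\<close> with all faces but the last trivial: its last face is a sphere of the
  kernel, and dividing the lift by a filling inside the kernel leaves a sphere over
  \<open>y\<close>.\<close>

lemma lift_sphere:
  assumes y: "y \<in> spheres (sg Y) n" and A: "\<And>m. n = Suc m \<Longrightarrow> aspherical (kernel_diagram X Y t) m"
  shows "\<exists>x \<in> spheres (sg X) n. t n x = y"
proof (cases n)
  case 0 then show ?thesis using surj y by (simp add: spheres_0)
next
  case (Suc m)
  have y': "y \<in> carrier (gobj Y (Suc m))" "\<And>i. i \<le> Suc m \<Longrightarrow> gmap Y (coface (Suc m) i) y = \<one>\<^bsub>gobj Y m\<^esub>"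
    using y Suc by (simp_all add: spheres_Suc)
  obtain x where x: "x \<in> carrier (gobj X (Suc m))" "t (Suc m) x = y" "\<And>i. i \<le> m \<Longrightarrow> gmap X (coface (Suc m) i) x = \<one>\<^bsub>gobj X m\<^esub>"
    using lift[OF y'(1)] y'(2) by (metis le_Suc_eq)
  let ?d = "gmap X (coface (Suc m) (Suc m)) x"
  have d: "?d \<in> carrier (gobj X m)" using x by (simp add: X_simps)
  have "?d \<in> spheres (sg X) m"
  proof (cases m)
    case 0 then show ?thesis using d by (simp add: spheres_0)
  next
    case (Suc k)
    have "gmap X (coface (Suc k) i) ?d = \<one>\<^bsub>gobj X k\<^esub>" if "i \<le> Suc k" for i
      using X.face_face[of i "Suc (Suc k)" k x] that x Suc X_simps(4) by simp
    then show ?thesis using d Suc by (simp add: spheres_Suc)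
  qed
  then have "?d \<in> spheres (sg (kernel_diagram X Y t)) m"
    using x y' by (simp add: spheres_kernel t_face)
  then have "?d \<in> boundaries (sg (kernel_diagram X Y t)) m" using A[OF Suc] by (auto simp: aspherical_def)
  then obtain z where z: "z \<in> carrier (gobj X (Suc m))" "t (Suc m) z = \<one>\<^bsub>gobj Y (Suc m)\<^esub>"
    "\<And>i. i \<le> m \<Longrightarrow> gmap X (coface (Suc m) i) z = \<one>\<^bsub>gobj X m\<^esub>" "gmap X (coface (Suc m) (Suc m)) z = ?d"
    by (elim boundariesE, simp, blast)
  let ?x = "x \<otimes>\<^bsub>gobj X (Suc m)\<^esub> inv\<^bsub>gobj X (Suc m)\<^esub> z"
  have "?x \<in> spheres (sg X) (Suc m)"
    using x z d by (auto simp: spheres_Suc X_simps le_Suc_eq)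
  moreover have "t (Suc m) ?x = y" using x z y' by simp
  ultimately show ?thesis using Suc by blast
qed

lemma aspherical_image: "aspherical X n \<Longrightarrow> (\<And>m. n = Suc m \<Longrightarrow> aspherical (kernel_diagram X Y t) m) \<Longrightarrow> aspherical Y n"
  using lift_sphere t_boundaries unfolding aspherical_def by blast

text \<open>Injectivity on homotopy from pi_n(ker t) = 0: a filling of \<open>t n x\<close> is
  lifted, and \<open>x\<close> divided by the last face of the lift is a sphere of the
  kernel.\<close>

lemma reflect_boundary:
  assumes x: "x \<in> spheres (sg X) n" and b: "t n x \<in> boundaries (sg Y) n" and A: "aspherical (kernel_diagram X Y t) n"
  shows "x \<in> boundaries (sg X) n"
proof -
  obtain v where v: "v \<in> carrier (gobj Y (Suc n))" "\<And>i. i \<le> n \<Longrightarrow> gmap Y (coface (Suc n) i) v = \<one>\<^bsub>gobj Y n\<^esub>"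
    "gmap Y (coface (Suc n) (Suc n)) v = t n x" using b by (elim boundariesE) blast
  obtain u where u: "u \<in> carrier (gobj X (Suc n))" "t (Suc n) u = v" "\<And>i. i \<le> n \<Longrightarrow> gmap X (coface (Suc n) i) u = \<one>\<^bsub>gobj X n\<^esub>"
    using lift[OF v(1,2)] by blast
  let ?d = "gmap X (coface (Suc n) (Suc n)) u"
  have xc: "x \<in> carrier (gobj X n)" using X.spheres_carrier[OF x] by simp
  have db: "?d \<in> boundaries (sg X) n" using u by (intro boundariesI[of u]) auto
  then have d: "?d \<in> spheres (sg X) n" using X.boundary_sphere by blast
  then have dc: "?d \<in> carrier (gobj X n)" using X.spheres_carrier by fastforce
  have "x \<otimes>\<^bsub>gobj X n\<^esub> inv\<^bsub>gobj X n\<^esub> ?d \<in> spheres (sg X) n"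
    using subgroup.m_closed[OF X.spheres_subgroup x subgroup.m_inv_closed[OF X.spheres_subgroup d]] by simp
  moreover have "t n (x \<otimes>\<^bsub>gobj X n\<^esub> inv\<^bsub>gobj X n\<^esub> ?d) = \<one>\<^bsub>gobj Y n\<^esub>"
    using xc dc u v t_face[of "Suc n" n u] by simp
  ultimately have "x \<otimes>\<^bsub>gobj X n\<^esub> inv\<^bsub>gobj X n\<^esub> ?d \<in> boundaries (sg (kernel_diagram X Y t)) n"
    using A by (auto simp: aspherical_def spheres_kernel)
  then obtain k where k: "k \<in> carrier (gobj X (Suc n))" "\<And>i. i \<le> n \<Longrightarrow> gmap X (coface (Suc n) i) k = \<one>\<^bsub>gobj X n\<^esub>"
    "gmap X (coface (Suc n) (Suc n)) k = x \<otimes>\<^bsub>gobj X n\<^esub> inv\<^bsub>gobj X n\<^esub> ?d"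
    by (elim boundariesE, simp, blast)
  show ?thesis
    using k u xc dc by (intro boundariesI[of "k \<otimes>\<^bsub>gobj X (Suc n)\<^esub> u"]) (simp_all add: X_simps X.grp group.is_group th.G.m_assoc)
qed

text \<open>The kernel stands in for the homotopy fibre: its vanishing in degree n-1 gives
  surjectivity, in degree n injectivity.\<close>

lemma homotopy_map_iso:
  assumes A: "\<And>n. aspherical (kernel_diagram X Y t) n"
  shows "homotopy_map (sg Y) n (t n) \<in> iso (homotopy_group (sg X) n) (homotopy_group (sg Y) n)"
proof -
  have "inj_on (homotopy_map (sg Y) n (t n)) (carrier (homotopy_group (sg X) n))"
  proof (rule inj_onI)
    fix a b assume "a \<in> carrier (homotopy_group (sg X) n)" "b \<in> carrier (homotopy_group (sg X) n)"
      and e: "homotopy_map (sg Y) n (t n) a = homotopy_map (sg Y) n (t n) b"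
    then obtain x y where *: "x \<in> spheres (sg X) n" "a = homotopic (sg X) n `` {x}" "y \<in> spheres (sg X) n" "b = homotopic (sg X) n `` {y}"
      by (auto simp: X.homotopy_carrier)
    have c: "x \<in> carrier (gobj X n)" "y \<in> carrier (gobj X n)" using * X.spheres_carrier by fastforce+
    have "x \<otimes>\<^bsub>gobj X n\<^esub> inv\<^bsub>gobj X n\<^esub> y \<in> spheres (sg X) n"
      using subgroup.m_closed[OF X.spheres_subgroup *(1) subgroup.m_inv_closed[OF X.spheres_subgroup *(3)]] by simp
    moreover have "t n (x \<otimes>\<^bsub>gobj X n\<^esub> inv\<^bsub>gobj X n\<^esub> y) \<in> boundaries (sg Y) n"
      using e * c by (simp add: homotopy_map_class Y.class_eq t_spheres)
    ultimately show "a = b" using reflect_boundary A * by (simp add: X.class_eq)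
  qed
  moreover have "homotopy_map (sg Y) n (t n) ` carrier (homotopy_group (sg X) n) = carrier (homotopy_group (sg Y) n)"
  proof -
    have "t n ` spheres (sg X) n = spheres (sg Y) n" using lift_sphere A t_spheres by blast
    then show ?thesis by (auto simp: X.homotopy_carrier Y.homotopy_carrier homotopy_map_class image_image)
      (metis (no_types, lifting) homotopy_map_class imageE imageI)
  qed
  ultimately show ?thesis using homotopy_map_hom by (simp add: iso_def bij_betw_def)
qed

end

section \<open>Bisimplicial groups\<close>

definition prod_cat :: "('o, 'm) cat \<Rightarrow> ('p, 'q) cat \<Rightarrow> ('o \<times> 'p, 'm \<times> 'q) cat" where
  "prod_cat A B = \<lparr>Obj = Obj A \<times> Obj B, Arr = Arr A \<times> Arr B, Dom = map_prod (Dom A) (Dom B),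
     Cod = map_prod (Cod A) (Cod B), Id = map_prod (Id A) (Id B),
     Comp = (\<lambda>g f. (Comp A (fst g) (fst f), Comp B (snd g) (snd f)))\<rparr>"

lemma prod_sel [simp]:
  "Obj (prod_cat A B) = Obj A \<times> Obj B" "Arr (prod_cat A B) = Arr A \<times> Arr B"
  "Dom (prod_cat A B) (f, g) = (Dom A f, Dom B g)" "Cod (prod_cat A B) (f, g) = (Cod A f, Cod B g)"
  "Id (prod_cat A B) (a, b) = (Id A a, Id B b)"
  "Comp (prod_cat A B) (f', g') (f, g) = (Comp A f' f, Comp B g' g)"
  by (simp_all add: prod_cat_def)

lemma category_prod: "category A \<Longrightarrow> category B \<Longrightarrow> category (prod_cat A B)"
  unfolding category_def by auto

abbreviation DD :: "(nat \<times> nat, darr \<times> darr) cat" where "DD \<equiv> prod_cat SD SD"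

lemma category_DD: "category DD"
  by (intro category_prod category_SD)

text \<open>A natural transformation between index functors induces a map of diagrams. The last
  vertex and the last face of a decalage are maps of this kind.\<close>

lemma whisker:
  assumes A: "category A" and X: "group_diagram B X" and F: "is_functor A B F" and F': "is_functor A B F'"
    and \<nu>: "\<And>c. c \<in> Obj A \<Longrightarrow> \<nu> c \<in> Arr B \<and> Dom B (\<nu> c) = fobj F c \<and> Cod B (\<nu> c) = fobj F' c"
    and nat: "\<And>f. f \<in> Arr A \<Longrightarrow> Comp B (\<nu> (Cod A f)) (fmap F f) = Comp B (fmap F' f) (\<nu> (Dom A f))"
  shows "nat_trans A (precomp X F) (precomp X F') (\<lambda>c. gmap X (\<nu> c))"
  unfolding nat_trans_def precomp_sel
proof (intro conjI ballI)
  fix c assume "c \<in> Obj A"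
  then show "gmap X (\<nu> c) \<in> hom (gobj X (fobj F c)) (gobj X (fobj F' c))"
    using X \<nu>[of c] unfolding group_diagram_def by metis
next
  fix f x assume f: "f \<in> Arr A" and x: "x \<in> carrier (gobj X (fobj F (Dom A f)))"
  have F1: "fmap F f \<in> Arr B" "Dom B (fmap F f) = fobj F (Dom A f)" "Cod B (fmap F f) = fobj F (Cod A f)"
    and F2: "fmap F' f \<in> Arr B" "Dom B (fmap F' f) = fobj F' (Dom A f)" "Cod B (fmap F' f) = fobj F' (Cod A f)"
    using F F' f by (simp_all add: is_functor_def)
  note d = \<nu>[OF category.Dom_in[OF A f]] and c = \<nu>[OF category.Cod_in[OF A f]]
  have X: "gmap X (Comp B g h) x = gmap X g (gmap X h x)"
    if "h \<in> Arr B" "g \<in> Arr B" "Cod B h = Dom B g" "Dom B h = fobj F (Dom A f)" for g h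
    using X x that unfolding group_diagram_def by metis
  show "gmap X (\<nu> (Cod A f)) (gmap X (fmap F f) x) = gmap X (fmap F' f) (gmap X (\<nu> (Dom A f)) x)"
    using X[of "fmap F f" "\<nu> (Cod A f)"] X[of "\<nu> (Dom A f)" "fmap F' f"] nat[OF f] F1 F2 c d by simp
qed

lemma nat_trans_kernel: "nat_trans A X Z s \<Longrightarrow> nat_trans A (kernel_diagram X Y t) Z s"
  by (auto simp: nat_trans_def hom_def kernel_diagram_def)

section \<open>Decalage, last vertices and the extra degeneracy of decalage\<close>

text \<open>\<open>dec \<alpha>\<close> extends \<open>\<alpha>\<close> by a new last vertex, so that \<open>gmap L \<circ> dec\<close> is the decalage forgetting the
  last face of \<open>L\<close>.\<close>

definition dec :: "darr \<Rightarrow> darr" where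
  "dec = (\<lambda>(m, f, n). (Suc m, restrict (\<lambda>i. if i \<le> m then f i else Suc n) {..Suc m}, Suc n))"

definition vtx :: "nat \<Rightarrow> darr" where
  "vtx n = (0, restrict (\<lambda>_. n) {..0}, n)"

definition bang :: "nat \<Rightarrow> darr" where
  "bang n = (n, restrict (\<lambda>_. 0) {..n}, 0)"

text \<open>Collapses the front face to the vertex 0 of [1]. Along it an edge of a simplicial group
  becomes a simplex that is constant away from its last vertex.\<close>

definition step :: "nat \<Rightarrow> darr" where
  "step n = (Suc n, restrict (\<lambda>i. if i \<le> n then 0 else 1) {..Suc n}, 1)"

lemma arr_cases:
  assumes "\<alpha> \<in> Arr Delta"
  obtains m f n where "\<alpha> = (m, f, n)" "f \<in> extensional {..m}" "\<And>i. i \<le> m \<Longrightarrow> f i \<le> n" "\<And>i j. i \<le> j \<Longrightarrow> j \<le> m \<Longrightarrow> f i \<le> f j"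
proof -
  obtain m f n where a: "\<alpha> = (m, f, n)" by (metis prod_cases3)
  show ?thesis by (rule that[of m f n]) (use assms a in \<open>auto simp: PiE_def mono_on_def\<close>)
qed

lemma arrI: "f \<in> extensional {..m} \<Longrightarrow> (\<And>i. i \<le> m \<Longrightarrow> f i \<le> n) \<Longrightarrow> (\<And>i j. i \<le> j \<Longrightarrow> j \<le> m \<Longrightarrow> f i \<le> f j) \<Longrightarrow> (m, f, n) \<in> Arr Delta"
  by (auto simp: PiE_def mono_on_def)

lemma dec_sel [simp]: "Dom Delta (dec \<alpha>) = Suc (Dom Delta \<alpha>)" "Cod Delta (dec \<alpha>) = Suc (Cod Delta \<alpha>)"
  by (cases \<alpha>, simp add: dec_def)+

lemma dec_arr [simp]: "\<alpha> \<in> Arr Delta \<Longrightarrow> dec \<alpha> \<in> Arr Delta"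
  by (elim arr_cases) (auto simp: dec_def le_Suc_eq simp del: Delta_sel(2) intro!: arrI)

lemma dec_Id: "dec (Id Delta n) = Id Delta (Suc n)"
  by (auto simp: dec_def fun_eq_iff)

lemma dec_Comp: "\<alpha> \<in> Arr Delta \<Longrightarrow> \<beta> \<in> Arr Delta \<Longrightarrow> Cod Delta \<alpha> = Dom Delta \<beta> \<Longrightarrow> dec (Comp Delta \<beta> \<alpha>) = Comp Delta (dec \<beta>) (dec \<alpha>)"
  by (elim arr_cases) (auto simp: dec_def fun_eq_iff compose_def le_Suc_eq simp del: Delta_sel(2))

lemma special_sel [simp]:
  "Dom Delta (vtx n) = 0" "Cod Delta (vtx n) = n" "vtx n \<in> Arr Delta"
  "Dom Delta (bang n) = n" "Cod Delta (bang n) = 0" "bang n \<in> Arr Delta"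
  "Dom Delta (step n) = Suc n" "Cod Delta (step n) = 1" "step n \<in> Arr Delta"
  by (auto simp: vtx_def bang_def step_def mono_on_def)

lemma Id_arr [simp]: "Dom Delta (Id Delta n) = n" "Cod Delta (Id Delta n) = n" "Id Delta n \<in> Arr Delta"
  by (auto simp: mono_on_def)

lemma dec_last: "\<alpha> \<in> Arr Delta \<Longrightarrow> Comp Delta (dec \<alpha>) (coface (Suc (Dom Delta \<alpha>)) (Suc (Dom Delta \<alpha>))) =
    Comp Delta (coface (Suc (Cod Delta \<alpha>)) (Suc (Cod Delta \<alpha>))) \<alpha>"
  by (elim arr_cases) (auto simp: dec_def coface_def fun_eq_iff compose_def extensional_def le_Suc_eq less_Suc_eq_le simp del: Delta_sel(2))

lemma dec_vtx: "Comp Delta (dec \<alpha>) (vtx (Suc (Dom Delta \<alpha>))) = vtx (Suc (Cod Delta \<alpha>))"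
  by (cases \<alpha>) (auto simp: dec_def vtx_def fun_eq_iff compose_def)

text \<open>By the first two equations the last codegeneracy is an extra degeneracy of decalage. In
  the lowest degree only the last vertex remains (third equation), so killing this vertex makes
  decalage contractible.\<close>

lemma special_comp:
  "Comp Delta (codegen (Suc n) (Suc n)) (dec (coface (Suc n) (Suc n))) = Id Delta (Suc n)"
  "i \<le> Suc n \<Longrightarrow> Comp Delta (codegen (Suc (Suc n)) (Suc (Suc n))) (dec (coface (Suc (Suc n)) i)) =
     Comp Delta (dec (coface (Suc n) i)) (codegen (Suc n) (Suc n))"
  "Comp Delta (codegen (Suc 0) (Suc 0)) (dec (coface (Suc 0) 0)) = Comp Delta (vtx (Suc 0)) (codegen 0 0)"
  "Comp Delta (codegen (Suc n) (Suc n)) (vtx (Suc (Suc n))) = vtx (Suc n)"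
  "Comp Delta (codegen n n) (vtx (Suc n)) = vtx n"
  "Comp Delta (step n) (coface (Suc n) (Suc n)) = Comp Delta (coface (Suc 0) (Suc 0)) (bang n)"
  "Comp Delta (step n) (vtx (Suc n)) = coface (Suc 0) 0"
  by (auto simp: codegen_def coface_def dec_def vtx_def step_def bang_def fun_eq_iff compose_def)

lemma Delta_Comp_Id [simp]: "\<alpha> \<in> Arr Delta \<Longrightarrow> Cod Delta \<alpha> = n \<Longrightarrow> Comp Delta (Id Delta n) \<alpha> = \<alpha>"
  "\<alpha> \<in> Arr Delta \<Longrightarrow> Dom Delta \<alpha> = n \<Longrightarrow> Comp Delta \<alpha> (Id Delta n) = \<alpha>"
  using category.Id_Comp[OF category_Delta] category.Comp_Id[OF category_Delta] by blast+

lemmas Delta_Comp [simp] = category.Comp_in[OF category_Delta] category.Dom_Comp[OF category_Delta] category.Cod_Comp[OF category_Delta]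

declare Delta_sel(2,5) [simp del] coface_arr [simp]

definition diagF :: "(nat, darr, nat \<times> nat, darr \<times> darr) func" where
  "diagF = \<lparr>fobj = (\<lambda>n. (n, n)), fmap = (\<lambda>\<alpha>. (\<alpha>, \<alpha>))\<rparr>"

definition rowF :: "nat \<Rightarrow> (nat, darr, nat \<times> nat, darr \<times> darr) func" where
  "rowF q = \<lparr>fobj = (\<lambda>p. (p, q)), fmap = (\<lambda>\<alpha>. (\<alpha>, Id Delta q))\<rparr>"

definition decF :: "(nat \<times> nat, darr \<times> darr, nat \<times> nat, darr \<times> darr) func" where
  "decF = \<lparr>fobj = map_prod Suc Suc, fmap = map_prod dec dec\<rparr>"

definition vtxF :: "(nat \<times> nat, darr \<times> darr, nat \<times> nat, darr \<times> darr) func" where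
  "vtxF = \<lparr>fobj = (\<lambda>(p, q). (0, Suc q)), fmap = (\<lambda>(\<alpha>, \<beta>). (Id Delta 0, dec \<beta>))\<rparr>"

lemma F_sel [simp]:
  "fobj diagF n = (n, n)" "fmap diagF \<alpha> = (\<alpha>, \<alpha>)" "fobj (rowF q) p = (p, q)" "fmap (rowF q) \<alpha> = (\<alpha>, Id Delta q)"
  "fobj decF (p, q) = (Suc p, Suc q)" "fmap decF (\<alpha>, \<beta>) = (dec \<alpha>, dec \<beta>)"
  "fobj vtxF (p, q) = (0, Suc q)" "fmap vtxF (\<alpha>, \<beta>) = (Id Delta 0, dec \<beta>)"
  by (simp_all add: diagF_def rowF_def decF_def vtxF_def)

lemma is_functor_F: "is_functor SD DD diagF" "is_functor SD DD (rowF q)" "is_functor DD DD decF" "is_functor DD DD vtxF"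
  by (auto simp: is_functor_def dec_Id dec_Comp)

section \<open>The path object and the loop object of a bisimplicial group\<close>

locale bisimplicial =
  fixes K :: "(nat \<times> nat, darr \<times> darr, 'g) diagram"
  assumes K: "group_diagram DD K"
begin

sublocale diagram DD K
  by (rule diagramI[OF category_DD K])

lemma comp2: "\<lbrakk>\<alpha> \<in> Arr Delta; \<beta> \<in> Arr Delta; \<alpha>' \<in> Arr Delta; \<beta>' \<in> Arr Delta; Cod Delta \<alpha> = Dom Delta \<alpha>'; Cod Delta \<beta> = Dom Delta \<beta>';
    x \<in> carrier (gobj K (Cod Delta \<alpha>', Cod Delta \<beta>'))\<rbrakk>
  \<Longrightarrow> gmap K (\<alpha>, \<beta>) (gmap K (\<alpha>', \<beta>') x) = gmap K (Comp Delta \<alpha>' \<alpha>, Comp Delta \<beta>' \<beta>) x"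
  using map_Comp[of "(\<alpha>', \<beta>')" "(\<alpha>, \<beta>)" x] by simp

lemma closed2: "\<lbrakk>\<alpha> \<in> Arr Delta; \<beta> \<in> Arr Delta; Dom Delta \<alpha> = p; Dom Delta \<beta> = q; x \<in> carrier (gobj K (Cod Delta \<alpha>, Cod Delta \<beta>))\<rbrakk>
  \<Longrightarrow> gmap K (\<alpha>, \<beta>) x \<in> carrier (gobj K (p, q))"
  using closed[of "(\<alpha>, \<beta>)" x] by simp

lemma one2: "\<lbrakk>\<alpha> \<in> Arr Delta; \<beta> \<in> Arr Delta; Cod Delta \<alpha> = p; Cod Delta \<beta> = q\<rbrakk>
  \<Longrightarrow> gmap K (\<alpha>, \<beta>) \<one>\<^bsub>gobj K (p, q)\<^esub> = \<one>\<^bsub>gobj K (Dom Delta \<alpha>, Dom Delta \<beta>)\<^esub>"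
  using map_one[of "(\<alpha>, \<beta>)"] by simp

lemma id2: "x \<in> carrier (gobj K (p, q)) \<Longrightarrow> gmap K (Id Delta p, Id Delta q) x = x"
  using map_Id[of "(p, q)" x] by simp

lemma diag_diagram: "group_diagram SD (precomp K diagF)"
  by (rule precomp_diagram[OF category_SD is_functor_F(1) K])

lemma row_diagram: "group_diagram SD (precomp K (rowF q))"
  by (rule precomp_diagram[OF category_SD is_functor_F(2) K])

abbreviation "lastv \<equiv> (\<lambda>c. gmap K (vtx (Suc (fst c)), Id Delta (Suc (snd c))))"
abbreviation "lastf \<equiv> (\<lambda>c. gmap K (coface (Suc (fst c)) (Suc (fst c)), coface (Suc (snd c)) (Suc (snd c))))"

text \<open>The path object shifts both degrees, but trivialises only the last vertex in the first direction:
  trivialising the last vertex in both directions would destroy the asphericity of the rows.\<close>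

definition path :: "(nat \<times> nat, darr \<times> darr, 'g) diagram" where
  "path = kernel_diagram (precomp K decF) (precomp K vtxF) lastv"

lemma lastv_nat: "nat_trans DD (precomp K decF) (precomp K vtxF) lastv"
  by (rule whisker[OF category_DD K is_functor_F(3,4)]) (auto simp: dec_vtx[of "(m, f, n)" for m f n, simplified])

lemma path_diagram: "group_diagram DD path"
  unfolding path_def
  by (rule group_diagram_kernel[OF category_DD precomp_diagram[OF category_DD is_functor_F(3) K] precomp_diagram[OF category_DD is_functor_F(4) K] lastv_nat])

lemma lastf_nat: "nat_trans DD path K lastf"
proof -
  let ?I = "\<lparr>fobj = (\<lambda>c. c), fmap = (\<lambda>f. f)\<rparr> :: (nat \<times> nat, darr \<times> darr, nat \<times> nat, darr \<times> darr) func"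
  have I: "is_functor DD DD ?I" by (auto simp: is_functor_def)
  have "nat_trans DD (precomp K decF) (precomp K ?I) lastf"
    by (rule whisker[OF category_DD K is_functor_F(3) I]) (auto simp: dec_last[of "(m, f, n)" for m f n, simplified])
  moreover have "precomp K ?I = K" by (simp add: precomp_def)
  ultimately show ?thesis unfolding path_def by (simp add: nat_trans_kernel)
qed

end

text \<open>Surjectivity of the path fibration over a connected simplicial group. The last vertex c
  of \<open>y\<close> is joined to 1 by an edge; this edge, spread along \<open>step\<close>, moves
  the last vertex of a degenerate copy of \<open>y\<close> to 1 and leaves its last face
  alone.\<close>

lemma (in sdiagram) connected_path:
  assumes A: "aspherical L 0" and y: "y \<in> carrier (gobj L p)"
  shows "\<exists>x \<in> carrier (gobj L (Suc p)). gmap L (coface (Suc p) (Suc p)) x = y \<and> gmap L (vtx (Suc p)) x = \<one>\<^bsub>gobj L 0\<^esub>"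
proof -
  have ap: "gmap L \<alpha> x \<in> carrier (gobj L m)" if "\<alpha> \<in> Arr Delta" "Dom Delta \<alpha> = m" "Cod Delta \<alpha> = n" "x \<in> carrier (gobj L n)" for \<alpha> m n x
    using closed[of \<alpha> x] that by simp
  have am: "gmap L \<alpha> (x \<otimes>\<^bsub>gobj L n\<^esub> inv\<^bsub>gobj L n\<^esub> x') = gmap L \<alpha> x \<otimes>\<^bsub>gobj L m\<^esub> inv\<^bsub>gobj L m\<^esub> gmap L \<alpha> x'"
    if "\<alpha> \<in> Arr Delta" "Dom Delta \<alpha> = m" "Cod Delta \<alpha> = n" "x \<in> carrier (gobj L n)" "x' \<in> carrier (gobj L n)" for \<alpha> m n x x'
    using map_mult[of \<alpha> x "inv\<^bsub>gobj L n\<^esub> x'"] map_inv[of \<alpha> x'] that grp[of n] by simp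
  have ac: "gmap L \<alpha> (gmap L \<beta> x) = gmap L (Comp Delta \<beta> \<alpha>) x"
    if "\<alpha> \<in> Arr Delta" "\<beta> \<in> Arr Delta" "Cod Delta \<alpha> = Dom Delta \<beta>" "x \<in> carrier (gobj L (Cod Delta \<beta>))" for \<alpha> \<beta> x
    using map_Comp[of \<beta> \<alpha> x] that by simp
  interpret G: group "gobj L n" for n using grp[of n] by simp
  let ?c = "gmap L (vtx p) y"
  have c: "?c \<in> carrier (gobj L 0)" by (rule ap[of _ _ p]) (use y in auto)
  then have "?c \<in> boundaries (sg L) 0" using A by (auto simp: aspherical_def spheres_0)
  then obtain z where z: "z \<in> carrier (gobj L (Suc 0))" "gmap L (coface (Suc 0) 0) z = \<one>\<^bsub>gobj L 0\<^esub>"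
    "gmap L (coface (Suc 0) (Suc 0)) z = ?c" by (elim boundariesE) auto
  let ?s = "gmap L (codegen 0 0) ?c"
  have s: "?s \<in> carrier (gobj L (Suc 0))" by (rule ap[of _ _ 0]) (use c in auto)
  have sf: "gmap L (coface (Suc 0) i) ?s = ?c" if "i \<le> 1" for i
    using face_degen_id[of i 0 0 ?c] c that by (auto simp: le_Suc_eq)
  \<comment> \<open>\<open>coface 1 0\<close> is the end of an edge and \<open>coface 1 1\<close>
    its start. So \<open>z\<close> runs from c to 1, and division by the constant edge at c gives an
    edge from 1 to the inverse of c.\<close>
  let ?z = "z \<otimes>\<^bsub>gobj L (Suc 0)\<^esub> inv\<^bsub>gobj L (Suc 0)\<^esub> ?s"
  have z': "?z \<in> carrier (gobj L (Suc 0))" using z s by simp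
  have zf: "gmap L (coface (Suc 0) 0) ?z = inv\<^bsub>gobj L 0\<^esub> ?c" "gmap L (coface (Suc 0) (Suc 0)) ?z = \<one>\<^bsub>gobj L 0\<^esub>"
    using z s c sf[of 0] sf[of 1] am[of "coface (Suc 0) 0" 0 "Suc 0" z ?s] am[of "coface (Suc 0) (Suc 0)" 0 "Suc 0" z ?s] by simp_all
  let ?w = "gmap L (step p) ?z"
  have w: "?w \<in> carrier (gobj L (Suc p))" by (rule ap[of _ _ "Suc 0"]) (use z' in auto)
  have wf: "gmap L (coface (Suc p) (Suc p)) ?w = \<one>\<^bsub>gobj L p\<^esub>" "gmap L (vtx (Suc p)) ?w = inv\<^bsub>gobj L 0\<^esub> ?c"
  proof -
    have "gmap L (coface (Suc p) (Suc p)) ?w = gmap L (bang p) (gmap L (coface (Suc 0) (Suc 0)) ?z)"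
      using z' by (simp add: ac special_comp)
    then show "gmap L (coface (Suc p) (Suc p)) ?w = \<one>\<^bsub>gobj L p\<^esub>" using zf map_one[of "bang p"] by simp
    show "gmap L (vtx (Suc p)) ?w = inv\<^bsub>gobj L 0\<^esub> ?c" using z' zf by (simp add: ac special_comp)
  qed
  let ?y = "gmap L (codegen p p) y"
  have y': "?y \<in> carrier (gobj L (Suc p))" by (rule ap[of _ _ p]) (use y in auto)
  have yf: "gmap L (coface (Suc p) (Suc p)) ?y = y" using face_degen_id[of "Suc p" p p y] y by simp
  have yv: "gmap L (vtx (Suc p)) ?y = ?c" using y by (simp add: ac special_comp)
  have m: "gmap L \<alpha> (?y \<otimes>\<^bsub>gobj L (Suc p)\<^esub> ?w) = gmap L \<alpha> ?y \<otimes>\<^bsub>gobj L (Dom Delta \<alpha>)\<^esub> gmap L \<alpha> ?w"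
    if "\<alpha> \<in> Arr Delta" "Cod Delta \<alpha> = Suc p" for \<alpha> using map_mult[of \<alpha> ?y ?w] that y' w by simp
  show ?thesis
    using y' w y c m[of "coface (Suc p) (Suc p)"] m[of "vtx (Suc p)"]
    by (intro bexI[of _ "?y \<otimes>\<^bsub>gobj L (Suc p)\<^esub> ?w"]) (simp_all add: wf yf yv)
qed

text \<open>\<open>h\<close> is a cone with its new vertex at the end. For a sphere
  \<open>x\<close>, the face identities give \<open>h n x\<close> the last face \<open>x\<close> and
  trivial faces otherwise, so \<open>x\<close> is a boundary.\<close>

lemma aspherical_extra:
  assumes L: "group_diagram SD L"
    and closed: "\<And>n x. x \<in> carrier (gobj L n) \<Longrightarrow> h n x \<in> carrier (gobj L (Suc n))"
    and one: "\<And>n. h n \<one>\<^bsub>gobj L n\<^esub> = \<one>\<^bsub>gobj L (Suc n)\<^esub>"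
    and last: "\<And>n x. x \<in> carrier (gobj L n) \<Longrightarrow> gmap L (coface (Suc n) (Suc n)) (h n x) = x"
    and face: "\<And>n i x. i \<le> Suc n \<Longrightarrow> x \<in> carrier (gobj L (Suc n)) \<Longrightarrow>
      gmap L (coface (Suc (Suc n)) i) (h (Suc n) x) = h n (gmap L (coface (Suc n) i) x)"
    and base: "\<And>x. x \<in> carrier (gobj L 0) \<Longrightarrow> gmap L (coface (Suc 0) 0) (h 0 x) = \<one>\<^bsub>gobj L 0\<^esub>"
  shows "aspherical L n"
  unfolding aspherical_def
proof
  fix x assume x: "x \<in> spheres (sg L) n"
  then have c: "x \<in> carrier (gobj L n)" by (simp add: spheres_def)
  show "x \<in> boundaries (sg L) n"
    using closed[OF c] _ last[OF c]
  proof (rule boundariesI)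
    show "gmap L (coface (Suc n) i) (h n x) = \<one>\<^bsub>gobj L n\<^esub>" if "i \<le> n" for i
      using that c x base face one by (cases n) (auto simp: spheres_Suc)
  qed
qed

context bisimplicial begin

lemma path_sel [simp]: "x \<in> carrier (gobj path (p, q)) \<longleftrightarrow>
    x \<in> carrier (gobj K (Suc p, Suc q)) \<and> gmap K (vtx (Suc p), Id Delta (Suc q)) x = \<one>\<^bsub>gobj K (0, Suc q)\<^esub>"
  "\<one>\<^bsub>gobj path (p, q)\<^esub> = \<one>\<^bsub>gobj K (Suc p, Suc q)\<^esub>" "gmap path (\<alpha>, \<beta>) = gmap K (dec \<alpha>, dec \<beta>)"
  by (simp_all add: path_def)

text \<open>An operator through the last horizontal vertex factors through \<open>lastv\<close>,
  whose kernel is \<open>path\<close>.\<close>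

lemma vtx_decomp:
  assumes x: "x \<in> carrier (gobj K (Suc p, Suc q))" "gmap K (vtx (Suc p), Id Delta (Suc q)) x = \<one>\<^bsub>gobj K (0, Suc q)\<^esub>"
    and a: "\<alpha> \<in> Arr Delta" "\<beta> \<in> Arr Delta" "Cod Delta \<alpha> = 0" "Cod Delta \<beta> = Suc q"
  shows "gmap K (Comp Delta (vtx (Suc p)) \<alpha>, \<beta>) x = \<one>\<^bsub>gobj K (Dom Delta \<alpha>, Dom Delta \<beta>)\<^esub>"
proof -
  have "gmap K (Comp Delta (vtx (Suc p)) \<alpha>, \<beta>) x = gmap K (\<alpha>, \<beta>) (gmap K (vtx (Suc p), Id Delta (Suc q)) x)"
    using comp2[of \<alpha> \<beta> "vtx (Suc p)" "Id Delta (Suc q)" x] x(1) a by simp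
  then show ?thesis using x(2) one2[OF a] by simp
qed

text \<open>Both directions are degenerated together. In degree 0 the remaining face factors through
  the last vertex in both directions, so it is enough that the horizontal one is killed.\<close>

lemma path_diag_aspherical: "aspherical (precomp path diagF) n"
proof (rule aspherical_extra[where h = "\<lambda>n. gmap K (codegen (Suc n) (Suc n), codegen (Suc n) (Suc n))"])
  show "group_diagram SD (precomp path diagF)"
    by (rule precomp_diagram[OF category_SD is_functor_F(1) path_diagram])
next
  fix n x assume "x \<in> carrier (gobj (precomp path diagF) n)"
  then have x: "x \<in> carrier (gobj K (Suc n, Suc n))" "gmap K (vtx (Suc n), Id Delta (Suc n)) x = \<one>\<^bsub>gobj K (0, Suc n)\<^esub>"
    by simp_all
  show "gmap K (codegen (Suc n) (Suc n), codegen (Suc n) (Suc n)) x \<in> carrier (gobj (precomp path diagF) (Suc n))"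
    using vtx_decomp[OF x, of "Id Delta 0" "codegen (Suc n) (Suc n)"] x(1) by (simp add: comp2 special_comp closed2)
  show "gmap (precomp path diagF) (coface (Suc n) (Suc n)) (gmap K (codegen (Suc n) (Suc n), codegen (Suc n) (Suc n)) x) = x"
    using x(1) by (simp add: comp2 special_comp id2)
next
  fix n i x assume "i \<le> Suc n" "x \<in> carrier (gobj (precomp path diagF) (Suc n))"
  then show "gmap (precomp path diagF) (coface (Suc (Suc n)) i) (gmap K (codegen (Suc (Suc n)) (Suc (Suc n)), codegen (Suc (Suc n)) (Suc (Suc n))) x) =
    gmap K (codegen (Suc n) (Suc n), codegen (Suc n) (Suc n)) (gmap (precomp path diagF) (coface (Suc n) i) x)"
    by (simp add: comp2 special_comp)
next
  fix x assume "x \<in> carrier (gobj (precomp path diagF) 0)"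
  then have x: "x \<in> carrier (gobj K (Suc 0, Suc 0))" "gmap K (vtx (Suc 0), Id Delta (Suc 0)) x = \<one>\<^bsub>gobj K (0, Suc 0)\<^esub>"
    by simp_all
  show "gmap (precomp path diagF) (coface (Suc 0) 0) (gmap K (codegen (Suc 0) (Suc 0), codegen (Suc 0) (Suc 0)) x) = \<one>\<^bsub>gobj (precomp path diagF) 0\<^esub>"
    using vtx_decomp[OF x, of "codegen 0 0" "Comp Delta (vtx (Suc 0)) (codegen 0 0)"] x(1) by (simp add: comp2 special_comp)
qed (simp add: one2)

text \<open>With the second index fixed this is the usual contraction of a decalage relative to its
  last vertex.\<close>

lemma path_row_aspherical: "aspherical (precomp path (rowF q)) n"
proof (rule aspherical_extra[where h = "\<lambda>n. gmap K (codegen (Suc n) (Suc n), Id Delta (Suc q))"])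
  show "group_diagram SD (precomp path (rowF q))"
    by (rule precomp_diagram[OF category_SD is_functor_F(2) path_diagram])
next
  fix n x assume "x \<in> carrier (gobj (precomp path (rowF q)) n)"
  then have x: "x \<in> carrier (gobj K (Suc n, Suc q))" "gmap K (vtx (Suc n), Id Delta (Suc q)) x = \<one>\<^bsub>gobj K (0, Suc q)\<^esub>"
    by simp_all
  show "gmap K (codegen (Suc n) (Suc n), Id Delta (Suc q)) x \<in> carrier (gobj (precomp path (rowF q)) (Suc n))"
    using x by (simp add: comp2 special_comp closed2)
  show "gmap (precomp path (rowF q)) (coface (Suc n) (Suc n)) (gmap K (codegen (Suc n) (Suc n), Id Delta (Suc q)) x) = x"
    using x(1) by (simp add: comp2 special_comp id2 dec_Id)
next
  fix n i x assume "i \<le> Suc n" "x \<in> carrier (gobj (precomp path (rowF q)) (Suc n))"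
  then show "gmap (precomp path (rowF q)) (coface (Suc (Suc n)) i) (gmap K (codegen (Suc (Suc n)) (Suc (Suc n)), Id Delta (Suc q)) x) =
    gmap K (codegen (Suc n) (Suc n), Id Delta (Suc q)) (gmap (precomp path (rowF q)) (coface (Suc n) i) x)"
    by (simp add: comp2 special_comp dec_Id)
next
  fix x assume "x \<in> carrier (gobj (precomp path (rowF q)) 0)"
  then have x: "x \<in> carrier (gobj K (Suc 0, Suc q))" "gmap K (vtx (Suc 0), Id Delta (Suc q)) x = \<one>\<^bsub>gobj K (0, Suc q)\<^esub>"
    by simp_all
  show "gmap (precomp path (rowF q)) (coface (Suc 0) 0) (gmap K (codegen (Suc 0) (Suc 0), Id Delta (Suc q)) x) = \<one>\<^bsub>gobj (precomp path (rowF q)) 0\<^esub>"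
    using vtx_decomp[OF x, of "codegen 0 0" "Id Delta (Suc q)"] x(1) by (simp add: comp2 special_comp dec_Id)
qed (simp add: one2)

text \<open>\<open>connected_path\<close> gives a lift in the row through \<open>y\<close>. The
  vertical shift is supplied by a degeneracy, which the last vertical face cancels.\<close>

lemma lastf_surj:
  assumes A: "aspherical (precomp K (rowF q)) 0" and y: "y \<in> carrier (gobj K (p, q))"
  shows "\<exists>x \<in> carrier (gobj path (p, q)). lastf (p, q) x = y"
proof -
  interpret R: sdiagram "precomp K (rowF q)" by (rule sdiagram.intro[OF row_diagram])
  obtain x where x: "x \<in> carrier (gobj K (Suc p, q))" "gmap K (coface (Suc p) (Suc p), Id Delta q) x = y"
    "gmap K (vtx (Suc p), Id Delta q) x = \<one>\<^bsub>gobj K (0, q)\<^esub>"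
    using R.connected_path[OF A, of y p] y by auto
  let ?x = "gmap K (Id Delta (Suc p), codegen q q) x"
  have "gmap K (vtx (Suc p), Id Delta (Suc q)) ?x = gmap K (Id Delta 0, codegen q q) (gmap K (vtx (Suc p), Id Delta q) x)"
    using comp2[of "vtx (Suc p)" "Id Delta (Suc q)" "Id Delta (Suc p)" "codegen q q" x]
      comp2[of "Id Delta 0" "codegen q q" "vtx (Suc p)" "Id Delta q" x] x(1) by simp
  also have "\<dots> = \<one>\<^bsub>gobj K (0, Suc q)\<^esub>" using x by (simp add: one2)
  finally have "?x \<in> carrier (gobj path (p, q))" using x by (simp add: closed2)
  moreover have "lastf (p, q) ?x = y" using x by (simp add: comp2 cosimplicial(3))
  ultimately show ?thesis by blast
qed

definition loop :: "(nat \<times> nat, darr \<times> darr, 'g) diagram" where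
  "loop = kernel_diagram path K lastf"

lemma loop_diagram: "group_diagram DD loop"
  unfolding loop_def by (rule group_diagram_kernel[OF category_DD path_diagram K lastf_nat])

lemma surjection_F:
  assumes A: "\<And>q. aspherical (precomp K (rowF q)) 0" and F: "is_functor SD DD F"
  shows "surjection (precomp path F) (precomp K F) (\<lambda>n. lastf (fobj F n))"
proof -
  have "\<exists>x \<in> carrier (gobj path (fobj F n)). lastf (fobj F n) x = y" if "y \<in> carrier (gobj K (fobj F n))" for y n
    using lastf_surj[OF A, of y "fst (fobj F n)" "snd (fobj F n)"] that by simp
  then show ?thesis
    using precomp_diagram[OF category_SD F K] precomp_diagram[OF category_SD F path_diagram]
      precomp_nat_trans[OF F category_SD lastf_nat]
    by (simp add: surjection_def smap_def sdiagram_def smap_axioms_def surjection_axioms_def)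
qed

text \<open>Exactness along each row: the class of bisimplicial groups with aspherical rows is
  closed under \<open>loop\<close>, which lets the dimension shift be repeated.\<close>

lemma loop_row_aspherical:
  assumes A: "\<And>q n. aspherical (precomp K (rowF q)) n"
  shows "aspherical (precomp loop (rowF q)) n"
  unfolding loop_def precomp_kernel
  by (rule surjection.kernel_aspherical[OF surjection_F[OF A is_functor_F(2)] path_row_aspherical A])

lemma diag_aspherical_step:
  assumes A: "\<And>q n. aspherical (precomp K (rowF q)) n" and B: "\<And>m. n = Suc m \<Longrightarrow> aspherical (precomp loop diagF) m"
  shows "aspherical (precomp K diagF) n"
proof (rule surjection.aspherical_image[OF surjection_F[OF A is_functor_F(1)] path_diag_aspherical])
  show "aspherical (kernel_diagram (precomp path diagF) (precomp K diagF) (\<lambda>n. lastf (fobj diagF n))) m" if "n = Suc m" for m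
    using B[OF that] unfolding loop_def precomp_kernel .
qed

end

text \<open>The hypothesis on the rows concerns all degrees, since every shift to
  \<open>loop\<close> uses up one of them. In degree 0 no condition on the kernel is left: the
  diagonal of \<open>path\<close> is connected and maps onto that of \<open>K\<close>.\<close>

lemma diag_aspherical:
  "group_diagram DD K \<Longrightarrow> (\<And>q n. aspherical (precomp K (rowF q)) n) \<Longrightarrow> aspherical (precomp K diagF) n"
proof (induction n arbitrary: K)
  case 0
  then interpret bisimplicial K by (simp add: bisimplicial_def)
  show ?case by (rule diag_aspherical_step) (use 0 in auto)
next
  case (Suc n)
  then interpret bisimplicial K by (simp add: bisimplicial_def)
  show ?case
  proof (rule diag_aspherical_step)
    show "aspherical (precomp loop diagF) m" if "Suc n = Suc m" for m
      using Suc.IH[OF loop_diagram loop_row_aspherical] Suc.prems that by simp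
  qed (use Suc in auto)
qed

section \<open>From rowwise contractions to equivalences of the diagonal\<close>

definition sndF :: "(nat \<times> nat, darr \<times> darr, nat, darr) func" where
  "sndF = \<lparr>fobj = snd, fmap = snd\<rparr>"

lemma sndF_sel [simp]: "fobj sndF c = snd c" "fmap sndF f = snd f"
  by (simp_all add: sndF_def)

lemma is_functor_sndF: "is_functor DD SD sndF"
  by (auto simp: is_functor_def)

text \<open>Common tool of all comparisons: \<open>h\<close> contracts each row of \<open>X\<close>
  onto \<open>Y\<close>. On the kernel of \<open>t\<close> it is an extra degeneracy, so the kernel
  has aspherical rows and hence an aspherical diagonal. The maps \<open>h p q\<close> for different
  q are unrelated.\<close>

lemma levelwise_equivalence:
  assumes X: "group_diagram DD X" and Y: "group_diagram SD Y" and t: "nat_trans DD X (precomp Y sndF) t"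
    and surj: "\<And>q y. y \<in> carrier (gobj Y q) \<Longrightarrow> \<exists>x \<in> carrier (gobj X (0, q)). t (0, q) x = y"
    and closed: "\<And>p q x. x \<in> carrier (gobj X (p, q)) \<Longrightarrow> h p q x \<in> carrier (gobj X (Suc p, q))"
    and one: "\<And>p q. h p q \<one>\<^bsub>gobj X (p, q)\<^esub> = \<one>\<^bsub>gobj X (Suc p, q)\<^esub>"
    and last: "\<And>p q x. x \<in> carrier (gobj X (p, q)) \<Longrightarrow> gmap X (coface (Suc p) (Suc p), Id Delta q) (h p q x) = x"
    and face: "\<And>p q i x. i \<le> Suc p \<Longrightarrow> x \<in> carrier (gobj X (Suc p, q)) \<Longrightarrow>
      gmap X (coface (Suc (Suc p)) i, Id Delta q) (h (Suc p) q x) = h p q (gmap X (coface (Suc p) i, Id Delta q) x)"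
    and base: "\<And>q x. x \<in> carrier (gobj X (0, q)) \<Longrightarrow> t (0, q) x = \<one>\<^bsub>gobj Y q\<^esub> \<Longrightarrow>
      gmap X (coface (Suc 0) 0, Id Delta q) (h 0 q x) = \<one>\<^bsub>gobj X (0, q)\<^esub>"
  shows "homotopy_map (sg Y) n (t (n, n)) \<in> iso (homotopy_group (sg (precomp X diagF)) n) (homotopy_group (sg Y) n)"
proof -
  interpret X: bisimplicial X by (rule bisimplicial.intro[OF X])
  interpret Y: sdiagram Y by (rule sdiagram.intro[OF Y])
  have t_nat: "t (Dom Delta \<alpha>, Dom Delta \<beta>) (gmap X (\<alpha>, \<beta>) x) = gmap Y \<beta> (t (Cod Delta \<alpha>, Cod Delta \<beta>) x)"
    if "\<alpha> \<in> Arr Delta" "\<beta> \<in> Arr Delta" "x \<in> carrier (gobj X (Cod Delta \<alpha>, Cod Delta \<beta>))" for \<alpha> \<beta> x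
    using nat_transD(2)[OF t, of "(\<alpha>, \<beta>)" x] that by simp
  have t_in: "t (p, q) x \<in> carrier (gobj Y q)" if "x \<in> carrier (gobj X (p, q))" for p q x
    using hom_in_carrier[OF nat_transD(1)[OF t, of "(p, q)"], of x] that by simp
  have YY: "precomp (precomp Y sndF) diagF = Y" by (simp add: precomp_def)
  have n: "nat_trans SD (precomp X diagF) Y (\<lambda>n. t (n, n))"
    using precomp_nat_trans[OF is_functor_F(1) category_SD t] by (simp add: YY)
  interpret S: surjection "precomp X diagF" Y "\<lambda>n. t (n, n)"
  proof
    show "group_diagram SD (precomp X diagF)" by (rule X.diag_diagram)
    fix y n assume y: "y \<in> carrier (gobj Y n)"
    then obtain x where x: "x \<in> carrier (gobj X (0, n))" "t (0, n) x = y" using surj by blast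
    \<comment> \<open>A lift in bidegree (0, n) is moved into the diagonal by the horizontal
      degeneracy along [n] -> [0].\<close>
    have "t (n, n) (gmap X (bang n, Id Delta n) x) = y"
      using t_nat[of "bang n" "Id Delta n" x] x y Y.map_Id[of n y] by simp
    then show "\<exists>x \<in> carrier (gobj (precomp X diagF) n). t (n, n) x = y"
      using X.closed2[of "bang n" "Id Delta n" n n x] x by auto
  qed (rule n)
  let ?K = "kernel_diagram X (precomp Y sndF) t"
  have K: "group_diagram DD ?K"
    by (rule group_diagram_kernel[OF category_DD X precomp_diagram[OF category_DD is_functor_sndF Y] t])
  have "aspherical (precomp ?K (rowF q)) m" for q m
  proof (rule aspherical_extra[where h = "\<lambda>p. h p q"])
    show "group_diagram SD (precomp ?K (rowF q))" by (rule precomp_diagram[OF category_SD is_functor_F(2) K])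
  next
    fix p x assume x: "x \<in> carrier (gobj (precomp ?K (rowF q)) p)"
    \<comment> \<open>\<open>t\<close> does not see the horizontal direction, so its value on
      \<open>h p q x\<close> equals that on the last face, which is \<open>x\<close>. Hence
      \<open>h\<close> preserves the kernel.\<close>
    then have "t (p, q) (gmap X (coface (Suc p) (Suc p), Id Delta q) (h p q x)) = t (Suc p, q) (h p q x)"
      using t_nat[of "coface (Suc p) (Suc p)" "Id Delta q" "h p q x"] closed Y.map_Id t_in by simp
    then show "h p q x \<in> carrier (gobj (precomp ?K (rowF q)) (Suc p))" using x closed last by simp
  qed (use last face one base in simp_all)
  from diag_aspherical[OF K this] have "aspherical (kernel_diagram (precomp X diagF) Y (\<lambda>n. t (n, n))) m" for m
    by (simp add: precomp_kernel YY)
  from S.homotopy_map_iso[OF this]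
  show "homotopy_map (sg Y) n (t (n, n)) \<in> iso (homotopy_group (sg (precomp X diagF)) n) (homotopy_group (sg Y) n)" .
qed


section \<open>Diagrams of free products\<close>

abbreviation fgen :: "'i set \<Rightarrow> ('i \<Rightarrow> 'g monoid) \<Rightarrow> 'i \<Rightarrow> 'g \<Rightarrow> ('i \<times> 'g) list set" where
  "fgen I G \<equiv> word_presentation.gen I G {}"

text \<open>The chosen homomorphism is determined only on the carrier; identities between such maps
  are therefore proved on generators and transferred to carrier elements.\<close>

definition free_ext ::
  "'i set \<Rightarrow> ('i \<Rightarrow> 'g monoid) \<Rightarrow> 'h monoid \<Rightarrow> ('i \<Rightarrow> 'g \<Rightarrow> 'h) \<Rightarrow> ('i \<times> 'g) list set \<Rightarrow> 'h" where
  "free_ext I G H f = (SOME h. h \<in> hom (free_product I G) H \<and> (\<forall>i \<in> I. \<forall>x \<in> carrier (G i). h (fgen I G i x) = f i x))"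

lemma free_ext:
  assumes "\<And>i. i \<in> I \<Longrightarrow> group (G i)" "group H" "\<And>i. i \<in> I \<Longrightarrow> f i \<in> hom (G i) H"
  shows "free_ext I G H f \<in> hom (free_product I G) H"
    and "i \<in> I \<Longrightarrow> x \<in> carrier (G i) \<Longrightarrow> free_ext I G H f (fgen I G i x) = f i x"
proof -
  interpret word_presentation I G "{}" using assms(1) by (simp add: word_presentation_def)
  have "\<exists>h. h \<in> hom (free_product I G) H \<and> (\<forall>i \<in> I. \<forall>x \<in> carrier (G i). h (fgen I G i x) = f i x)"
    using hom_exists[of H f] assms(2,3) by blast
  from someI_ex[OF this, folded free_ext_def]
  show "free_ext I G H f \<in> hom (free_product I G) H"
    "i \<in> I \<Longrightarrow> x \<in> carrier (G i) \<Longrightarrow> free_ext I G H f (fgen I G i x) = f i x" by blast+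
qed

lemma fgen_hom: "(\<And>i. i \<in> I \<Longrightarrow> group (G i)) \<Longrightarrow> i \<in> I \<Longrightarrow> fgen I G i \<in> hom (G i) (free_product I G)"
  by (rule word_presentation.gen_hom) (simp add: word_presentation_def)

lemma free_hom_eq:
  assumes "\<And>i. i \<in> I \<Longrightarrow> group (G i)" "group H" "h \<in> hom (free_product I G) H" "k \<in> hom (free_product I G) H"
    "\<And>i x. i \<in> I \<Longrightarrow> x \<in> carrier (G i) \<Longrightarrow> h (fgen I G i x) = k (fgen I G i x)"
    "c \<in> carrier (free_product I G)"
  shows "h c = k c"
  using word_presentation.hom_unique[of I G H h "{}" k c] assms by (simp add: word_presentation_def)

text \<open>A homomorphism out of a free product is determined on the factors, so functoriality is
  demanded only of the indices (\<open>k\<close>) and of the factor elements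
  (\<open>h\<close>).\<close>

locale free_diagram = category M for M :: "('o, 'm) cat" +
  fixes I :: "'o \<Rightarrow> 'i set" and G :: "'i \<Rightarrow> 'g monoid" and k :: "'m \<Rightarrow> 'i \<Rightarrow> 'i" and h :: "'m \<Rightarrow> 'i \<Rightarrow> 'g \<Rightarrow> 'g"
  assumes I_grp: "c \<in> Obj M \<Longrightarrow> i \<in> I c \<Longrightarrow> group (G i)"
    and k: "f \<in> Arr M \<Longrightarrow> i \<in> I (Dom M f) \<Longrightarrow> k f i \<in> I (Cod M f)"
    and h: "f \<in> Arr M \<Longrightarrow> i \<in> I (Dom M f) \<Longrightarrow> h f i \<in> hom (G i) (G (k f i))"
    and k_Id: "c \<in> Obj M \<Longrightarrow> i \<in> I c \<Longrightarrow> k (Id M c) i = i"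
    and h_Id: "c \<in> Obj M \<Longrightarrow> i \<in> I c \<Longrightarrow> x \<in> carrier (G i) \<Longrightarrow> h (Id M c) i x = x"
    and k_Comp: "f \<in> Arr M \<Longrightarrow> g \<in> Arr M \<Longrightarrow> Cod M f = Dom M g \<Longrightarrow> i \<in> I (Dom M f) \<Longrightarrow> k (Comp M g f) i = k g (k f i)"
    and h_Comp: "f \<in> Arr M \<Longrightarrow> g \<in> Arr M \<Longrightarrow> Cod M f = Dom M g \<Longrightarrow> i \<in> I (Dom M f) \<Longrightarrow> x \<in> carrier (G i) \<Longrightarrow>
      h (Comp M g f) i x = h g (k f i) (h f i x)"
begin

definition FD :: "('o, 'm, ('i \<times> 'g) list set) diagram" where
  "FD = \<lparr>gobj = (\<lambda>c. free_product (I c) G),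
     gmap = (\<lambda>f. free_ext (I (Dom M f)) G (free_product (I (Cod M f)) G) (\<lambda>i x. fgen (I (Cod M f)) G (k f i) (h f i x)))\<rparr>"

lemma gobj_FD: "gobj FD c = free_product (I c) G"
  by (simp add: FD_def)

lemma FD_group: "c \<in> Obj M \<Longrightarrow> group (free_product (I c) G)"
  by (rule word_group_group) (rule I_grp)

lemma gen_hom: "c \<in> Obj M \<Longrightarrow> i \<in> I c \<Longrightarrow> fgen (I c) G i \<in> hom (G i) (free_product (I c) G)"
  by (rule fgen_hom) (rule I_grp)

lemma gmap_FD:
  assumes f: "f \<in> Arr M"
  shows "gmap FD f \<in> hom (free_product (I (Dom M f)) G) (free_product (I (Cod M f)) G)"
    and "i \<in> I (Dom M f) \<Longrightarrow> x \<in> carrier (G i) \<Longrightarrow> gmap FD f (fgen (I (Dom M f)) G i x) = fgen (I (Cod M f)) G (k f i) (h f i x)"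
proof -
  note o = Dom_in[OF f] Cod_in[OF f]
  have "(\<lambda>x. fgen (I (Cod M f)) G (k f i) (h f i x)) \<in> hom (G i) (free_product (I (Cod M f)) G)" if "i \<in> I (Dom M f)" for i
    using hom_compose[OF h[OF f that] gen_hom[OF o(2) k[OF f that]]] by (simp add: o_def)
  note * = free_ext[OF I_grp[OF o(1)] FD_group[OF o(2)] this]
  show "gmap FD f \<in> hom (free_product (I (Dom M f)) G) (free_product (I (Cod M f)) G)"
    "i \<in> I (Dom M f) \<Longrightarrow> x \<in> carrier (G i) \<Longrightarrow> gmap FD f (fgen (I (Dom M f)) G i x) = fgen (I (Cod M f)) G (k f i) (h f i x)"
    using * by (simp_all add: FD_def)
qed

lemma FD_hom_eq:
  assumes "c \<in> Obj M" "group H" "a \<in> hom (free_product (I c) G) H" "b \<in> hom (free_product (I c) G) H"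
    "\<And>i x. i \<in> I c \<Longrightarrow> x \<in> carrier (G i) \<Longrightarrow> a (fgen (I c) G i x) = b (fgen (I c) G i x)"
    "x \<in> carrier (free_product (I c) G)"
  shows "a x = b x"
  by (rule free_hom_eq[OF I_grp[OF assms(1)] assms(2-6)])

lemma FD_diagram: "group_diagram M FD"
  unfolding group_diagram_def gobj_FD
proof (intro conjI ballI impI)
  fix c x assume c: "c \<in> Obj M" and x: "x \<in> carrier (free_product (I c) G)"
  note g = gmap_FD[OF Id_in[OF c], unfolded Dom_Id[OF c] Cod_Id[OF c]]
  show "gmap FD (Id M c) x = x"
    by (rule FD_hom_eq[OF c FD_group[OF c] g(1) _ _ x]) (simp_all add: g(2) k_Id h_Id c hom_def)
next
  fix f g x assume fg: "f \<in> Arr M" "g \<in> Arr M" "Cod M f = Dom M g" and x: "x \<in> carrier (free_product (I (Dom M f)) G)"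
  note c = gmap_FD[OF Comp_in[OF fg], unfolded Dom_Comp[OF fg] Cod_Comp[OF fg]]
  have "gmap FD (Comp M g f) x = (gmap FD g \<circ> gmap FD f) x"
  proof (rule FD_hom_eq[OF Dom_in[OF fg(1)] FD_group[OF Cod_in[OF fg(2)]] c(1) hom_compose[OF gmap_FD(1)[OF fg(1), unfolded fg(3)] gmap_FD(1)[OF fg(2)]] _ x])
    fix i x assume i: "i \<in> I (Dom M f)" "x \<in> carrier (G i)"
    then show "gmap FD (Comp M g f) (fgen (I (Dom M f)) G i x) = (gmap FD g \<circ> gmap FD f) (fgen (I (Dom M f)) G i x)"
      using k[OF fg(1) i(1)] hom_in_carrier[OF h[OF fg(1) i(1)] i(2)] fg
      by (simp add: c(2) gmap_FD(2) k_Comp h_Comp)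
  qed
  then show "gmap FD (Comp M g f) x = gmap FD g (gmap FD f x)" by simp
qed (simp_all add: FD_group gmap_FD(1))

lemma FD_nat_trans:
  assumes Y: "group_diagram M Y" and \<phi>: "\<And>c i. c \<in> Obj M \<Longrightarrow> i \<in> I c \<Longrightarrow> \<phi> c i \<in> hom (G i) (gobj Y c)"
    and nat: "\<And>f i x. f \<in> Arr M \<Longrightarrow> i \<in> I (Dom M f) \<Longrightarrow> x \<in> carrier (G i) \<Longrightarrow>
      \<phi> (Cod M f) (k f i) (h f i x) = gmap Y f (\<phi> (Dom M f) i x)"
  shows "nat_trans M FD Y (\<lambda>c. free_ext (I c) G (gobj Y c) (\<phi> c))"
    and "c \<in> Obj M \<Longrightarrow> i \<in> I c \<Longrightarrow> x \<in> carrier (G i) \<Longrightarrow> free_ext (I c) G (gobj Y c) (\<phi> c) (fgen (I c) G i x) = \<phi> c i x"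
proof -
  interpret Y: diagram M Y by (rule diagramI[OF category_axioms Y])
  let ?t = "\<lambda>c. free_ext (I c) G (gobj Y c) (\<phi> c)"
  have t: "?t c \<in> hom (free_product (I c) G) (gobj Y c)"
    "i \<in> I c \<Longrightarrow> x \<in> carrier (G i) \<Longrightarrow> ?t c (fgen (I c) G i x) = \<phi> c i x" if "c \<in> Obj M" for c i x
    by (rule free_ext[OF I_grp[OF that] Y.grp[OF that] \<phi>[OF that]], assumption+)+
  show "c \<in> Obj M \<Longrightarrow> i \<in> I c \<Longrightarrow> x \<in> carrier (G i) \<Longrightarrow> ?t c (fgen (I c) G i x) = \<phi> c i x" by (rule t(2))
  show "nat_trans M FD Y ?t"
    unfolding nat_trans_def gobj_FD
  proof (intro conjI ballI)
    fix f x assume f: "f \<in> Arr M" and x: "x \<in> carrier (free_product (I (Dom M f)) G)"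
    note o = Dom_in[OF f] Cod_in[OF f]
    have "(?t (Cod M f) \<circ> gmap FD f) x = (gmap Y f \<circ> ?t (Dom M f)) x"
    proof (rule FD_hom_eq[OF o(1) Y.grp[OF o(2)] hom_compose[OF gmap_FD(1)[OF f] t(1)[OF o(2)]] hom_compose[OF t(1)[OF o(1)] Y.hom[OF f]] _ x])
      fix i x assume i: "i \<in> I (Dom M f)" "x \<in> carrier (G i)"
      show "(?t (Cod M f) \<circ> gmap FD f) (fgen (I (Dom M f)) G i x) = (gmap Y f \<circ> ?t (Dom M f)) (fgen (I (Dom M f)) G i x)"
        using i t(2)[OF o(1) i] t(2)[OF o(2) k[OF f i(1)] hom_in_carrier[OF h[OF f i(1)] i(2)]] nat[OF f i] by (simp add: gmap_FD(2)[OF f i])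
    qed
    then show "?t (Cod M f) (gmap FD f x) = gmap Y f (?t (Dom M f) x)" by simp
  qed (rule t(1))
qed

end


section \<open>Extending simplices of a nerve\<close>

text \<open>The appended arrow is \<open>u\<close>; the outer \<open>restrict\<close> makes both
  components extensional, as membership in the nerve demands.\<close>

definition snoc :: "('o, 'm) cat \<Rightarrow> nat \<Rightarrow> ('o, 'm) nsimplex \<Rightarrow> 'm \<Rightarrow> ('o, 'm) nsimplex" where
  "snoc K n \<sigma> u =
     \<lparr>fobj = restrict (\<lambda>i. if i \<le> n then fobj \<sigma> i else Cod K u) {..Suc n},
      fmap = restrict (\<lambda>(i, j). if j \<le> n then fmap \<sigma> (i, j) else if i \<le> n then Comp K u (fmap \<sigma> (i, n)) else Id K (Cod K u))
        (Arr (ord_cat (Suc n)))\<rparr>"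

definition point :: "('o, 'm) cat \<Rightarrow> 'o \<Rightarrow> ('o, 'm) nsimplex" where
  "point K c = \<lparr>fobj = restrict (\<lambda>_. c) {..0}, fmap = restrict (\<lambda>_. Id K c) (Arr (ord_cat 0))\<rparr>"

lemma snoc_sel: "fobj (snoc K n \<sigma> u) i = (if i \<le> n then fobj \<sigma> i else if i = Suc n then Cod K u else undefined)"
  "fmap (snoc K n \<sigma> u) (i, j) = (if i \<le> j \<and> j \<le> n then fmap \<sigma> (i, j) else if i \<le> n \<and> j = Suc n then Comp K u (fmap \<sigma> (i, n))
     else if i = Suc n \<and> j = Suc n then Id K (Cod K u) else undefined)"
  by (auto simp: snoc_def)

lemma point_sel: "fobj (point K c) i = (if i = 0 then c else undefined)"
  "fmap (point K c) (i, j) = (if i = 0 \<and> j = 0 then Id K c else undefined)"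
  by (auto simp: point_def)

text \<open>All faces but the last keep the final vertex. So compatibility of a contraction with
  \<open>dec\<close> covers the face identities other than those for the last face and for the
  lowest degree.\<close>

lemma coface_dec: "i \<le> Suc n \<Longrightarrow> coface (Suc (Suc n)) i = dec (coface (Suc n) i)"
  by (auto simp: coface_def dec_def fun_eq_iff)

context category begin

lemma nerve_sel:
  assumes "\<sigma> \<in> simplices (nerve K) n"
  shows "i \<le> n \<Longrightarrow> fobj \<sigma> i \<in> Obj K" "i \<le> n \<Longrightarrow> fmap \<sigma> (i, i) = Id K (fobj \<sigma> i)"
    "i \<le> j \<Longrightarrow> j \<le> n \<Longrightarrow> fmap \<sigma> (i, j) \<in> Arr K" "i \<le> j \<Longrightarrow> j \<le> n \<Longrightarrow> Dom K (fmap \<sigma> (i, j)) = fobj \<sigma> i"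
    "i \<le> j \<Longrightarrow> j \<le> n \<Longrightarrow> Cod K (fmap \<sigma> (i, j)) = fobj \<sigma> j"
    "i \<le> j \<Longrightarrow> j \<le> k \<Longrightarrow> k \<le> n \<Longrightarrow> Comp K (fmap \<sigma> (j, k)) (fmap \<sigma> (i, j)) = fmap \<sigma> (i, k)"
    "\<not> i \<le> n \<Longrightarrow> fobj \<sigma> i = undefined" "\<not> (i \<le> j \<and> j \<le> n) \<Longrightarrow> fmap \<sigma> (i, j) = undefined"
  using assms[unfolded nerve_iff] by auto

lemma point_nerve: "c \<in> Obj K \<Longrightarrow> point K c \<in> simplices (nerve K) 0"
  using Comp_Id[OF Id_in] by (auto simp: nerve_iff point_sel Id_in Dom_Id Cod_Id)

lemma snoc_nerve:
  assumes \<sigma>: "\<sigma> \<in> simplices (nerve K) n" and u: "u \<in> Arr K" "Dom K u = fobj \<sigma> n"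
  shows "snoc K n \<sigma> u \<in> simplices (nerve K) (Suc n)"
proof -
  note s = nerve_sel[OF \<sigma>]
  have c: "Comp K (Comp K u (fmap \<sigma> (j, n))) (fmap \<sigma> (i, j)) = Comp K u (fmap \<sigma> (i, n))" if "i \<le> j" "j \<le> n" for i j
    using that u s Comp_assoc[of "fmap \<sigma> (i, j)" "fmap \<sigma> (j, n)" u] by simp
  have d: "Comp K (Id K (Cod K u)) (Comp K u (fmap \<sigma> (i, n))) = Comp K u (fmap \<sigma> (i, n))" if "i \<le> n" for i
    using that u s Id_Comp[of "Comp K u (fmap \<sigma> (i, n))"] by (simp add: Comp_in Cod_Comp)
  show ?thesis
    unfolding nerve_iff
    using u s c d Comp_in Dom_Comp Cod_Comp Id_in Cod_in Dom_Id Cod_Id Id_Comp[OF Id_in, of "Cod K u"]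
    by (auto simp: snoc_sel le_Suc_eq)
qed

lemma snoc_last: "\<sigma> \<in> simplices (nerve K) n \<Longrightarrow> act (nerve K) (coface (Suc n) (Suc n)) (snoc K n \<sigma> u) = \<sigma>"
  by (intro nsimplex_eqI) (auto simp: coface_def snoc_sel nerve_sel(7,8))

lemma snoc_first: "u \<in> Arr K \<Longrightarrow> act (nerve K) (coface (Suc 0) 0) (snoc K 0 \<sigma> u) = point K (Cod K u)"
  by (intro nsimplex_eqI) (auto simp: coface_def snoc_sel point_sel)

text \<open>Restriction may drop the last vertices of \<sigma>; the appended arrow then absorbs the
  dropped tail \<open>fmap \<sigma> (f m, n)\<close>. The same correction occurs in
  \<open>kI\<close>.\<close>

lemma snoc_dec:
  assumes \<sigma>: "\<sigma> \<in> simplices (nerve K) n" and u: "u \<in> Arr K" "Dom K u = fobj \<sigma> n" and \<alpha>: "(m, f, n) \<in> Arr Delta"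
  shows "act (nerve K) (dec (m, f, n)) (snoc K n \<sigma> u) = snoc K m (act (nerve K) (m, f, n) \<sigma>) (Comp K u (fmap \<sigma> (f m, n)))"
proof -
  note s = nerve_sel[OF \<sigma>]
  have f: "f i \<le> n" if "i \<le> m" for i using \<alpha> that by (auto simp: Delta_sel(2))
  have f': "f i \<le> f j" if "i \<le> j" "j \<le> m" for i j using \<alpha> that by (auto simp: Delta_sel(2) mono_on_def)
  have c: "Comp K (Comp K u (fmap \<sigma> (f m, n))) (fmap \<sigma> (f i, f m)) = Comp K u (fmap \<sigma> (f i, n))" if "i \<le> m" for i
    using that u s f[of m] f'[of i m] Comp_assoc[of "fmap \<sigma> (f i, f m)" "fmap \<sigma> (f m, n)" u] by simp
  show ?thesis
    using f f' c u s(4,5)[of "f m" n] s(3)[of "f m" n]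
    by (intro nsimplex_eqI) (auto simp: snoc_sel dec_def le_Suc_eq Cod_Comp)
qed

end

section \<open>The simplicial replacement as a diagram\<close>

context replacement_setup begin

sublocale diagram K D
  by unfold_locales (rule D)

definition repl :: "(nat, darr, (('o, 'm) nsimplex \<times> 'g) list set) diagram" where
  "repl = \<lparr>gobj = replacement_group K D, gmap = opr\<rparr>"

lemma repl_sel [simp]: "gobj repl n = replacement_group K D n" "gmap repl = opr"
  by (simp_all add: repl_def)

lemma repl_diagram: "group_diagram SD repl"
  unfolding group_diagram_def using P.word_group_group opr(1) opr_Id opr_Comp by simp

lemma repl_spheres: "spheres (replacement K D) n = spheres (sg repl) n"
proof (cases n)
  case (Suc m)
  then show ?thesis using face_opr[of _ m] by (auto simp: spheres_def sgrp_eq)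
qed (simp add: spheres_def sgrp_eq)

lemma repl_homotopic: "homotopic (replacement K D) n = homotopic (sg repl) n"
  using face_opr[of _ n] by (auto simp: homotopic_def repl_spheres sgrp_eq)

text \<open>An equality and not just an isomorphism: the faces of \<open>replacement\<close> and of
  \<open>repl\<close> agree on carriers, and spheres and homotopies involve nothing else.\<close>

lemma colim_n_repl: "colim_n K D n = homotopy_group (sg repl) n"
  by (simp add: colim_n_def homotopy_group_def repl_spheres repl_homotopic sgrp_eq)

end


section \<open>Two-sided bar constructions\<close>

definition fstF :: "(nat \<times> nat, darr \<times> darr, nat, darr) func" where
  "fstF = \<lparr>fobj = fst, fmap = fst\<rparr>"

definition swapF :: "(nat \<times> nat, darr \<times> darr, nat \<times> nat, darr \<times> darr) func" where
  "swapF = \<lparr>fobj = prod.swap, fmap = prod.swap\<rparr>"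

lemma swapF_sel [simp]: "fobj fstF c = fst c" "fmap fstF f = fst f" "fobj swapF c = prod.swap c" "fmap swapF f = prod.swap f"
  by (simp_all add: fstF_def swapF_def)

lemma is_functor_swapF: "is_functor DD SD fstF" "is_functor DD DD swapF"
  by (auto simp: is_functor_def)

locale bar = replacement_setup K D
  for K :: "('o, 'm) cat" and D :: "('o, 'm, 'g) diagram" +
  fixes X :: "'x sset" and S :: "(nat \<times> 'x, (nat \<times> 'x) \<times> darr \<times> (nat \<times> 'x), 'o, 'm) func"
  assumes X: "simplicial_set X" and S: "is_functor (op_cat (simplex_cat X)) K S"
begin

abbreviation "E \<equiv> op_cat (simplex_cat X)"

text \<open>The arrow S(e) -> S(\<beta>^* e) of \<open>K\<close>, where \<beta> is read in the
  opposite of the category of simplices.\<close>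

definition sarr :: "darr \<Rightarrow> 'x \<Rightarrow> 'm" where
  "sarr \<beta> e = fmap S ((Dom Delta \<beta>, act X \<beta> e), \<beta>, (Cod Delta \<beta>, e))"

lemma X_act: "\<beta> \<in> Arr Delta \<Longrightarrow> e \<in> simplices X (Cod Delta \<beta>) \<Longrightarrow> act X \<beta> e \<in> simplices X (Dom Delta \<beta>)"
  "e \<in> simplices X n \<Longrightarrow> act X (Id Delta n) e = e"
  "\<alpha> \<in> Arr Delta \<Longrightarrow> \<beta> \<in> Arr Delta \<Longrightarrow> Cod Delta \<alpha> = Dom Delta \<beta> \<Longrightarrow> e \<in> simplices X (Cod Delta \<beta>) \<Longrightarrow>
    act X (Comp Delta \<beta> \<alpha>) e = act X \<alpha> (act X \<beta> e)"
  using X unfolding simplicial_set_def by blast+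

lemma N_act: "\<beta> \<in> Arr Delta \<Longrightarrow> \<sigma> \<in> N (Cod Delta \<beta>) \<Longrightarrow> act (nerve K) \<beta> \<sigma> \<in> N (Dom Delta \<beta>)"
  "\<sigma> \<in> N n \<Longrightarrow> act (nerve K) (Id Delta n) \<sigma> = \<sigma>"
  "\<alpha> \<in> Arr Delta \<Longrightarrow> \<beta> \<in> Arr Delta \<Longrightarrow> Cod Delta \<alpha> = Dom Delta \<beta> \<Longrightarrow> \<sigma> \<in> N (Cod Delta \<beta>) \<Longrightarrow>
    act (nerve K) (Comp Delta \<beta> \<alpha>) \<sigma> = act (nerve K) \<alpha> (act (nerve K) \<beta> \<sigma>)"
  using nerve_simplicial_set[of K] unfolding simplicial_set_def by blast+

lemma E_arr: "\<beta> \<in> Arr Delta \<Longrightarrow> e \<in> simplices X (Cod Delta \<beta>) \<Longrightarrow>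
    ((Dom Delta \<beta>, act X \<beta> e), \<beta>, (Cod Delta \<beta>, e)) \<in> Arr E"
  using X_act(1) by (cases \<beta>) (auto simp: simplex_cat_def)

lemma E_sel: "Dom E (y, \<beta>, x) = x" "Cod E (y, \<beta>, x) = y" "Id E (n, e) = ((n, e), Id Delta n, (n, e))"
  "Comp E (x, \<alpha>, y') (y, \<beta>, z) = (x, Comp Delta \<beta> \<alpha>, z)" "(n, e) \<in> Obj E \<longleftrightarrow> e \<in> simplices X n"
  by (simp_all add: simplex_cat_def)

lemma S_obj: "e \<in> simplices X n \<Longrightarrow> fobj S (n, e) \<in> Obj K"
  using S unfolding is_functor_def by (metis E_sel(5))

lemma sarr:
  assumes "\<beta> \<in> Arr Delta" "e \<in> simplices X (Cod Delta \<beta>)"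
  shows "sarr \<beta> e \<in> Arr K" "Dom K (sarr \<beta> e) = fobj S (Cod Delta \<beta>, e)" "Cod K (sarr \<beta> e) = fobj S (Dom Delta \<beta>, act X \<beta> e)"
  using S E_arr[OF assms] unfolding is_functor_def sarr_def by (metis E_sel(1,2))+

lemma sarr_Id: "e \<in> simplices X n \<Longrightarrow> sarr (Id Delta n) e = Id K (fobj S (n, e))"
  using S unfolding is_functor_def sarr_def by (metis E_sel(3,5) Id_arr(1,2) X_act(2))

lemma sarr_Comp:
  assumes "\<alpha> \<in> Arr Delta" "\<beta> \<in> Arr Delta" "Cod Delta \<alpha> = Dom Delta \<beta>" "e \<in> simplices X (Cod Delta \<beta>)"
  shows "sarr (Comp Delta \<beta> \<alpha>) e = Comp K (sarr \<alpha> (act X \<beta> e)) (sarr \<beta> e)"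
proof -
  let ?g = "((Dom Delta \<alpha>, act X \<alpha> (act X \<beta> e)), \<alpha>, (Cod Delta \<alpha>, act X \<beta> e))"
  let ?f = "((Dom Delta \<beta>, act X \<beta> e), \<beta>, (Cod Delta \<beta>, e))"
  have "?g \<in> Arr E" "?f \<in> Arr E" "Cod E ?f = Dom E ?g"
    using assms E_arr[of \<alpha> "act X \<beta> e"] E_arr[of \<beta> e] X_act(1)[of \<beta> e] by (simp_all add: E_sel del: op_cat_sel)
  then have "fmap S (Comp E ?g ?f) = Comp K (fmap S ?g) (fmap S ?f)" using S unfolding is_functor_def by blast
  then show ?thesis using assms by (simp add: E_sel sarr_def X_act(3) del: op_cat_sel)
qed

text \<open>A simplex of bidegree \<open>(p, q)\<close> consists of a chain \<open>\<kappa>\<close> of length \<open>p\<close> in \<open>K\<close>, a \<open>q\<close>-simplex \<open>e\<close> of \<open>X\<close> and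
  an arrow \<open>u\<close> from the last object of \<open>\<kappa>\<close> to \<open>S e\<close>.\<close>

definition W :: "nat \<Rightarrow> 'o \<Rightarrow> ('x \<times> 'm) set" where
  "W q c = {(e, u). e \<in> simplices X q \<and> u \<in> Arr K \<and> Dom K u = c \<and> Cod K u = fobj S (q, e)}"

definition wd :: "darr \<Rightarrow> 'x \<times> 'm \<Rightarrow> 'x \<times> 'm" where
  "wd \<beta> = (\<lambda>(e, u). (act X \<beta> e, Comp K (sarr \<beta> e) u))"

definition I :: "nat \<times> nat \<Rightarrow> (('o, 'm) nsimplex \<times> 'x \<times> 'm) set" where
  "I = (\<lambda>(p, q). SIGMA \<kappa>:N p. W q (fobj \<kappa> p))"

definition GI :: "('o, 'm) nsimplex \<times> 'x \<times> 'm \<Rightarrow> 'g monoid" where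
  "GI = (\<lambda>i. gobj D (fobj (fst i) 0))"

text \<open>For \<alpha> = (m, f, n) the last object of the restricted chain is the one at f m, so
  \<open>u\<close> is precomposed with the tail from f m to n before \<beta> acts.\<close>

definition kI :: "darr \<times> darr \<Rightarrow> ('o, 'm) nsimplex \<times> 'x \<times> 'm \<Rightarrow> ('o, 'm) nsimplex \<times> 'x \<times> 'm" where
  "kI = (\<lambda>(\<alpha>, \<beta>) (\<kappa>, e, u). (act (nerve K) \<alpha> \<kappa>, wd \<beta> (e, Comp K u (fmap \<kappa> (fst (snd \<alpha>) (fst \<alpha>), snd (snd \<alpha>))))))"

text \<open>The group sits at the start of the chain, so \<beta> acts on indices alone and \<alpha>
  acts through the arrow to the new first vertex.\<close>

definition hI :: "darr \<times> darr \<Rightarrow> ('o, 'm) nsimplex \<times> 'x \<times> 'm \<Rightarrow> 'g \<Rightarrow> 'g" where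
  "hI = (\<lambda>(\<alpha>, \<beta>) (\<kappa>, w). gmap D (fmap \<kappa> (0, fst (snd \<alpha>) 0)))"

lemma I_iff: "(\<kappa>, e, u) \<in> I (p, q) \<longleftrightarrow> \<kappa> \<in> N p \<and> e \<in> simplices X q \<and> u \<in> Arr K \<and> Dom K u = fobj \<kappa> p \<and> Cod K u = fobj S (q, e)"
  by (simp add: I_def W_def)

lemma I_group: "i \<in> I c \<Longrightarrow> group (GI i)"
  by (cases c) (auto simp: I_def GI_def intro: groups)

lemma kI_hI:
  assumes \<alpha>: "\<alpha> \<in> Arr Delta" and \<beta>: "\<beta> \<in> Arr Delta" and i: "i \<in> I (Cod Delta \<alpha>, Cod Delta \<beta>)"
  shows "kI (\<alpha>, \<beta>) i \<in> I (Dom Delta \<alpha>, Dom Delta \<beta>)" "hI (\<alpha>, \<beta>) i \<in> hom (GI i) (GI (kI (\<alpha>, \<beta>) i))"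
proof -
  obtain \<kappa> e u where e: "i = (\<kappa>, e, u)" by (metis prod_cases3)
  obtain m f n where a: "\<alpha> = (m, f, n)" and f: "\<And>i. i \<le> m \<Longrightarrow> f i \<le> n" using \<alpha> by (elim arr_cases) blast
  have i': "\<kappa> \<in> N n" "e \<in> simplices X (Cod Delta \<beta>)" "u \<in> Arr K" "Dom K u = fobj \<kappa> n" "Cod K u = fobj S (Cod Delta \<beta>, e)"
    using i by (auto simp: e a I_iff)
  note s = nerve_sel[OF i'(1)] and S = sarr[OF \<beta> i'(2)]
  show "kI (\<alpha>, \<beta>) i \<in> I (Dom Delta \<alpha>, Dom Delta \<beta>)"
    using N_act(1)[OF \<alpha>, of \<kappa>] X_act(1)[OF \<beta>, of e] i' S s(3-5)[of "f m" n] f[of m]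
    by (simp add: e a kI_def wd_def I_iff Comp_in Dom_Comp Cod_Comp)
  show "hI (\<alpha>, \<beta>) i \<in> hom (GI i) (GI (kI (\<alpha>, \<beta>) i))"
    using hom[OF s(3)[of 0 "f 0"]] s(4,5)[of 0 "f 0"] f[of 0] by (simp add: e a hI_def GI_def kI_def)
qed

lemma Id_parts: "fst (Id Delta p) = p" "snd (snd (Id Delta p)) = p" "i \<le> p \<Longrightarrow> fst (snd (Id Delta p)) i = i"
  by (simp_all add: Delta_sel(5))

lemma kI_hor: "\<alpha> \<in> Arr Delta \<Longrightarrow> (\<kappa>, e, u) \<in> I (Cod Delta \<alpha>, q) \<Longrightarrow>
    kI (\<alpha>, Id Delta q) (\<kappa>, e, u) = (act (nerve K) \<alpha> \<kappa>, e, Comp K u (fmap \<kappa> (fst (snd \<alpha>) (fst \<alpha>), snd (snd \<alpha>))))"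
proof (elim arr_cases)
  fix m f n assume *: "(\<kappa>, e, u) \<in> I (Cod Delta \<alpha>, q)" "\<alpha> = (m, f, n)" "\<And>i. i \<le> m \<Longrightarrow> f i \<le> n"
  then have i: "\<kappa> \<in> N n" "e \<in> simplices X q" "u \<in> Arr K" "Dom K u = fobj \<kappa> n" "Cod K u = fobj S (q, e)"
    by (auto simp: I_iff)
  note s = nerve_sel(3-5)[OF i(1), of "f m" n]
  have "Comp K (Id K (Cod K u)) (Comp K u (fmap \<kappa> (f m, n))) = Comp K u (fmap \<kappa> (f m, n))"
    using Id_Comp[of "Comp K u (fmap \<kappa> (f m, n))"] i s *(3)[of m] by (simp add: Comp_in Cod_Comp)
  then show ?thesis using i by (simp add: kI_def wd_def *(2) X_act(2) sarr_Id)
qed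

lemma kI_vert: "\<beta> \<in> Arr Delta \<Longrightarrow> (\<kappa>, w) \<in> I (p, Cod Delta \<beta>) \<Longrightarrow> kI (Id Delta p, \<beta>) (\<kappa>, w) = (\<kappa>, wd \<beta> w)"
  using Comp_Id[of "snd w"] by (cases w) (auto simp: kI_def wd_def I_iff N_act(2) Id_parts nid)

lemma hI_vert: "(\<kappa>, w) \<in> I (p, q) \<Longrightarrow> x \<in> carrier (GI (\<kappa>, w)) \<Longrightarrow> hI (Id Delta p, \<beta>) (\<kappa>, w) x = x"
  using nid[of \<kappa> p 0] nobj[of \<kappa> p 0] by (cases w) (simp add: hI_def GI_def I_iff Id_parts gmap_id)

lemma kI_Comp:
  assumes ar: "\<alpha> \<in> Arr Delta" "\<beta> \<in> Arr Delta" "\<alpha>' \<in> Arr Delta" "\<beta>' \<in> Arr Delta"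
    and c: "Cod Delta \<alpha>' = Dom Delta \<alpha>" "Cod Delta \<beta>' = Dom Delta \<beta>" and i: "i \<in> I (Cod Delta \<alpha>, Cod Delta \<beta>)"
  shows "kI (Comp Delta \<alpha> \<alpha>', Comp Delta \<beta> \<beta>') i = kI (\<alpha>', \<beta>') (kI (\<alpha>, \<beta>) i)"
    and "x \<in> carrier (GI i) \<Longrightarrow> hI (Comp Delta \<alpha> \<alpha>', Comp Delta \<beta> \<beta>') i x = hI (\<alpha>', \<beta>') (kI (\<alpha>, \<beta>) i) (hI (\<alpha>, \<beta>) i x)"
proof -
  obtain \<kappa> e u where e: "i = (\<kappa>, e, u)" by (metis prod_cases3)
  obtain m f n where a: "\<alpha> = (m, f, n)" and f: "\<And>i. i \<le> m \<Longrightarrow> f i \<le> n" "\<And>i j. i \<le> j \<Longrightarrow> j \<le> m \<Longrightarrow> f i \<le> f j"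
    using ar(1) by (elim arr_cases) blast
  obtain l f' where a': "\<alpha>' = (l, f', m)" and f': "\<And>i. i \<le> l \<Longrightarrow> f' i \<le> m"
    using ar(3) c(1) by (elim arr_cases) (auto simp: a)
  have i': "\<kappa> \<in> N n" "e \<in> simplices X (Cod Delta \<beta>)" "u \<in> Arr K" "Dom K u = fobj \<kappa> n" "Cod K u = fobj S (Cod Delta \<beta>, e)"
    using i by (auto simp: e a I_iff)
  note s = nerve_sel[OF i'(1)] and S = sarr[OF ar(2) i'(2)]
  have S': "sarr \<beta>' (act X \<beta> e) \<in> Arr K" "Dom K (sarr \<beta>' (act X \<beta> e)) = fobj S (Dom Delta \<beta>, act X \<beta> e)"
    using sarr[OF ar(4), of "act X \<beta> e"] X_act(1)[OF ar(2), of e] i' c by simp_all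
  \<comment> \<open>The tails cut off by the two restrictions; composed, they form the tail cut off
    by the composite restriction.\<close>
  let ?k1 = "fmap \<kappa> (f (f' l), f m)" and ?k2 = "fmap \<kappa> (f m, n)"
  have k: "?k1 \<in> Arr K" "?k2 \<in> Arr K" "Cod K ?k1 = Dom K ?k2" "Cod K ?k2 = Dom K u"
    using s(3-5)[of "f m" n] s(3-5)[of "f (f' l)" "f m"] f f' i' by auto
  have "Comp K (Comp K (sarr \<beta>' (act X \<beta> e)) (sarr \<beta> e)) (Comp K u (Comp K ?k2 ?k1)) =
    Comp K (sarr \<beta>' (act X \<beta> e)) (Comp K (Comp K (sarr \<beta> e) (Comp K u ?k2)) ?k1)"
    using k S S' i'
      Comp_assoc[of ?k1 "Comp K u ?k2" "sarr \<beta> e"] Comp_assoc[of ?k1 ?k2 u] Comp_assoc[of "Comp K u (Comp K ?k2 ?k1)" "sarr \<beta> e" "sarr \<beta>' (act X \<beta> e)"]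
    by (simp add: Comp_in Dom_Comp Cod_Comp)
  moreover have "Comp K ?k2 ?k1 = fmap \<kappa> (f (f' l), n)" using s(6)[of "f (f' l)" "f m" n] f f' by auto
  ultimately show "kI (Comp Delta \<alpha> \<alpha>', Comp Delta \<beta> \<beta>') i = kI (\<alpha>', \<beta>') (kI (\<alpha>, \<beta>) i)"
    using i' ar c N_act(3)[of \<alpha>' \<alpha> \<kappa>] f'[of l]
    by (simp add: kI_def e wd_def X_act(3) sarr_Comp) (simp add: a a' compose_def)
  assume x: "x \<in> carrier (GI i)"
  have "gmap D (Comp K (fmap \<kappa> (f 0, f (f' 0))) (fmap \<kappa> (0, f 0))) x = gmap D (fmap \<kappa> (f 0, f (f' 0))) (gmap D (fmap \<kappa> (0, f 0)) x)"
    using s(3-5)[of 0 "f 0"] s(3-5)[of "f 0" "f (f' 0)"] f f' x by (intro map_Comp) (auto simp: GI_def e)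
  then show "hI (Comp Delta \<alpha> \<alpha>', Comp Delta \<beta> \<beta>') i x = hI (\<alpha>', \<beta>') (kI (\<alpha>, \<beta>) i) (hI (\<alpha>, \<beta>) i x)"
    using s(6)[of 0 "f 0" "f (f' 0)"] f f' by (simp add: hI_def e kI_def wd_def a a' compose_def)
qed

sublocale Z: free_diagram DD I GI kI hI
proof (intro free_diagram.intro category_DD free_diagram_axioms.intro)
  show "group (GI i)" if "i \<in> I c" for c i by (rule I_group[OF that])
next
  fix f i assume "f \<in> Arr DD" "i \<in> I (Dom DD f)"
  then show "kI f i \<in> I (Cod DD f)" "hI f i \<in> hom (GI i) (GI (kI f i))"
    using kI_hI[of "fst f" "snd f" i] by (cases f; simp)+
next
  fix c i assume i: "i \<in> I c"
  obtain p q \<kappa> w where c: "c = (p, q)" "i = (\<kappa>, w)" by (metis surj_pair)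
  have w: "wd (Id Delta q) w = w" using i Id_Comp[of "snd w"] by (cases w) (auto simp: c I_iff wd_def X_act(2) sarr_Id)
  show "kI (Id DD c) i = i" using kI_vert[of "Id Delta q" \<kappa> w p] i by (simp add: c w)
  show "hI (Id DD c) i x = x" if "x \<in> carrier (GI i)" for x using hI_vert[of \<kappa> w p q x] i that by (simp add: c)
next
  fix f g i assume "f \<in> Arr DD" "g \<in> Arr DD" "Cod DD f = Dom DD g" "i \<in> I (Dom DD f)"
  then show "kI (Comp DD g f) i = kI g (kI f i)" 
    "x \<in> carrier (GI i) \<Longrightarrow> hI (Comp DD g f) i x = hI g (kI f i) (hI f i x)" for x
    using kI_Comp[of "fst f" "snd f" "fst g" "snd g" i] by (cases f; cases g; simp)+
qed

abbreviation "Z \<equiv> Z.FD"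

end

section \<open>Homomorphisms between the groups of the bar construction\<close>

context bar begin

abbreviation gn :: "nat \<times> nat \<Rightarrow> ('o, 'm) nsimplex \<times> 'x \<times> 'm \<Rightarrow> 'g \<Rightarrow> _" where
  "gn c \<equiv> fgen (I c) GI"

lemma GI_sel: "GI (\<kappa>, w) = G \<kappa>"
  by (simp add: GI_def)

lemma Z_obj: "gobj Z c = free_product (I c) GI"
  by (rule Z.gobj_FD)

lemma Z_group: "group (gobj Z c)"
  unfolding Z_obj by (rule Z.FD_group) simp

lemma Z_hom: "\<alpha> \<in> Arr Delta \<Longrightarrow> \<beta> \<in> Arr Delta \<Longrightarrow> Cod Delta \<alpha> = p \<Longrightarrow> Cod Delta \<beta> = q \<Longrightarrow> Dom Delta \<alpha> = p' \<Longrightarrow> Dom Delta \<beta> = q' \<Longrightarrow>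
    gmap Z (\<alpha>, \<beta>) \<in> hom (gobj Z (p, q)) (gobj Z (p', q'))"
  using Z.gmap_FD(1)[of "(\<alpha>, \<beta>)"] by (simp add: Z_obj)

lemma Z_gen: "\<alpha> \<in> Arr Delta \<Longrightarrow> \<beta> \<in> Arr Delta \<Longrightarrow> Cod Delta \<alpha> = p \<Longrightarrow> Cod Delta \<beta> = q \<Longrightarrow> i \<in> I (p, q) \<Longrightarrow> x \<in> carrier (GI i) \<Longrightarrow>
    gmap Z (\<alpha>, \<beta>) (gn (p, q) i x) = gn (Dom Delta \<alpha>, Dom Delta \<beta>) (kI (\<alpha>, \<beta>) i) (hI (\<alpha>, \<beta>) i x)"
  using Z.gmap_FD(2)[of "(\<alpha>, \<beta>)" i x] by simp

lemma Z_hom_eq: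
  assumes "group H" "a \<in> hom (gobj Z c) H" "b \<in> hom (gobj Z c) H"
    "\<And>i x. i \<in> I c \<Longrightarrow> x \<in> carrier (GI i) \<Longrightarrow> a (gn c i x) = b (gn c i x)" "x \<in> carrier (gobj Z c)"
  shows "a x = b x"
  by (rule Z.FD_hom_eq[of c, OF _ assms[unfolded Z_obj]]) simp

lemma gn_hom: "i \<in> I c \<Longrightarrow> gn c i \<in> hom (GI i) (gobj Z c)"
  unfolding Z_obj by (rule Z.gen_hom) simp

text \<open>Relabels the indices and keeps the factor elements. Both contractions have this form,
  because they leave the first object of the chain unchanged.\<close>

definition emap :: "nat \<times> nat \<Rightarrow> nat \<times> nat \<Rightarrow> _" where
  "emap c c' j = free_ext (I c) GI (gobj Z c') (\<lambda>i. gn c' (j i))"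

lemma emap:
  assumes "\<And>i. i \<in> I c \<Longrightarrow> j i \<in> I c' \<and> GI (j i) = GI i"
  shows "emap c c' j \<in> hom (gobj Z c) (gobj Z c')"
    and "i \<in> I c \<Longrightarrow> x \<in> carrier (GI i) \<Longrightarrow> emap c c' j (gn c i x) = gn c' (j i) x"
proof -
  have "gn c' (j i) \<in> hom (GI i) (gobj Z c')" if "i \<in> I c" for i
    using gn_hom[of "j i" c'] assms[OF that] by simp
  note * = free_ext[OF I_group[of _ c] Z_group[of c'] this]
  show "emap c c' j \<in> hom (gobj Z c) (gobj Z c')" "i \<in> I c \<Longrightarrow> x \<in> carrier (GI i) \<Longrightarrow> emap c c' j (gn c i x) = gn c' (j i) x"
    using * by (simp_all add: emap_def Z_obj)
qed

text \<open>Reduces each face identity of a contraction to a computation with indices.\<close>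

lemma gmap_emap:
  assumes j: "\<And>i. i \<in> I (p, q) \<Longrightarrow> j i \<in> I (p', q') \<and> GI (j i) = GI i"
    and \<alpha>\<beta>: "\<alpha> \<in> Arr Delta" "\<beta> \<in> Arr Delta" "Cod Delta \<alpha> = p'" "Cod Delta \<beta> = q'" "Dom Delta \<alpha> = m'" "Dom Delta \<beta> = n'"
    and H: "a \<in> hom (gobj Z (p, q)) (gobj Z (m', n'))"
    and eq: "\<And>i x. i \<in> I (p, q) \<Longrightarrow> x \<in> carrier (GI i) \<Longrightarrow> a (gn (p, q) i x) = gn (m', n') (kI (\<alpha>, \<beta>) (j i)) (hI (\<alpha>, \<beta>) (j i) x)"
    and x: "x \<in> carrier (gobj Z (p, q))"
  shows "gmap Z (\<alpha>, \<beta>) (emap (p, q) (p', q') j x) = a x"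
proof -
  note e = emap[of "(p, q)" j "(p', q')", OF j]
  have "(gmap Z (\<alpha>, \<beta>) \<circ> emap (p, q) (p', q') j) x = a x"
  proof (rule Z_hom_eq[OF Z_group hom_compose[OF e(1) Z_hom[OF \<alpha>\<beta>]] H _ x])
    fix i x assume i: "i \<in> I (p, q)" "x \<in> carrier (GI i)"
    then show "(gmap Z (\<alpha>, \<beta>) \<circ> emap (p, q) (p', q') j) (gn (p, q) i x) = a (gn (p, q) i x)"
      using e(2) eq j[OF i(1)] \<alpha>\<beta> by (simp add: Z_gen)
  qed simp
  then show ?thesis by simp
qed

section \<open>The projection to the simplicial replacement\<close>

definition proj :: "nat \<times> nat \<Rightarrow> _" where
  "proj c = free_ext (I c) GI (gobj repl (fst c)) (\<lambda>i. fgen (N (fst c)) G (fst i))"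

lemma N_gen_hom: "\<kappa> \<in> N n \<Longrightarrow> fgen (N n) G \<kappa> \<in> hom (G \<kappa>) (gobj repl n)"
  using P.gen_hom[of \<kappa> n] by simp

lemma proj: "nat_trans DD Z (precomp repl fstF) proj"
  and proj_gen: "i \<in> I c \<Longrightarrow> x \<in> carrier (GI i) \<Longrightarrow> proj c (gn c i x) = fgen (N (fst c)) G (fst i) x"
proof -
  have Y: "group_diagram DD (precomp repl fstF)"
    by (rule precomp_diagram[OF category_DD is_functor_swapF(1) repl_diagram])
  have 1: "fgen (N (fst c)) G (fst i) \<in> hom (GI i) (gobj (precomp repl fstF) c)" if "i \<in> I c" for c i
    using N_gen_hom[of "fst i" "fst c"] that by (cases c) (auto simp: I_def GI_def)
  have 2: "fgen (N (fst (Cod DD f))) G (fst (kI f i)) (hI f i x) = gmap (precomp repl fstF) f (fgen (N (fst (Dom DD f))) G (fst i) x)"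
    if "f \<in> Arr DD" "i \<in> I (Dom DD f)" "x \<in> carrier (GI i)" for f i x
    using opr(2)[of "fst f" "fst i" x] that by (cases f) (auto simp: I_def GI_def kI_def hI_def)
  note * = Z.FD_nat_trans[OF Y, of "\<lambda>c i. fgen (N (fst c)) G (fst i)", OF 1 2]
  show "nat_trans DD Z (precomp repl fstF) proj"
    using *(1) by (simp add: proj_def[abs_def] del: repl_sel)
  show "i \<in> I c \<Longrightarrow> x \<in> carrier (GI i) \<Longrightarrow> proj c (gn c i x) = fgen (N (fst c)) G (fst i) x"
    using *(2)[of c i x] by (simp add: proj_def del: repl_sel)
qed

lemma repl_hom_eq:
  assumes "group H" "a \<in> hom (gobj repl n) H" "b \<in> hom (gobj repl n) H"
    "\<And>\<kappa> x. \<kappa> \<in> N n \<Longrightarrow> x \<in> carrier (G \<kappa>) \<Longrightarrow> a (fgen (N n) G \<kappa> x) = b (fgen (N n) G \<kappa> x)" "x \<in> carrier (gobj repl n)"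
  shows "a x = b x"
  by (rule free_hom_eq[of "N n" G, OF _ assms[unfolded repl_sel]]) (rule groups)

text \<open>\<open>T\<close> is an extra degeneracy of the simplicial set \<open>W _ c\<close>, contracting it to the vertex \<open>B c\<close>.\<close>

lemma proj_equivalence:
  assumes T: "\<And>q c w. w \<in> W q c \<Longrightarrow> T q w \<in> W (Suc q) c"
    and T_last: "\<And>q c w. w \<in> W q c \<Longrightarrow> wd (coface (Suc q) (Suc q)) (T q w) = w"
    and T_face: "\<And>q c w i. w \<in> W (Suc q) c \<Longrightarrow> i \<le> Suc q \<Longrightarrow> wd (coface (Suc (Suc q)) i) (T (Suc q) w) = T q (wd (coface (Suc q) i) w)"
    and B: "\<And>c. c \<in> Obj K \<Longrightarrow> B c \<in> W 0 c"
    and T_base: "\<And>c w. w \<in> W 0 c \<Longrightarrow> wd (coface (Suc 0) 0) (T 0 w) = B c"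
  shows "homotopy_map (sg repl) n (proj (n, n)) \<in> iso (homotopy_group (sg (precomp Z diagF)) n) (homotopy_group (sg repl) n)"
proof -
  \<comment> \<open>\<open>levelwise_equivalence\<close> contracts the first direction, whereas
    \<open>T\<close> acts in the second one.\<close>
  let ?X = "precomp Z swapF"
  define h where "h q p = emap (p, q) (p, Suc q) (\<lambda>(\<kappa>, w). (\<kappa>, T q w))" for q p
  have jT: "(\<lambda>(\<kappa>, w). (\<kappa>, T q w)) i \<in> I (p, Suc q) \<and> GI ((\<lambda>(\<kappa>, w). (\<kappa>, T q w)) i) = GI i" if "i \<in> I (p, q)" for i p q
    using that T by (auto simp: I_def GI_def)
  have e: "h q p \<in> hom (gobj Z (p, q)) (gobj Z (p, Suc q))"
    "i \<in> I (p, q) \<Longrightarrow> x \<in> carrier (GI i) \<Longrightarrow> h q p (gn (p, q) i x) = gn (p, Suc q) ((\<lambda>(\<kappa>, w). (\<kappa>, T q w)) i) x" for p q i x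
    unfolding h_def by (rule emap[OF jT]; assumption)+
  have X: "group_diagram DD ?X" by (rule precomp_diagram[OF category_DD is_functor_swapF(2) Z.FD_diagram])
  have XX: "precomp ?X diagF = precomp Z diagF" by (simp add: precomp_def)
  have t: "nat_trans DD ?X (precomp repl sndF) (\<lambda>c. proj (prod.swap c))"
    using precomp_nat_trans[OF is_functor_swapF(2) category_DD proj] by (simp add: precomp_def)
  have t_hom: "proj (p, q) \<in> hom (gobj Z (p, q)) (gobj repl p)" for p q
    using nat_transD(1)[OF proj, of "(p, q)"] by simp
  \<comment> \<open>A section of the projection, which attaches the base vertex \<open>B\<close> to
    a chain. In degree 0 the contraction collapses to this section after the projection, hence to 1
    on the kernel of the projection.\<close>
  define s where "s p = free_ext (N p) G (gobj Z (p, 0)) (\<lambda>\<kappa>. gn (p, 0) (\<kappa>, B (fobj \<kappa> p)))" for p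
  have Bi: "(\<kappa>, B (fobj \<kappa> p)) \<in> I (p, 0)" if "\<kappa> \<in> N p" for \<kappa> p
    using that B nobj by (simp add: I_def)
  have Bh: "gn (p, 0) (\<kappa>, B (fobj \<kappa> p)) \<in> hom (G \<kappa>) (gobj Z (p, 0))" if "\<kappa> \<in> N p" for \<kappa> p
    using gn_hom[OF Bi[OF that]] by (simp add: GI_def)
  have s: "s p \<in> hom (gobj repl p) (gobj Z (p, 0))"
    "\<kappa> \<in> N p \<Longrightarrow> x \<in> carrier (G \<kappa>) \<Longrightarrow> s p (fgen (N p) G \<kappa> x) = gn (p, 0) (\<kappa>, B (fobj \<kappa> p)) x" for p \<kappa> x
    using free_ext[of "N p" G "gobj Z (p, 0)" "\<lambda>\<kappa>. gn (p, 0) (\<kappa>, B (fobj \<kappa> p))", OF _ Z_group Bh] groups[of _ p]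
    by (simp_all add: s_def)
  have ps: "proj (p, 0) (s p y) = y" if y: "y \<in> carrier (gobj repl p)" for p y
  proof -
    have "(proj (p, 0) \<circ> s p) y = y"
    proof (rule repl_hom_eq[OF _ hom_compose[OF s(1) t_hom] _ _ y])
      show "(proj (p, 0) \<circ> s p) (fgen (N p) G \<kappa> x) = fgen (N p) G \<kappa> x" if "\<kappa> \<in> N p" "x \<in> carrier (G \<kappa>)" for \<kappa> x
        using that s(2)[OF that] proj_gen[OF Bi[OF that(1)], of x] by (simp add: GI_def)
    qed (use P.word_group_group in \<open>simp_all add: hom_def\<close>)
    then show ?thesis by simp
  qed
  have XY: "gobj ?X (q, p) = gobj Z (p, q)" "gmap ?X (\<beta>, \<alpha>) = gmap Z (\<alpha>, \<beta>)" for p q \<alpha> \<beta> by simp_all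
  have hc: "h q p x \<in> carrier (gobj Z (p, Suc q))" if "x \<in> carrier (gobj Z (p, q))" for p q x
    by (rule hom_in_carrier[OF e(1) that])
  have h1: "h q p \<one>\<^bsub>gobj Z (p, q)\<^esub> = \<one>\<^bsub>gobj Z (p, Suc q)\<^esub>" for p q
    by (rule hom_one[OF e(1) Z_group Z_group])
  have kT: "kI (Id Delta p, \<beta>) (\<kappa>, T q w) = (\<kappa>, wd \<beta> (T q w))" if "(\<kappa>, w) \<in> I (p, q)" "\<beta> \<in> Arr Delta" "Cod Delta \<beta> = Suc q" for p q \<beta> \<kappa> w
    using kI_vert[of \<beta> \<kappa> "T q w" p] that jT[OF that(1)] by simp
  have hT: "hI (Id Delta p, \<beta>) (\<kappa>, T q w) x = x" if "(\<kappa>, w) \<in> I (p, q)" "x \<in> carrier (GI (\<kappa>, w))" for p q \<beta> \<kappa> w x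
    using hI_vert[of \<kappa> "T q w" p "Suc q" x] that jT[OF that(1)] by simp
  have hl: "gmap Z (Id Delta p, coface (Suc q) (Suc q)) (h q p x) = x" if "x \<in> carrier (gobj Z (p, q))" for p q x
    unfolding h_def
  proof (rule gmap_emap[OF jT _ _ _ _ _ _ _ _ that, where a = "\<lambda>x. x"])
    fix i x assume "i \<in> I (p, q)" "x \<in> carrier (GI i)"
    then show "gn (p, q) i x = gn (p, q) (kI (Id Delta p, coface (Suc q) (Suc q)) (case i of (\<kappa>, w) \<Rightarrow> (\<kappa>, T q w)))
      (hI (Id Delta p, coface (Suc q) (Suc q)) (case i of (\<kappa>, w) \<Rightarrow> (\<kappa>, T q w)) x)"
      using T_last by (cases i) (auto simp: kT hT I_def)
  qed (simp_all add: hom_def)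
  have hf: "gmap Z (Id Delta p, coface (Suc (Suc q)) i) (h (Suc q) p x) = h q p (gmap Z (Id Delta p, coface (Suc q) i) x)"
    if i: "i \<le> Suc q" and x: "x \<in> carrier (gobj Z (p, Suc q))" for p q i x
  proof -
    have "gmap Z (Id Delta p, coface (Suc (Suc q)) i) (h (Suc q) p x) = (h q p \<circ> gmap Z (Id Delta p, coface (Suc q) i)) x"
      unfolding h_def[of "Suc q"]
    proof (rule gmap_emap[OF jT _ _ _ _ _ _ _ _ x])
      show "h q p \<circ> gmap Z (Id Delta p, coface (Suc q) i) \<in> hom (gobj Z (p, Suc q)) (gobj Z (p, Suc q))"
        by (rule hom_compose[OF Z_hom e(1)]) (use i in simp_all)
      fix j x assume j: "j \<in> I (p, Suc q)" "x \<in> carrier (GI j)"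
      obtain \<kappa> w where w: "j = (\<kappa>, w)" "\<kappa> \<in> N p" "w \<in> W (Suc q) (fobj \<kappa> p)" using j(1) by (auto simp: I_def)
      have k: "kI (Id Delta p, coface (Suc q) i) j = (\<kappa>, wd (coface (Suc q) i) w)" "hI (Id Delta p, coface (Suc q) i) j x = x"
        using kI_vert[of "coface (Suc q) i" \<kappa> w p] hI_vert[of \<kappa> w p "Suc q" x] i j w by simp_all
      have k': "(\<kappa>, wd (coface (Suc q) i) w) \<in> I (p, q)"
        using kI_hI(1)[of "Id Delta p" "coface (Suc q) i" j] i j k by simp
      show "(h q p \<circ> gmap Z (Id Delta p, coface (Suc q) i)) (gn (p, Suc q) j x) =
        gn (p, Suc q) (kI (Id Delta p, coface (Suc (Suc q)) i) (case j of (\<kappa>, w) \<Rightarrow> (\<kappa>, T (Suc q) w)))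
          (hI (Id Delta p, coface (Suc (Suc q)) i) (case j of (\<kappa>, w) \<Rightarrow> (\<kappa>, T (Suc q) w)) x)"
        using i j k k' T_face[OF w(3) i] e(2)[OF k', of x] w by (simp add: Z_gen kT hT GI_sel)
    qed (use i in simp_all)
    then show ?thesis by simp
  qed
  have hb: "gmap Z (Id Delta p, coface (Suc 0) 0) (h 0 p x) = s p (proj (p, 0) x)" if x: "x \<in> carrier (gobj Z (p, 0))" for p x
  proof -
    have "gmap Z (Id Delta p, coface (Suc 0) 0) (h 0 p x) = (s p \<circ> proj (p, 0)) x"
      unfolding h_def
    proof (rule gmap_emap[OF jT _ _ _ _ _ _ hom_compose[OF t_hom s(1)] _ x])
      fix j x assume j: "j \<in> I (p, 0)" "x \<in> carrier (GI j)"
      obtain \<kappa> w where w: "j = (\<kappa>, w)" "\<kappa> \<in> N p" "w \<in> W 0 (fobj \<kappa> p)" using j(1) by (auto simp: I_def)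
      show "(s p \<circ> proj (p, 0)) (gn (p, 0) j x) = gn (p, 0) (kI (Id Delta p, coface (Suc 0) 0) (case j of (\<kappa>, w) \<Rightarrow> (\<kappa>, T 0 w)))
          (hI (Id Delta p, coface (Suc 0) 0) (case j of (\<kappa>, w) \<Rightarrow> (\<kappa>, T 0 w)) x)"
        using j w s(2)[OF w(2), of x] proj_gen[OF j] T_base[OF w(3)] by (simp add: kT hT GI_sel)
    qed simp_all
    then show ?thesis by simp
  qed
  have s1: "s p \<one>\<^bsub>gobj repl p\<^esub> = \<one>\<^bsub>gobj Z (p, 0)\<^esub>" for p
    using hom_one[OF s(1) _ Z_group] P.word_group_group by simp
  note L = levelwise_equivalence[OF X repl_diagram t, where h = h, unfolded XX]
  have sc: "y \<in> carrier (gobj repl q) \<Longrightarrow> s q y \<in> carrier (gobj Z (q, 0))" for y q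
    by (rule hom_in_carrier[OF s(1)])
  have su: "\<exists>x \<in> carrier (gobj ?X (0, q)). proj (prod.swap (0, q)) x = y" if "y \<in> carrier (gobj repl q)" for q y
    using ps[OF that] sc[OF that] by auto
  have "homotopy_map (sg repl) n (proj (prod.swap (n, n))) \<in> iso (homotopy_group (sg (precomp Z diagF)) n) (homotopy_group (sg repl) n)"
    by (rule L) (unfold XY, use su[unfolded XY] hc h1 hl hf hb s1 in \<open>simp_all del: repl_sel\<close>)
  then show "homotopy_map (sg repl) n (proj (n, n)) \<in> iso (homotopy_group (sg (precomp Z diagF)) n) (homotopy_group (sg repl) n)" by simp
qed

end

section \<open>The augmentation to a simplicial group\<close>

context bar begin

text \<open>An element is pushed along the whole chain and \<open>u\<close> into D(S(e)), and by
  \<eta> into \<open>Y\<close>. \<open>Y\<close> and \<eta> stay general for two uses: the left Kan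
  extension with its unit, and X a point with Y = D and \<eta> the identity.\<close>

definition aug :: "(nat, darr, 'h) diagram \<Rightarrow> (nat \<times> 'x \<Rightarrow> 'g \<Rightarrow> 'h) \<Rightarrow> nat \<times> nat \<Rightarrow> _" where
  "aug Y \<eta> c = free_ext (I c) GI (gobj Y (snd c))
     (\<lambda>i x. \<eta> (snd c, fst (snd i)) (gmap D (Comp K (snd (snd i)) (fmap (fst i) (0, fst c))) x))"

lemma u_arr:
  assumes "(\<kappa>, e, u) \<in> I (p, q)" "i \<le> p"
  shows "Comp K u (fmap \<kappa> (i, p)) \<in> Arr K" "Dom K (Comp K u (fmap \<kappa> (i, p))) = fobj \<kappa> i" "Cod K (Comp K u (fmap \<kappa> (i, p))) = fobj S (q, e)"
  using assms narr[of \<kappa> p i p] by (auto simp: I_iff Comp_in Dom_Comp Cod_Comp)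

lemma u_id: "(\<kappa>, e, u) \<in> I (p, q) \<Longrightarrow> Comp K u (fmap \<kappa> (p, p)) = u"
  using Comp_Id[of u] by (auto simp: I_iff nid)

context
  fixes Y :: "(nat, darr, 'h) diagram" and \<eta>
  assumes Y: "group_diagram SD Y" and \<eta>: "nat_trans E (precomp D S) (precomp Y simplex_forget) \<eta>"
begin

lemma eta_hom: "e \<in> simplices X q \<Longrightarrow> \<eta> (q, e) \<in> hom (gobj D (fobj S (q, e))) (gobj Y q)"
  using nat_transD(1)[OF \<eta>, of "(q, e)"] by (simp add: simplex_cat_def simplex_forget_def)

lemma eta_nat:
  assumes "\<beta> \<in> Arr Delta" "e \<in> simplices X (Cod Delta \<beta>)" "x \<in> carrier (gobj D (fobj S (Cod Delta \<beta>, e)))"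
  shows "\<eta> (Dom Delta \<beta>, act X \<beta> e) (gmap D (sarr \<beta> e) x) = gmap Y \<beta> (\<eta> (Cod Delta \<beta>, e) x)"
  using nat_transD(2)[OF \<eta> E_arr[OF assms(1,2)], of x] assms(3) unfolding E_sel
  by (simp add: sarr_def simplex_forget_def)

lemma aug: "nat_trans DD Z (precomp Y sndF) (aug Y \<eta>)"
  and aug_gen: "(\<kappa>, e, u) \<in> I (p, q) \<Longrightarrow> x \<in> carrier (G \<kappa>) \<Longrightarrow>
    aug Y \<eta> (p, q) (gn (p, q) (\<kappa>, e, u) x) = \<eta> (q, e) (gmap D (Comp K u (fmap \<kappa> (0, p))) x)"
proof -
  have YY: "group_diagram DD (precomp Y sndF)"
    by (rule precomp_diagram[OF category_DD is_functor_sndF Y])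
  let ?\<phi> = "\<lambda>c i x. \<eta> (snd c, fst (snd i)) (gmap D (Comp K (snd (snd i)) (fmap (fst i) (0, fst c))) x)"
  have 1: "?\<phi> c i \<in> hom (GI i) (gobj (precomp Y sndF) c)" if "i \<in> I c" for c i
  proof -
    obtain p q \<kappa> e u where e: "c = (p, q)" "i = (\<kappa>, e, u)" by (cases c, cases i) auto
    have i: "(\<kappa>, e, u) \<in> I (p, q)" using that e by simp
    show ?thesis
      using hom_compose[OF hom[OF u_arr(1)[OF i le0], unfolded u_arr(2,3)[OF i le0]] eta_hom[of e q]] i
      by (simp add: e I_iff GI_sel o_def)
  qed
  have 2: "?\<phi> (Cod DD f) (kI f i) (hI f i x) = gmap (precomp Y sndF) f (?\<phi> (Dom DD f) i x)"
    if f: "f \<in> Arr DD" and i: "i \<in> I (Dom DD f)" and x: "x \<in> carrier (GI i)" for f i x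
  proof -
    obtain \<alpha> \<beta> \<kappa> e u where e: "f = (\<alpha>, \<beta>)" "i = (\<kappa>, e, u)" by (cases f, cases i) auto
    have ar: "\<alpha> \<in> Arr Delta" "\<beta> \<in> Arr Delta" using f e by simp_all
    obtain m f n where a: "\<alpha> = (m, f, n)" and f: "\<And>i. i \<le> m \<Longrightarrow> f i \<le> n" "\<And>i j. i \<le> j \<Longrightarrow> j \<le> m \<Longrightarrow> f i \<le> f j"
      using ar(1) by (elim arr_cases) blast
    have I: "(\<kappa>, e, u) \<in> I (n, Cod Delta \<beta>)" using i by (simp add: e a)
    then have i': "\<kappa> \<in> N n" "e \<in> simplices X (Cod Delta \<beta>)" "u \<in> Arr K" "Dom K u = fobj \<kappa> n" "Cod K u = fobj S (Cod Delta \<beta>, e)"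
      by (auto simp: I_iff)
    have x': "x \<in> carrier (G \<kappa>)" using x by (simp add: e GI_sel)
    note s = nerve_sel[OF i'(1)] and S = sarr[OF ar(2) i'(2)]
    let ?k0 = "fmap \<kappa> (0, f 0)" and ?k1 = "fmap \<kappa> (f 0, f m)" and ?k2 = "fmap \<kappa> (f m, n)" and ?s = "sarr \<beta> e"
    have k: "?k0 \<in> Arr K" "?k1 \<in> Arr K" "?k2 \<in> Arr K" "Cod K ?k1 = Dom K ?k2" "Cod K ?k2 = Dom K u" "Cod K ?k0 = Dom K ?k1" "Dom K ?k0 = fobj \<kappa> 0"
      using s(3-5)[of "f m" n] s(3-5)[of "f 0" "f m"] s(3-5)[of 0 "f 0"] f i' by auto
    \<comment> \<open>The path from the start of \<kappa> to S(\<beta>^* e) is cut at f 0 and f m,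
      the ends of the restricted chain. Naturality then amounts to associativity of
      composition.\<close>
    have "Comp K u (fmap \<kappa> (0, n)) = Comp K u (Comp K ?k2 (Comp K ?k1 ?k0))"
      using s(6)[of 0 "f m" n] s(6)[of 0 "f 0" "f m"] f by simp
    then have "Comp K ?s (Comp K u (fmap \<kappa> (0, n))) = Comp K (Comp K (Comp K ?s (Comp K u ?k2)) ?k1) ?k0"
      using k S i'
        Comp_assoc[of ?k0 ?k1 "Comp K ?s (Comp K u ?k2)"] Comp_assoc[of "Comp K ?k1 ?k0" "Comp K u ?k2" ?s] Comp_assoc[of "Comp K ?k1 ?k0" ?k2 u]
      by (simp add: Comp_in Dom_Comp Cod_Comp)
    then have "gmap D (Comp K (Comp K ?s (Comp K u ?k2)) ?k1) (gmap D ?k0 x) = gmap D (Comp K ?s (Comp K u (fmap \<kappa> (0, n)))) x"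
      using k S i' x' map_Comp[of ?k0 "Comp K (Comp K ?s (Comp K u ?k2)) ?k1" x]
      by (simp add: Comp_in Dom_Comp Cod_Comp)
    also have "\<dots> = gmap D ?s (gmap D (Comp K u (fmap \<kappa> (0, n))) x)"
      using x' S u_arr[OF I le0] by (intro map_Comp) simp_all
    finally show ?thesis
      using eta_nat[OF ar(2) i'(2), of "gmap D (Comp K u (fmap \<kappa> (0, n))) x"] closed[OF u_arr(1)[OF I le0]] u_arr(2,3)[OF I le0] x' f(2)[of 0 m]
      by (simp add: e a kI_def wd_def hI_def)
  qed
  note * = Z.FD_nat_trans[OF YY, of ?\<phi>, OF 1 2]
  show "nat_trans DD Z (precomp Y sndF) (aug Y \<eta>)"
    using *(1) by (simp add: aug_def[abs_def])
  show "(\<kappa>, e, u) \<in> I (p, q) \<Longrightarrow> x \<in> carrier (G \<kappa>) \<Longrightarrow>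
    aug Y \<eta> (p, q) (gn (p, q) (\<kappa>, e, u) x) = \<eta> (q, e) (gmap D (Comp K u (fmap \<kappa> (0, p))) x)"
    using *(2)[of "(p, q)" "(\<kappa>, e, u)" x] by (simp add: aug_def GI_sel)
qed

text \<open>The extra degeneracy in the chain direction: \<open>u\<close> becomes the last arrow of
  the chain, and an identity takes its place.\<close>

definition ext :: "nat \<Rightarrow> ('o, 'm) nsimplex \<times> 'x \<times> 'm \<Rightarrow> ('o, 'm) nsimplex \<times> 'x \<times> 'm" where
  "ext p = (\<lambda>(\<kappa>, e, u). (snoc K p \<kappa> u, e, Id K (Cod K u)))"

lemma ext_in: "i \<in> I (p, q) \<Longrightarrow> ext p i \<in> I (Suc p, q) \<and> GI (ext p i) = GI i"
  by (cases i) (auto simp: ext_def I_iff GI_sel snoc_nerve snoc_sel Id_in Dom_Id Cod_Id Cod_in S_obj)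

text \<open>\<open>snoc\<close> absorbs exactly the tail by which \<open>kI\<close> corrects
  \<open>u\<close>, and \<open>dec\<close> fixes the appended vertex. The action on elements agrees
  since it only involves the part of the chain before that vertex.\<close>

lemma ext_dec:
  assumes \<alpha>: "\<alpha> \<in> Arr Delta" and i: "i \<in> I (Cod Delta \<alpha>, q)"
  shows "kI (dec \<alpha>, Id Delta q) (ext (Cod Delta \<alpha>) i) = ext (Dom Delta \<alpha>) (kI (\<alpha>, Id Delta q) i)"
    and "hI (dec \<alpha>, Id Delta q) (ext (Cod Delta \<alpha>) i) = hI (\<alpha>, Id Delta q) i"
proof -
  obtain \<kappa> e u where e: "i = (\<kappa>, e, u)" by (metis prod_cases3)
  obtain m f n where a: "\<alpha> = (m, f, n)" and f: "\<And>i. i \<le> m \<Longrightarrow> f i \<le> n" using \<alpha> by (elim arr_cases) blast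
  have i': "\<kappa> \<in> N n" "e \<in> simplices X q" "u \<in> Arr K" "Dom K u = fobj \<kappa> n" "Cod K u = fobj S (q, e)"
    and I: "(\<kappa>, e, u) \<in> I (n, q)"
    using i by (auto simp: e a I_iff)
  have x: "(snoc K n \<kappa> u, e, Id K (Cod K u)) \<in> I (Suc n, q)" using ext_in[OF I] by (simp add: ext_def)
  have "Comp K (Id K (Cod K u)) (Id K (Cod K u)) = Id K (Cod K u)" using Id_Comp[OF Id_in[OF Cod_in[OF i'(3)]]] Cod_Id[OF Cod_in[OF i'(3)]] by simp
  then show "kI (dec \<alpha>, Id Delta q) (ext (Cod Delta \<alpha>) i) = ext (Dom Delta \<alpha>) (kI (\<alpha>, Id Delta q) i)"
    using kI_hor[of "dec \<alpha>" "snoc K n \<kappa> u" e "Id K (Cod K u)" q] kI_hor[of \<alpha> \<kappa> e u q] \<alpha> I x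
      snoc_dec[OF i'(1,3,4) \<alpha>[unfolded a]] u_arr(3)[OF I f[OF order_refl]] i'(5)
    by (simp add: e ext_def a) (simp add: dec_def snoc_sel)
  show "hI (dec \<alpha>, Id Delta q) (ext (Cod Delta \<alpha>) i) = hI (\<alpha>, Id Delta q) i"
    using f[of 0] by (simp add: e ext_def a hI_def) (simp add: dec_def snoc_sel)
qed

text \<open>The assumptions on \<open>\<zeta>\<close> express that \<open>\<eta>\<close> exhibits \<open>Y\<close> in each degree as the free product of the groups \<open>D (S e)\<close>.\<close>

lemma aug_equivalence:
  assumes \<zeta>: "\<And>q. \<zeta> q \<in> hom (gobj Y q) (gobj Z (0, q))"
    and \<zeta>_aug: "\<And>q y. y \<in> carrier (gobj Y q) \<Longrightarrow> aug Y \<eta> (0, q) (\<zeta> q y) = y"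
    and \<zeta>_eta: "\<And>q e x. e \<in> simplices X q \<Longrightarrow> x \<in> carrier (gobj D (fobj S (q, e))) \<Longrightarrow>
      \<zeta> q (\<eta> (q, e) x) = gn (0, q) (point K (fobj S (q, e)), e, Id K (fobj S (q, e))) x"
  shows "homotopy_map (sg Y) n (aug Y \<eta> (n, n)) \<in> iso (homotopy_group (sg (precomp Z diagF)) n) (homotopy_group (sg Y) n)"
proof -
  interpret Y: diagram SD Y by (rule diagramI[OF category_SD Y])
  define h where "h p q = emap (p, q) (Suc p, q) (ext p)" for p q
  have e: "h p q \<in> hom (gobj Z (p, q)) (gobj Z (Suc p, q))"
    "i \<in> I (p, q) \<Longrightarrow> x \<in> carrier (GI i) \<Longrightarrow> h p q (gn (p, q) i x) = gn (Suc p, q) (ext p i) x" for p q i x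
    unfolding h_def by (rule emap[OF ext_in]; assumption)+
  have hc: "h p q x \<in> carrier (gobj Z (Suc p, q))" if "x \<in> carrier (gobj Z (p, q))" for p q x
    by (rule hom_in_carrier[OF e(1) that])
  have h1: "h p q \<one>\<^bsub>gobj Z (p, q)\<^esub> = \<one>\<^bsub>gobj Z (Suc p, q)\<^esub>" for p q
    by (rule hom_one[OF e(1) Z_group Z_group])
  have hl: "gmap Z (coface (Suc p) (Suc p), Id Delta q) (h p q x) = x" if "x \<in> carrier (gobj Z (p, q))" for p q x
    unfolding h_def
  proof (rule gmap_emap[OF ext_in _ _ _ _ _ _ _ _ that, where a = "\<lambda>x. x"])
    fix i x assume i: "i \<in> I (p, q)" "x \<in> carrier (GI i)"
    obtain \<kappa> e u where e: "i = (\<kappa>, e, u)" by (metis prod_cases3)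
    have I: "(\<kappa>, e, u) \<in> I (p, q)" using i e by simp
    then have i': "\<kappa> \<in> N p" "u \<in> Arr K" by (auto simp: I_iff)
    have x: "(snoc K p \<kappa> u, e, Id K (Cod K u)) \<in> I (Suc p, q)" using ext_in[OF I] by (simp add: ext_def)
    have "kI (coface (Suc p) (Suc p), Id Delta q) (ext p i) = i"
      using kI_hor[of "coface (Suc p) (Suc p)" "snoc K p \<kappa> u" e "Id K (Cod K u)" q] x snoc_last[OF i'(1)] u_id[OF I] Id_Comp[OF i'(2)]
      by (simp add: e ext_def) (simp add: coface_def snoc_sel)
    moreover have "hI (coface (Suc p) (Suc p), Id Delta q) (ext p i) x = x"
      using i e gmap_id[OF nobj[OF i'(1) le0]] nid[OF i'(1) le0] by (simp add: ext_def hI_def coface_def snoc_sel GI_sel)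
    ultimately show "gn (p, q) i x = gn (p, q) (kI (coface (Suc p) (Suc p), Id Delta q) (ext p i)) (hI (coface (Suc p) (Suc p), Id Delta q) (ext p i) x)"
      by simp
  qed (simp_all add: hom_def)
  have hf: "gmap Z (coface (Suc (Suc p)) i, Id Delta q) (h (Suc p) q x) = h p q (gmap Z (coface (Suc p) i, Id Delta q) x)"
    if i: "i \<le> Suc p" and x: "x \<in> carrier (gobj Z (Suc p, q))" for p q i x
  proof -
    have "gmap Z (coface (Suc (Suc p)) i, Id Delta q) (h (Suc p) q x) = (h p q \<circ> gmap Z (coface (Suc p) i, Id Delta q)) x"
      unfolding h_def[of "Suc p"]
    proof (rule gmap_emap[OF ext_in _ _ _ _ _ _ _ _ x])
      show "h p q \<circ> gmap Z (coface (Suc p) i, Id Delta q) \<in> hom (gobj Z (Suc p, q)) (gobj Z (Suc p, q))"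
        by (rule hom_compose[OF Z_hom e(1)]) (use i in simp_all)
      fix j x assume j: "j \<in> I (Suc p, q)" "x \<in> carrier (GI j)"
      have k: "kI (coface (Suc p) i, Id Delta q) j \<in> I (p, q)" "hI (coface (Suc p) i, Id Delta q) j x \<in> carrier (GI (kI (coface (Suc p) i, Id Delta q) j))"
        using kI_hI[of "coface (Suc p) i" "Id Delta q" j] i j hom_in_carrier[of "hI (coface (Suc p) i, Id Delta q) j"] by auto
      show "(h p q \<circ> gmap Z (coface (Suc p) i, Id Delta q)) (gn (Suc p, q) j x) =
        gn (Suc p, q) (kI (coface (Suc (Suc p)) i, Id Delta q) (ext (Suc p) j)) (hI (coface (Suc (Suc p)) i, Id Delta q) (ext (Suc p) j) x)"
        using i j e(2)[OF k] ext_dec[of "coface (Suc p) i" j q] by (simp add: Z_gen coface_dec)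
    qed (use i in simp_all)
    then show ?thesis by simp
  qed
  have t_hom: "aug Y \<eta> (p, q) \<in> hom (gobj Z (p, q)) (gobj Y q)" for p q
    using nat_transD(1)[OF aug, of "(p, q)"] by simp
  \<comment> \<open>Removing the first vertex of the extended chain leaves the one-point chain at
    S(e) with an identity arrow, and carries the element into D(S(e)). This is \<zeta> after the
    augmentation.\<close>
  have hb: "gmap Z (coface (Suc 0) 0, Id Delta q) (h 0 q x) = \<zeta> q (aug Y \<eta> (0, q) x)" if x: "x \<in> carrier (gobj Z (0, q))" for q x
  proof -
    have "gmap Z (coface (Suc 0) 0, Id Delta q) (h 0 q x) = (\<zeta> q \<circ> aug Y \<eta> (0, q)) x"
      unfolding h_def
    proof (rule gmap_emap[OF ext_in _ _ _ _ _ _ hom_compose[OF t_hom \<zeta>] _ x])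
      fix j x assume j: "j \<in> I (0, q)" "x \<in> carrier (GI j)"
      obtain \<kappa> e u where e: "j = (\<kappa>, e, u)" by (metis prod_cases3)
      have I: "(\<kappa>, e, u) \<in> I (0, q)" using j e by simp
      have i': "u \<in> Arr K" "Cod K u = fobj S (q, e)" "e \<in> simplices X q" using I by (auto simp: I_iff)
      have x: "(snoc K 0 \<kappa> u, e, Id K (Cod K u)) \<in> I (Suc 0, q)" using ext_in[OF I] by (simp add: ext_def)
      have "Comp K (Id K (Cod K u)) (Id K (Cod K u)) = Id K (Cod K u)" using Id_Comp[OF Id_in[OF Cod_in[OF i'(1)]]] Cod_Id[OF Cod_in[OF i'(1)]] by simp
      then have k: "kI (coface (Suc 0) 0, Id Delta q) (ext 0 j) = (point K (fobj S (q, e)), e, Id K (fobj S (q, e)))"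
        using kI_hor[of "coface (Suc 0) 0" "snoc K 0 \<kappa> u" e "Id K (Cod K u)" q] x snoc_first[OF i'(1)] i'
        by (simp add: e ext_def) (simp add: coface_def snoc_sel)
      have l: "hI (coface (Suc 0) 0, Id Delta q) (ext 0 j) x = gmap D (Comp K u (fmap \<kappa> (0, 0))) x"
        by (simp add: e ext_def hI_def coface_def snoc_sel)
      show "(\<zeta> q \<circ> aug Y \<eta> (0, q)) (gn (0, q) j x) =
          gn (0, q) (kI (coface (Suc 0) 0, Id Delta q) (ext 0 j)) (hI (coface (Suc 0) 0, Id Delta q) (ext 0 j) x)"
        using aug_gen[OF I, of x] j \<zeta>_eta[OF i'(3), of "gmap D (Comp K u (fmap \<kappa> (0, 0))) x"] closed[OF u_arr(1)[OF I le0]] u_arr(2,3)[OF I le0]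
        by (simp add: k l) (simp add: e GI_sel)
    qed simp_all
    then show ?thesis by simp
  qed
  have z1: "\<zeta> q \<one>\<^bsub>gobj Y q\<^esub> = \<one>\<^bsub>gobj Z (0, q)\<^esub>" for q
    by (rule hom_one[OF \<zeta> _ Z_group]) (use Y.grp[of q] in simp)
  note L = levelwise_equivalence[OF Z.FD_diagram Y aug, where h = h]
  have su: "\<exists>x \<in> carrier (gobj Z (0, q)). aug Y \<eta> (0, q) x = y" if "y \<in> carrier (gobj Y q)" for q y
    using \<zeta>_aug[OF that] hom_in_carrier[OF \<zeta> that] by blast
  show "homotopy_map (sg Y) n (aug Y \<eta> (n, n)) \<in> iso (homotopy_group (sg (precomp Z diagF)) n) (homotopy_group (sg Y) n)"
    by (rule L) (use su hc h1 hl hf hb z1 in simp_all)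
qed

end

end

section \<open>Naturality\<close>

lemma precomp_sndF_diagF: "precomp (precomp Y sndF) diagF = Y"
  by (simp add: precomp_def)

lemma homotopy_map_square:
  assumes "smap X Y f" "smap X X' f'" "smap Y Y' g" "smap X' Y' g'"
    and eq: "\<And>x. x \<in> carrier (gobj X n) \<Longrightarrow> g n (f n x) = g' n (f' n x)"
    and a: "a \<in> carrier (homotopy_group (sg X) n)"
  shows "homotopy_map (sg Y') n (g n) (homotopy_map (sg Y) n (f n) a) =
    homotopy_map (sg Y') n (g' n) (homotopy_map (sg X') n (f' n) a)"
proof -
  interpret f: smap X Y f by fact
  interpret f': smap X X' f' by fact
  interpret g: smap Y Y' g by fact
  interpret g': smap X' Y' g' by fact
  obtain x where x: "x \<in> spheres (sg X) n" "a = homotopic (sg X) n `` {x}" using a by (auto simp: f.X.homotopy_carrier)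
  have "x \<in> carrier (gobj X n)" using x by (simp add: spheres_def)
  then show ?thesis using x eq
    by (simp add: f.homotopy_map_class f'.homotopy_map_class g.homotopy_map_class g'.homotopy_map_class f.t_spheres f'.t_spheres)
qed

text \<open>Passes naturality from an isomorphism to its inverse, as needed for the backward leg of
  a zigzag.\<close>

lemma inv_square:
  assumes f: "f \<in> iso A B" and f': "f' \<in> iso A' B'" and m: "m \<in> hom A A'"
    and eq: "\<And>a. a \<in> carrier A \<Longrightarrow> f' (m a) = m' (f a)" and b: "b \<in> carrier B"
  shows "inv_into (carrier A') f' (m' b) = m (inv_into (carrier A) f b)"
proof -
  have s: "f ` carrier A = carrier B" and i: "inj_on f' (carrier A')" using f f' by (auto simp: iso_def bij_betw_def)
  let ?a = "inv_into (carrier A) f b"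
  have a: "?a \<in> carrier A" "f ?a = b" using b s by (auto intro: inv_into_into f_inv_into_f)
  then have "m' b = f' (m ?a)" using eq by simp
  then show ?thesis using inv_into_f_f[OF i hom_in_carrier[OF m a(1)]] by simp
qed

locale bar_map = B: bar K D X S + B': bar K D' X S
  for K :: "('o, 'm) cat" and D :: "('o, 'm, 'g) diagram" and X :: "'x sset" and S
    and D' :: "('o, 'm, 'h) diagram" +
  fixes t :: "'o \<Rightarrow> 'g \<Rightarrow> 'h"
  assumes t: "nat_trans K D D' t"
begin

text \<open>The simplicial homomorphism underlying \<open>colim_n_map\<close>.\<close>

abbreviation "rmap \<equiv> (\<lambda>n. replacement_map K D' n (\<lambda>(\<sigma>, x). (\<sigma>, t (fobj \<sigma> 0) x)))"

lemma t_hom: "\<sigma> \<in> B.N n \<Longrightarrow> t (fobj \<sigma> 0) \<in> hom (B.G \<sigma>) (B'.G \<sigma>)"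
  using nat_transD(1)[OF t B.nobj] by simp

lemma t_nat: "f \<in> Arr K \<Longrightarrow> x \<in> carrier (gobj D (Dom K f)) \<Longrightarrow> t (Cod K f) (gmap D f x) = gmap D' f (t (Dom K f) x)"
  by (rule nat_transD(2)[OF t])

lemma rmap: "rmap n \<in> hom (gobj B.repl n) (gobj B'.repl n)"
  and rmap_gen: "\<sigma> \<in> B.N n \<Longrightarrow> x \<in> carrier (B.G \<sigma>) \<Longrightarrow> rmap n (fgen (B.N n) B.G \<sigma> x) = fgen (B.N n) B'.G \<sigma> (t (fobj \<sigma> 0) x)"
proof -
  note W = word_map_hom[of "B.N n" B.G "B.N n" B'.G "\<lambda>\<sigma>. \<sigma>" "\<lambda>\<sigma>. t (fobj \<sigma> 0)" "{}" "{}" "\<lambda>(\<sigma>, x). (\<sigma>, t (fobj \<sigma> 0) x)"]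
  show "rmap n \<in> hom (gobj B.repl n) (gobj B'.repl n)"
    unfolding B.repl_sel B'.repl_sel by (rule W(1)) (use B.groups B'.groups t_hom in auto)
  assume s: "\<sigma> \<in> B.N n" "x \<in> carrier (B.G \<sigma>)"
  have "rmap n (word_rel (B.N n) B.G {} `` {[(\<sigma>, x)]}) = word_rel (B.N n) B'.G {} `` {map (\<lambda>(\<sigma>, x). (\<sigma>, t (fobj \<sigma> 0) x)) [(\<sigma>, x)]}"
    by (rule W(2)) (use B.groups B'.groups t_hom s in \<open>auto simp: letters_def\<close>)
  then show "rmap n (fgen (B.N n) B.G \<sigma> x) = fgen (B.N n) B'.G \<sigma> (t (fobj \<sigma> 0) x)"
    unfolding B.P.gen_def B.P.cls_def B'.P.gen_def B'.P.cls_def by simp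
qed

lemma rmap_nat: "nat_trans SD B.repl B'.repl rmap"
  unfolding nat_trans_def
proof (intro conjI ballI)
  fix \<alpha> x assume "\<alpha> \<in> Arr SD" and "x \<in> carrier (gobj B.repl (Dom SD \<alpha>))"
  then have \<alpha>: "\<alpha> \<in> Arr Delta" and x: "x \<in> carrier (gobj B.repl (Cod Delta \<alpha>))" by simp_all
  have o: "B.opr \<alpha> \<in> hom (gobj B.repl (Cod Delta \<alpha>)) (gobj B.repl (Dom Delta \<alpha>))"
    "B'.opr \<alpha> \<in> hom (gobj B'.repl (Cod Delta \<alpha>)) (gobj B'.repl (Dom Delta \<alpha>))"
    using B.opr(1)[OF \<alpha>] B'.opr(1)[OF \<alpha>] by simp_all
  have "(rmap (Dom Delta \<alpha>) \<circ> B.opr \<alpha>) x = (B'.opr \<alpha> \<circ> rmap (Cod Delta \<alpha>)) x"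
  proof (rule B.repl_hom_eq[OF _ hom_compose[OF o(1) rmap] hom_compose[OF rmap o(2)] _ x])
    fix \<kappa> y assume k: "\<kappa> \<in> B.N (Cod Delta \<alpha>)" "y \<in> carrier (B.G \<kappa>)"
    obtain m f n where a: "\<alpha> = (m, f, n)" and f: "\<And>i. i \<le> m \<Longrightarrow> f i \<le> n" using \<alpha> by (elim arr_cases) blast
    have n: "t (fobj \<kappa> (f 0)) (gmap D (fmap \<kappa> (0, f 0)) y) = gmap D' (fmap \<kappa> (0, f 0)) (t (fobj \<kappa> 0) y)"
      using t_nat[of "fmap \<kappa> (0, f 0)" y] B.narr[of \<kappa> n 0 "f 0"] k f[of 0] by (simp add: a)
    have ty: "t (fobj \<kappa> 0) y \<in> carrier (B'.G \<kappa>)" by (rule hom_in_carrier[OF t_hom[OF k(1)] k(2)])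
    show "(rmap (Dom Delta \<alpha>) \<circ> B.opr \<alpha>) (fgen (B.N (Cod Delta \<alpha>)) B.G \<kappa> y) = (B'.opr \<alpha> \<circ> rmap (Cod Delta \<alpha>)) (fgen (B.N (Cod Delta \<alpha>)) B.G \<kappa> y)"
      using B.opr(2,3)[OF \<alpha> k] B'.opr(2)[OF \<alpha> k(1) ty] rmap_gen[OF k] rmap_gen[of "act (nerve K) \<alpha> \<kappa>" "Dom Delta \<alpha>" "gmap D (fmap \<kappa> (0, fst (snd \<alpha>) 0)) y"] n
      by (simp add: a)
  qed (use B'.P.word_group_group in simp)
  then show "rmap (Cod SD \<alpha>) (gmap B.repl \<alpha> x) = gmap B'.repl \<alpha> (rmap (Dom SD \<alpha>) x)" by simp
qed (rule rmap)

definition zmap :: "nat \<times> nat \<Rightarrow> _" where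
  "zmap c = free_ext (B.I c) B.GI (gobj B'.Z c) (\<lambda>i x. B'.gn c i (t (fobj (fst i) 0) x))"

lemma t_GI: "i \<in> B.I c \<Longrightarrow> t (fobj (fst i) 0) \<in> hom (B.GI i) (B'.GI i)"
  using t_hom[of "fst i" "fst c"] by (cases c) (auto simp: B.I_def B.GI_def B'.GI_def)

lemma zmap: "nat_trans DD B.Z B'.Z zmap"
  and zmap_gen: "i \<in> B.I c \<Longrightarrow> x \<in> carrier (B.GI i) \<Longrightarrow> zmap c (B.gn c i x) = B'.gn c i (t (fobj (fst i) 0) x)"
proof -
  let ?\<phi> = "\<lambda>c i x. B'.gn c i (t (fobj (fst i) 0) x)"
  have 1: "?\<phi> c i \<in> hom (B.GI i) (gobj B'.Z c)" if "i \<in> B.I c" for c i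
    using hom_compose[OF t_GI[OF that] B'.gn_hom[OF that]] by (simp add: o_def)
  have 2: "?\<phi> (Cod DD f) (B.kI f i) (B.hI f i x) = gmap B'.Z f (?\<phi> (Dom DD f) i x)"
    if f: "f \<in> Arr DD" and i: "i \<in> B.I (Dom DD f)" and x: "x \<in> carrier (B.GI i)" for f i x
  proof -
    obtain \<alpha> \<beta> \<kappa> e u where e: "f = (\<alpha>, \<beta>)" "i = (\<kappa>, e, u)" by (cases f, cases i) auto
    have ar: "\<alpha> \<in> Arr Delta" "\<beta> \<in> Arr Delta" using f e by simp_all
    obtain m f n where a: "\<alpha> = (m, f, n)" and f: "\<And>i. i \<le> m \<Longrightarrow> f i \<le> n" using ar(1) by (elim arr_cases) blast
    have k: "\<kappa> \<in> B.N n" using i by (auto simp: e a B.I_iff)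
    have n: "t (fobj \<kappa> (f 0)) (gmap D (fmap \<kappa> (0, f 0)) x) = gmap D' (fmap \<kappa> (0, f 0)) (t (fobj \<kappa> 0) x)"
      using t_nat[of "fmap \<kappa> (0, f 0)" x] B.narr[OF k, of 0 "f 0"] f[of 0] x by (simp add: e B.GI_sel)
    have ty: "t (fobj \<kappa> 0) x \<in> carrier (B'.GI i)" using hom_in_carrier[OF t_GI[OF i] x] by (simp add: e)
    show ?thesis
      using B'.Z_gen[OF ar _ _ _ ty, of "Cod Delta \<alpha>" "Cod Delta \<beta>"] i n
      by (simp add: e) (simp add: a B.kI_def B.hI_def B'.hI_def)
  qed
  note * = B.Z.FD_nat_trans[OF B'.Z.FD_diagram, of ?\<phi>, OF 1 2]
  show "nat_trans DD B.Z B'.Z zmap"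
    using *(1) by (simp add: zmap_def[abs_def])
  show "i \<in> B.I c \<Longrightarrow> x \<in> carrier (B.GI i) \<Longrightarrow> zmap c (B.gn c i x) = B'.gn c i (t (fobj (fst i) 0) x)"
    using *(2)[of c i x] by (simp add: zmap_def)
qed

lemma zmap_hom: "zmap c \<in> hom (gobj B.Z c) (gobj B'.Z c)"
  using nat_transD(1)[OF zmap, of c] by (cases c) simp

lemma proj_zmap: "x \<in> carrier (gobj B.Z c) \<Longrightarrow> B'.proj c (zmap c x) = rmap (fst c) (B.proj c x)"
proof -
  assume x: "x \<in> carrier (gobj B.Z c)"
  have p: "B.proj c \<in> hom (gobj B.Z c) (gobj B.repl (fst c))" "B'.proj c \<in> hom (gobj B'.Z c) (gobj B'.repl (fst c))"
    using nat_transD(1)[OF B.proj, of c] nat_transD(1)[OF B'.proj, of c] by (cases c, simp)+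
  have "(B'.proj c \<circ> zmap c) x = (rmap (fst c) \<circ> B.proj c) x"
  proof (rule B.Z_hom_eq[OF _ hom_compose[OF zmap_hom p(2)] hom_compose[OF p(1) rmap] _ x])
    fix i y assume i: "i \<in> B.I c" "y \<in> carrier (B.GI i)"
    have "fst i \<in> B.N (fst c)" "y \<in> carrier (B.G (fst i))" using i by (cases c, auto simp: B.I_def B.GI_def)+
    then show "(B'.proj c \<circ> zmap c) (B.gn c i y) = (rmap (fst c) \<circ> B.proj c) (B.gn c i y)"
      using i zmap_gen[OF i] B.proj_gen[OF i] B'.proj_gen[OF i(1) hom_in_carrier[OF t_GI[OF i(1)] i(2)]] rmap_gen by simp
  qed (use B'.P.word_group_group in simp)
  then show ?thesis by simp
qed

lemma aug_zmap:
  assumes Y: "group_diagram SD Y" "nat_trans B.E (precomp D S) (precomp Y simplex_forget) \<eta>"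
    and Y': "group_diagram SD Y'" "nat_trans B.E (precomp D' S) (precomp Y' simplex_forget) \<eta>'"
    and s: "nat_trans SD Y Y' s"
    and eq: "\<And>q e x. e \<in> simplices X q \<Longrightarrow> x \<in> carrier (gobj D (fobj S (q, e))) \<Longrightarrow> s q (\<eta> (q, e) x) = \<eta>' (q, e) (t (fobj S (q, e)) x)"
    and x: "x \<in> carrier (gobj B.Z (p, q))"
  shows "B'.aug Y' \<eta>' (p, q) (zmap (p, q) x) = s q (B.aug Y \<eta> (p, q) x)"
proof -
  have a: "B.aug Y \<eta> (p, q) \<in> hom (gobj B.Z (p, q)) (gobj Y q)" "B'.aug Y' \<eta>' (p, q) \<in> hom (gobj B'.Z (p, q)) (gobj Y' q)"
    using nat_transD(1)[OF B.aug[OF Y], of "(p, q)"] nat_transD(1)[OF B'.aug[OF Y'], of "(p, q)"] by simp_all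
  have sh: "s q \<in> hom (gobj Y q) (gobj Y' q)" using nat_transD(1)[OF s, of q] by simp
  have gY: "group (gobj Y' q)" using Y'(1) by (simp add: group_diagram_def)
  have "(B'.aug Y' \<eta>' (p, q) \<circ> zmap (p, q)) x = (s q \<circ> B.aug Y \<eta> (p, q)) x"
  proof (rule B.Z_hom_eq[OF gY hom_compose[OF zmap_hom a(2)] hom_compose[OF a(1) sh] _ x])
    fix i y assume i: "i \<in> B.I (p, q)" "y \<in> carrier (B.GI i)"
    obtain \<kappa> e u where e: "i = (\<kappa>, e, u)" by (metis prod_cases3)
    have I: "(\<kappa>, e, u) \<in> B.I (p, q)" and y: "y \<in> carrier (B.G \<kappa>)" using i by (simp_all add: e B.GI_sel)
    have k: "\<kappa> \<in> B.N p" and ex: "e \<in> simplices X q" using I by (auto simp: B.I_iff)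
    note u = B.u_arr[OF I le0]
    show "(B'.aug Y' \<eta>' (p, q) \<circ> zmap (p, q)) (B.gn (p, q) i y) = (s q \<circ> B.aug Y \<eta> (p, q)) (B.gn (p, q) i y)"
      using i zmap_gen[OF i] B.aug_gen[OF Y I y] B'.aug_gen[OF Y' I hom_in_carrier[OF t_hom[OF k] y]]
        t_nat[OF u(1), of y] u(2,3) y eq[OF ex] B.closed[OF u(1), of y] by (simp add: e)
  qed
  then show ?thesis by simp
qed

end

section \<open>The comparison zigzag and its naturality\<close>

context bar begin

text \<open>The zigzag repl <- diag Z -> Y on homotopy, with the left leg inverted.
  \<open>inv_into\<close> is an honest inverse once \<open>proj_iso\<close> holds.\<close>

definition comparison :: "(nat, darr, 'h) diagram \<Rightarrow> (nat \<times> 'x \<Rightarrow> 'g \<Rightarrow> 'h) \<Rightarrow> nat \<Rightarrow> _" where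
  "comparison Y \<eta> n = homotopy_map (sg Y) n (aug Y \<eta> (n, n)) \<circ>
     inv_into (carrier (homotopy_group (sg (precomp Z diagF)) n)) (homotopy_map (sg repl) n (proj (n, n)))"

definition proj_iso :: bool where
  "proj_iso \<longleftrightarrow> (\<forall>n. homotopy_map (sg repl) n (proj (n, n)) \<in> iso (homotopy_group (sg (precomp Z diagF)) n) (homotopy_group (sg repl) n))"

lemma Zdiag: "group_diagram SD (precomp Z diagF)"
  by (rule precomp_diagram[OF category_SD is_functor_F(1) Z.FD_diagram])

lemma comparison_iso:
  assumes "proj_iso"
    and "homotopy_map (sg Y) n (aug Y \<eta> (n, n)) \<in> iso (homotopy_group (sg (precomp Z diagF)) n) (homotopy_group (sg Y) n)"
  shows "comparison Y \<eta> n \<in> iso (colim_n K D n) (homotopy_group (sg Y) n)"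
proof -
  interpret sdiagram "precomp Z diagF" by (rule sdiagram.intro[OF Zdiag])
  show ?thesis
    unfolding comparison_def colim_n_repl
    using assms group.iso_set_sym[OF homotopy_group_group] unfolding proj_iso_def by (blast intro: iso_set_trans)
qed

lemma proj_diag_nat: "nat_trans SD (precomp Z diagF) repl (\<lambda>n. proj (n, n))"
proof -
  have "precomp (precomp repl fstF) diagF = repl" by (simp add: precomp_def repl_def)
  then show ?thesis using precomp_nat_trans[OF is_functor_F(1) category_SD proj] by (simp del: repl_sel)
qed

end

text \<open>Both legs of the zigzag are natural in the coefficients through \<open>zmap\<close>;
  \<open>inv_square\<close> reverses the left one.\<close>

lemma (in bar_map) comparison_natural:
  assumes p: "B.proj_iso" "B'.proj_iso"
    and Y: "group_diagram SD Y" "nat_trans B.E (precomp D S) (precomp Y simplex_forget) \<eta>"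
    and Y': "group_diagram SD Y'" "nat_trans B.E (precomp D' S) (precomp Y' simplex_forget) \<eta>'"
    and s: "nat_trans SD Y Y' s"
    and eq: "\<And>q e x. e \<in> simplices X q \<Longrightarrow> x \<in> carrier (gobj D (fobj S (q, e))) \<Longrightarrow> s q (\<eta> (q, e) x) = \<eta>' (q, e) (t (fobj S (q, e)) x)"
    and a: "a \<in> carrier (colim_n K D n)"
  shows "B'.comparison Y' \<eta>' n (colim_n_map K D' t n a) = homotopy_map (sg Y') n (s n) (B.comparison Y \<eta> n a)"
proof -
  have aug_nat: "nat_trans SD (precomp B.Z diagF) Y (\<lambda>n. B.aug Y \<eta> (n, n))" "nat_trans SD (precomp B'.Z diagF) Y' (\<lambda>n. B'.aug Y' \<eta>' (n, n))"
    using precomp_nat_trans[OF is_functor_F(1) category_SD B.aug[OF Y]] precomp_nat_trans[OF is_functor_F(1) category_SD B'.aug[OF Y']]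
    by (simp_all add: precomp_sndF_diagF)
  have z: "nat_trans SD (precomp B.Z diagF) (precomp B'.Z diagF) (\<lambda>n. zmap (n, n))"
    using precomp_nat_trans[OF is_functor_F(1) category_SD zmap] by simp
  note defs = smap_def sdiagram_def smap_axioms_def
  have sm: "smap (precomp B.Z diagF) Y (\<lambda>n. B.aug Y \<eta> (n, n))" "smap (precomp B'.Z diagF) Y' (\<lambda>n. B'.aug Y' \<eta>' (n, n))"
    "smap (precomp B.Z diagF) (precomp B'.Z diagF) (\<lambda>n. zmap (n, n))" "smap Y Y' s"
    "smap (precomp B.Z diagF) B.repl (\<lambda>n. B.proj (n, n))" "smap (precomp B'.Z diagF) B'.repl (\<lambda>n. B'.proj (n, n))" "smap B.repl B'.repl rmap"
    using aug_nat z s B.proj_diag_nat B'.proj_diag_nat rmap_nat B.Zdiag B'.Zdiag Y Y' B.repl_diagram B'.repl_diagram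
    by (simp_all add: defs)
  let ?A = "homotopy_group (sg (precomp B.Z diagF)) n" and ?A' = "homotopy_group (sg (precomp B'.Z diagF)) n"
  let ?i = "inv_into (carrier ?A) (homotopy_map (sg B.repl) n (B.proj (n, n))) a"
  have cm: "colim_n_map K D' t n a = homotopy_map (sg B'.repl) n (rmap n) a"
    by (simp add: colim_n_map_def homotopy_map_def B'.repl_homotopic)
  have i: "?i \<in> carrier ?A"
    using p(1) a by (auto simp: B.proj_iso_def B.colim_n_repl iso_def bij_betw_def intro!: inv_into_into)
  have "inv_into (carrier ?A') (homotopy_map (sg B'.repl) n (B'.proj (n, n))) (homotopy_map (sg B'.repl) n (rmap n) a) =
    homotopy_map (sg (precomp B'.Z diagF)) n (zmap (n, n)) ?i"
  proof (rule inv_square[where A = ?A and B = "homotopy_group (sg B.repl) n" and A' = ?A' and B' = "homotopy_group (sg B'.repl) n"])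
    show "homotopy_map (sg (precomp B'.Z diagF)) n (zmap (n, n)) \<in> hom ?A ?A'" by (rule smap.homotopy_map_hom[OF sm(3)])
    show "homotopy_map (sg B'.repl) n (B'.proj (n, n)) (homotopy_map (sg (precomp B'.Z diagF)) n (zmap (n, n)) b) =
      homotopy_map (sg B'.repl) n (rmap n) (homotopy_map (sg B.repl) n (B.proj (n, n)) b)" if "b \<in> carrier ?A" for b
      by (rule homotopy_map_square[OF sm(3) sm(5) sm(6) sm(7) _ that]) (simp add: proj_zmap)
  qed (use p a in \<open>simp_all add: B.proj_iso_def B'.proj_iso_def B.colim_n_repl\<close>)
  moreover have "homotopy_map (sg Y') n (B'.aug Y' \<eta>' (n, n)) (homotopy_map (sg (precomp B'.Z diagF)) n (zmap (n, n)) ?i) =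
      homotopy_map (sg Y') n (s n) (homotopy_map (sg Y) n (B.aug Y \<eta> (n, n)) ?i)"
    by (rule homotopy_map_square[OF sm(3) sm(1) sm(2) sm(4) _ i]) (simp add: aug_zmap[OF Y Y' s eq])
  ultimately show ?thesis by (simp add: B.comparison_def B'.comparison_def cm)
qed

section \<open>Left Kan extensions along the forgetful functor\<close>

text \<open>The relabelling respects the colimit relations because naturality of \<open>t\<close>
  carries the identification along an arrow \<alpha> for \<open>F\<close> to the one along \<alpha>
  for \<open>F'\<close>.\<close>

lemma Lan_map:
  assumes "Lan_setup A B S F" "Lan_setup A B S F'" and t: "nat_trans A F F' t"
  shows "nat_trans B (Lan A B S F) (Lan A B S F') (Lan_map A B S F' t)"
    and "(a, \<beta>) \<in> Lan_setup.I A B S d \<Longrightarrow> x \<in> carrier (gobj F a) \<Longrightarrow>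
      Lan_map A B S F' t d (word_presentation.gen (Lan_setup.I A B S d) (Lan_setup.G F) (Lan_setup.R A B S F d) (a, \<beta>) x) =
      word_presentation.gen (Lan_setup.I A B S d) (Lan_setup.G F') (Lan_setup.R A B S F' d) (a, \<beta>) (t a x)"
proof -
  interpret L: Lan_setup A B S F by fact
  interpret L': Lan_setup A B S F' by fact
  have th: "t a \<in> hom (gobj F a) (gobj F' a)" if "a \<in> Obj A" for a using nat_transD(1)[OF t that] .
  have 1: "i \<in> L.I d \<Longrightarrow> i \<in> L.I d \<and> t (fst i) \<in> hom (L.G i) (L'.G i)" for i d
    using th by (cases i) auto
  have 2: "word_eq (L.I d) L'.G (L'.R d) [(i, t (fst i) x)] [(j, t (fst j) y)]"
    if "((i, x), (j, y)) \<in> L.R d" "(i, x) \<in> letters (L.I d) L.G" "(j, y) \<in> letters (L.I d) L.G" for i x j y d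
  proof -
    obtain a \<beta> a' \<beta>' where e: "i = (a, \<beta>)" "j = (a', \<beta>')" by fastforce
    from that(1) obtain \<alpha> where \<alpha>: "\<alpha> \<in> Arr A" "Dom A \<alpha> = a" "Cod A \<alpha> = a'" "Comp B \<beta>' (fmap S \<alpha>) = \<beta>" "y = gmap F \<alpha> x"
      and i: "(a, \<beta>) \<in> L.I d" "(a', \<beta>') \<in> L.I d" and x: "x \<in> carrier (gobj F a)" unfolding e L.R_iff by auto
    have l: "(i, t (fst i) x) \<in> letters (L.I d) L'.G" "(j, t (fst j) y) \<in> letters (L.I d) L'.G"
      using that 1[of i d] 1[of j d] hom_in_carrier[of "t (fst i)"] hom_in_carrier[of "t (fst j)"] by (auto simp: letters_def)
    have "t a x \<in> carrier (gobj F' a)" using l(1) by (simp add: letters_def e)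
    then have "((i, t (fst i) x), (j, t (fst j) y)) \<in> L'.R d"
      unfolding e L'.R_iff using \<alpha> i nat_transD(2)[OF t \<alpha>(1), of x] x by auto
    then show ?thesis using word_eq.ident[of "[]" "L.I d" L'.G "[]"] l by simp
  qed
  note W = word_map_hom[of "L.I d" L.G "L.I d" L'.G "\<lambda>i. i" "\<lambda>i. t (fst i)" "L.R d" "L'.R d" "\<lambda>((a, \<beta>), x). ((a, \<beta>), t a x)" for d]
  have h: "Lan_map A B S F' t d \<in> hom (gobj L.L d) (gobj L'.L d)" for d
    unfolding Lan_map_def L.gobj_Lan L'.gobj_Lan by (rule W(1)) (use L.groups L'.groups 1 2 in \<open>auto simp: letters_def\<close>)
  have g: "Lan_map A B S F' t d (L.P.gen d (a, \<beta>) x) = L'.P.gen d (a, \<beta>) (t a x)"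
    if "(a, \<beta>) \<in> L.I d" "x \<in> carrier (gobj F a)" for a \<beta> x d
  proof -
    have "Lan_map A B S F' t d (L.P.gen d (a, \<beta>) x) = word_rel (L.I d) L'.G (L'.R d) `` {map (\<lambda>((a, \<beta>), x). ((a, \<beta>), t a x)) [((a, \<beta>), x)]}"
      unfolding Lan_map_def L.P.gen_def L.P.cls_def by (rule W(2)) (use L.groups L'.groups 1 2 that in \<open>auto simp: letters_def\<close>)
    then show ?thesis by (simp add: L'.P.gen_def L'.P.cls_def)
  qed
  show "(a, \<beta>) \<in> L.I d \<Longrightarrow> x \<in> carrier (gobj F a) \<Longrightarrow> Lan_map A B S F' t d (L.P.gen d (a, \<beta>) x) = L'.P.gen d (a, \<beta>) (t a x)"
    by (rule g)
  show "nat_trans B L.L L'.L (Lan_map A B S F' t)"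
    unfolding nat_trans_def
  proof (intro conjI ballI h)
    fix \<gamma> c assume \<gamma>: "\<gamma> \<in> Arr B" and c: "c \<in> carrier (gobj L.L (Dom B \<gamma>))"
    have "(Lan_map A B S F' t (Cod B \<gamma>) \<circ> gmap L.L \<gamma>) c = (gmap L'.L \<gamma> \<circ> Lan_map A B S F' t (Dom B \<gamma>)) c"
    proof (rule L.Lan_hom_unique[OF L'.Lan_group hom_compose[OF L.gmap_Lan(1)[OF \<gamma>] h] hom_compose[OF h L'.gmap_Lan(1)[OF \<gamma>]] _ c])
      fix a \<beta> x assume *: "(a, \<beta>) \<in> L.I (Dom B \<gamma>)" "x \<in> carrier (gobj F a)"
      have **: "(a, Comp B \<gamma> \<beta>) \<in> L.I (Cod B \<gamma>)" using * \<gamma> by (simp add: L.B.Comp_in L.B.Dom_Comp L.B.Cod_Comp)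
      have "a \<in> Obj A" using *(1) by simp
      then have tx: "t a x \<in> carrier (gobj F' a)" using hom_in_carrier[OF th *(2)] by blast
      show "(Lan_map A B S F' t (Cod B \<gamma>) \<circ> gmap L.L \<gamma>) (L.P.gen (Dom B \<gamma>) (a, \<beta>) x) =
        (gmap L'.L \<gamma> \<circ> Lan_map A B S F' t (Dom B \<gamma>)) (L.P.gen (Dom B \<gamma>) (a, \<beta>) x)"
        by (simp only: o_apply L.gmap_Lan(2)[OF \<gamma> *] g[OF *] g[OF ** *(2)] L'.gmap_Lan(2)[OF \<gamma> *(1) tx])
    qed
    then show "Lan_map A B S F' t (Cod B \<gamma>) (gmap L.L \<gamma> c) = gmap L'.L \<gamma> (Lan_map A B S F' t (Dom B \<gamma>) c)" by simp
  qed
qed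

lemma forget_obj: "fobj simplex_forget c = fst c"
  by (simp add: simplex_forget_def)

context bar begin

lemma E_cat: "category E"
  by (intro category_op simplex_cat_category X)

lemma Lan_setup: "Lan_setup E SD simplex_forget (precomp D S)"
  using E_cat category_SD is_functor_op[OF is_functor_forget] precomp_diagram[OF E_cat S D]
  by (simp add: Lan_setup_def Lan_setup_axioms_def)

abbreviation "LanD \<equiv> Lan E SD simplex_forget (precomp D S)"
abbreviation "unitD \<equiv> Lan_unit E SD simplex_forget (precomp D S)"

text \<open>Over [q] the comma category has one component for each q-simplex e, with terminal object
  \<open>((q, e), Id Delta q)\<close>: the object \<open>((k, e), \<beta>)\<close> lies in the
  component of \<beta>^* e. So the Kan extension is in degree q the free product of the groups
  D(S(e)), and \<zeta> is read off from this normal form.\<close>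

lemma Lan_equivalence:
  shows "homotopy_map (sg LanD) n (aug LanD unitD (n, n)) \<in> iso (homotopy_group (sg (precomp Z diagF)) n) (homotopy_group (sg LanD) n)"
proof -
  interpret La: Lan_setup E SD simplex_forget "precomp D S" by (rule Lan_setup)
  have Y: "group_diagram SD LanD" by (rule La.Lan_diagram)
  have u: "nat_trans E (precomp D S) (precomp LanD simplex_forget) unitD" by (rule La.unit_natural)
  have I: "((k, e), \<beta>) \<in> La.I q \<longleftrightarrow> e \<in> simplices X k \<and> \<beta> \<in> Arr Delta \<and> Cod Delta \<beta> = k \<and> Dom Delta \<beta> = q" for k e \<beta> q
    unfolding La.I_iff E_sel(5) by (auto simp: simplex_forget_def)
  define gz where "gz q e = (gn (0, q) (point K (fobj S (q, e)), e, Id K (fobj S (q, e))))" for q e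
  have gi: "(point K (fobj S (q, e)), e, Id K (fobj S (q, e))) \<in> I (0, q)" if "e \<in> simplices X q" for q e
    using S_obj[OF that] that by (simp add: I_iff point_nerve point_sel Id_in Dom_Id Cod_Id)
  have gh: "gz q e \<in> hom (gobj D (fobj S (q, e))) (gobj Z (0, q))" if "e \<in> simplices X q" for q e
    using gn_hom[OF gi[OF that]] by (simp add: gz_def GI_sel point_sel)
  \<comment> \<open>Moves a generator to the terminal object of its component.\<close>
  let ?f = "\<lambda>q ((k, e), \<beta>) x. gz q (act X \<beta> e) (gmap D (sarr \<beta> e) x)"
  have f: "?f q i \<in> hom (La.G i) (gobj Z (0, q))" if "i \<in> La.I q" for q i
  proof -
    obtain k e \<beta> where i: "i = ((k, e), \<beta>)" by (metis surj_pair)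
    have *: "e \<in> simplices X k" "\<beta> \<in> Arr Delta" "Cod Delta \<beta> = k" "Dom Delta \<beta> = q" using that unfolding i I by auto
    note s = sarr[OF *(2), of e, unfolded *(3,4)]
    show ?thesis
      using hom_compose[OF hom[OF s(1)], unfolded s(2,3)[OF *(1)], OF *(1) gh] X_act(1)[OF *(2), of e] *
      by (simp add: i o_def)
  qed
  have R: "?f q i x = ?f q j y" if r: "((i, x), (j, y)) \<in> La.R q" for q i x j y
  proof -
    obtain k e \<beta> k' e' \<beta>' where i: "i = ((k, e), \<beta>)" "j = ((k', e'), \<beta>')" by (metis surj_pair)
    from r[unfolded i La.R_iff] obtain \<alpha> where I1: "((k, e), \<beta>) \<in> La.I q" "((k', e'), \<beta>') \<in> La.I q"
      and x: "x \<in> carrier (gobj D (fobj S (k, e)))" and \<alpha>: "\<alpha> \<in> Arr E" "Dom E \<alpha> = (k, e)" "Cod E \<alpha> = (k', e')"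
      "Comp SD \<beta>' (fmap simplex_forget \<alpha>) = \<beta>" "y = gmap D (fmap S \<alpha>) x"
      unfolding precomp_sel by auto
    obtain \<gamma> where g: "\<alpha> = ((k', e'), \<gamma>, (k, e))" using \<alpha>(2,3) by (cases \<alpha>) (auto simp: E_sel simp del: op_cat_sel)
    have g': "\<gamma> \<in> Arr Delta" "Dom Delta \<gamma> = k'" "Cod Delta \<gamma> = k" "act X \<gamma> e = e'" "e \<in> simplices X k"
      using \<alpha>(1) by (auto simp: g simplex_cat_def)
    have b: "\<beta> = Comp Delta \<gamma> \<beta>'" "\<beta>' \<in> Arr Delta" "Cod Delta \<beta>' = k'" "Dom Delta \<beta>' = q"
      using \<alpha>(4) I1(2) unfolding I by (simp_all add: g simplex_forget_def)
    have s: "fmap S \<alpha> = sarr \<gamma> e" using g' by (simp add: sarr_def g)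
    have "gmap D (sarr \<beta> e) x = gmap D (sarr \<beta>' e') (gmap D (sarr \<gamma> e) x)"
      using map_Comp[of "sarr \<gamma> e" "sarr \<beta>' e'" x] sarr[of \<gamma> e] sarr[of \<beta>' e'] X_act(1)[of \<gamma> e] g' b x sarr_Comp[of \<beta>' \<gamma> e] by simp
    moreover have "act X \<beta> e = act X \<beta>' e'" using X_act(3)[of \<beta>' \<gamma> e] g' b by simp
    ultimately show ?thesis by (simp add: i \<alpha>(5) s)
  qed
  have "\<exists>h. h \<in> hom (gobj LanD q) (gobj Z (0, q)) \<and> (\<forall>i \<in> La.I q. \<forall>x \<in> carrier (La.G i). h (La.P.gen q i x) = ?f q i x)" for q
    using La.P.hom_exists[of "gobj Z (0, q)" q "?f q", OF Z_group f R] unfolding La.gobj_Lan by (simp only: Bex_def)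
  then have "\<forall>q. \<exists>h. h \<in> hom (gobj LanD q) (gobj Z (0, q)) \<and> (\<forall>i \<in> La.I q. \<forall>x \<in> carrier (La.G i). h (La.P.gen q i x) = ?f q i x)"
    by blast
  from choice[OF this] obtain \<zeta> where \<zeta>': "\<And>q. \<zeta> q \<in> hom (gobj LanD q) (gobj Z (0, q)) \<and>
    (\<forall>i \<in> La.I q. \<forall>x \<in> carrier (La.G i). \<zeta> q (La.P.gen q i x) = ?f q i x)" by blast
  have \<zeta>: "\<zeta> q \<in> hom (gobj LanD q) (gobj Z (0, q))" for q using \<zeta>' by blast
  have \<zeta>g: "\<zeta> q (La.P.gen q ((k, e), \<beta>) x) = gz q (act X \<beta> e) (gmap D (sarr \<beta> e) x)"
    if "((k, e), \<beta>) \<in> La.I q" "x \<in> carrier (gobj D (fobj S (k, e)))" for q k e \<beta> x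
    using bspec[OF bspec[OF conjunct2[OF \<zeta>'] that(1)], of x] that(2) by simp
  have ue: "unitD (q, e) x = La.P.gen q ((q, e), Id Delta q) x" for q e x
    using La.unit_eq[of "(q, e)" x] by (simp add: forget_obj)
  have ui: "((q, e), Id Delta q) \<in> La.I q" if "e \<in> simplices X q" for q e using that unfolding I by simp
  have agz: "aug LanD unitD (0, q) (gz q e x) = unitD (q, e) x" if e: "e \<in> simplices X q" and x: "x \<in> carrier (gobj D (fobj S (q, e)))" for q e x
  proof -
    have "Comp K (Id K (fobj S (q, e))) (fmap (point K (fobj S (q, e))) (0, 0)) = Id K (fobj S (q, e))"
      using Id_Comp[OF Id_in[OF S_obj[OF e]]] Cod_Id[OF S_obj[OF e]] by (simp add: point_sel)
    then show ?thesis using aug_gen[OF Y u gi[OF e], of x] x gmap_id[OF S_obj[OF e] x] by (simp add: gz_def point_sel)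
  qed
  have za: "aug LanD unitD (0, q) (\<zeta> q y) = y" if y: "y \<in> carrier (gobj LanD q)" for q y
  proof -
    have a: "aug LanD unitD (0, q) \<in> hom (gobj Z (0, q)) (gobj LanD q)"
      using nat_transD(1)[OF aug[OF Y u], of "(0, q)"] by simp
    have "(aug LanD unitD (0, q) \<circ> \<zeta> q) y = y"
    proof (rule La.Lan_hom_unique[OF La.Lan_group hom_compose[OF \<zeta> a] _ _ y])
      fix b \<beta> x assume b: "(b, \<beta>) \<in> La.I q" "x \<in> carrier (gobj (precomp D S) b)"
      obtain k e where i: "b = (k, e)" by (cases b)
      have *: "e \<in> simplices X k" "\<beta> \<in> Arr Delta" "Cod Delta \<beta> = k" "Dom Delta \<beta> = q" using b(1) unfolding i I by auto
      have x: "x \<in> carrier (gobj D (fobj S (k, e)))" using b i by simp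
      have e': "act X \<beta> e \<in> simplices X q" using X_act(1)[OF *(2), of e] * by simp
      have sx: "gmap D (sarr \<beta> e) x \<in> carrier (gobj D (fobj S (q, act X \<beta> e)))"
        using closed[of "sarr \<beta> e" x] sarr[OF *(2), of e] * x by simp
      have "(aug LanD unitD (0, q) \<circ> \<zeta> q) (La.P.gen q ((k, e), \<beta>) x) = unitD (q, act X \<beta> e) (gmap D (sarr \<beta> e) x)"
        using \<zeta>g[of k e \<beta> q x] b x agz[OF e' sx] by (simp add: i)
      \<comment> \<open>Naturality of the unit undoes the move to the terminal object.\<close>
      also have "\<dots> = gmap LanD \<beta> (unitD (k, e) x)" using eta_nat[OF Y u *(2), of e x] * x by simp
      also have "\<dots> = La.P.gen q ((k, e), \<beta>) x"
        using La.gmap_Lan(2)[of \<beta> "(k, e)" "Id Delta k" x] ui[OF *(1)] x * by (simp add: ue)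
      finally show "(aug LanD unitD (0, q) \<circ> \<zeta> q) (La.P.gen q (b, \<beta>) x) = La.P.gen q (b, \<beta>) x" by (simp add: i)
    qed (simp add: hom_def)
    then show ?thesis by simp
  qed
  have zu: "\<zeta> q (unitD (q, e) x) = gn (0, q) (point K (fobj S (q, e)), e, Id K (fobj S (q, e))) x"
    if e: "e \<in> simplices X q" and x: "x \<in> carrier (gobj D (fobj S (q, e)))" for q e x
    using \<zeta>g[OF ui[OF e] x] gmap_id[OF S_obj[OF e] x] X_act(2)[OF e] by (simp add: ue sarr_Id[OF e] gz_def)
  show "homotopy_map (sg LanD) n (aug LanD unitD (n, n)) \<in> iso (homotopy_group (sg (precomp Z diagF)) n) (homotopy_group (sg LanD) n)"
    by (rule aug_equivalence[OF Y u \<zeta> za zu])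
qed

end

section \<open>Simplicial groups and their replacements\<close>

lemma forget_map: "fmap simplex_forget (y, \<alpha>, x) = \<alpha>"
  by (simp add: simplex_forget_def)

text \<open>The category of simplices of the point is a copy of Delta, identified by
  \<open>simplex_forget\<close>. As \<open>S\<close>, this functor is in effect the identity of
  Delta^op.\<close>

definition pt_sset :: "unit sset" where
  "pt_sset = \<lparr>simplices = (\<lambda>_. {()}), act = (\<lambda>_ _. ())\<rparr>"

text \<open>A new last vertex is sent to the top element n of the target: the cone contraction of a
  standard simplex onto its last vertex.\<close>

definition apex :: "darr \<Rightarrow> darr" where
  "apex = (\<lambda>(m, f, n). (Suc m, restrict (\<lambda>i. if i \<le> m then f i else n) {..Suc m}, n))"

lemma apex_sel [simp]: "Dom Delta (apex v) = Suc (Dom Delta v)" "Cod Delta (apex v) = Cod Delta v"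
  by (cases v, simp add: apex_def)+

lemma apex_arr [simp]: "v \<in> Arr Delta \<Longrightarrow> apex v \<in> Arr Delta"
  by (elim arr_cases) (auto simp: apex_def le_Suc_eq intro!: arrI)

lemma apex_last: "v \<in> Arr Delta \<Longrightarrow> Comp Delta (apex v) (coface (Suc (Dom Delta v)) (Suc (Dom Delta v))) = v"
  by (elim arr_cases) (auto simp: apex_def coface_def fun_eq_iff compose_def extensional_def)

lemma apex_dec: "v \<in> Arr Delta \<Longrightarrow> \<alpha> \<in> Arr Delta \<Longrightarrow> Cod Delta \<alpha> = Dom Delta v \<Longrightarrow> Comp Delta (apex v) (dec \<alpha>) = apex (Comp Delta v \<alpha>)"
  by (elim arr_cases) (auto simp: apex_def dec_def fun_eq_iff compose_def le_Suc_eq)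

lemma apex_first: "v \<in> Arr Delta \<Longrightarrow> Dom Delta v = 0 \<Longrightarrow> Comp Delta (apex v) (coface (Suc 0) 0) = vtx (Cod Delta v)"
  by (elim arr_cases) (auto simp: apex_def coface_def vtx_def fun_eq_iff compose_def)

lemma pt_sset_sel: "simplices pt_sset n = {()}" "act pt_sset \<alpha> e = ()"
  by (simp_all add: pt_sset_def)

lemma pt_simplicial: "simplicial_set pt_sset"
  by (simp add: simplicial_set_def pt_sset_def)

lemma bar_pt: "group_diagram SD L \<Longrightarrow> bar SD L pt_sset simplex_forget"
  using category_SD is_functor_op[OF is_functor_forget] pt_simplicial
  by (simp add: bar_def bar_axioms_def replacement_setup_def replacement_setup_axioms_def)

lemma pt_unit:
  "nat_trans (op_cat (simplex_cat pt_sset)) (precomp L simplex_forget) (precomp L simplex_forget) (\<lambda>_ x. x)"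
  by (simp add: nat_trans_def hom_def)

text \<open>Arrows of Delta^op being maps read backwards, \<open>W _ c\<close> is the standard
  c-simplex, contracted by \<open>apex\<close>. \<open>L\<close> is its own augmentation: with a
  single simplex in degree q, the free product of the groups D(S(e)) is the one factor L_q.\<close>

lemma bar_pt_isos:
  assumes L: "group_diagram SD L"
  shows "bar.proj_iso SD L pt_sset simplex_forget"
    and "homotopy_map (sg L) n (bar.aug SD L pt_sset simplex_forget L (\<lambda>_ x. x) (n, n)) \<in>
      iso (homotopy_group (sg (precomp (free_diagram.FD DD (bar.I SD pt_sset simplex_forget) (bar.GI L) (bar.kI SD pt_sset simplex_forget) (bar.hI L)) diagF)) n)
        (homotopy_group (sg L) n)"
proof -
  interpret B: bar SD L pt_sset simplex_forget by (rule bar_pt[OF L])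
  have s: "B.sarr \<beta> e = \<beta>" for \<beta> e by (simp add: B.sarr_def forget_map)
  have W: "(e, v) \<in> B.W q c \<longleftrightarrow> v \<in> Arr Delta \<and> Cod Delta v = c \<and> Dom Delta v = q" for e v q c
    by (simp add: B.W_def pt_sset_sel forget_obj)
  have wd: "B.wd \<beta> (e, v) = ((), Comp Delta v \<beta>)" for \<beta> e v by (simp add: B.wd_def s)
  show "B.proj_iso" unfolding B.proj_iso_def
  proof
    fix n
    show "homotopy_map (sg B.repl) n (B.proj (n, n)) \<in> iso (homotopy_group (sg (precomp B.Z diagF)) n) (homotopy_group (sg B.repl) n)"
    proof (rule B.proj_equivalence[where T = "\<lambda>_ (e, v). ((), apex v)" and B = "\<lambda>c. ((), vtx c)"])
      fix q c w assume "w \<in> B.W q c"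
      then show "(\<lambda>(e, v). ((), apex v)) w \<in> B.W (Suc q) c"
        "B.wd (coface (Suc q) (Suc q)) ((\<lambda>(e, v). ((), apex v)) w) = w"
        using apex_last by (cases w; auto simp: W wd)+
    next
      fix q c w i assume "w \<in> B.W (Suc q) c" "i \<le> Suc q"
      then show "B.wd (coface (Suc (Suc q)) i) ((\<lambda>(e, v). ((), apex v)) w) = (\<lambda>(e, v). ((), apex v)) (B.wd (coface (Suc q) i) w)"
        by (cases w) (auto simp: W wd coface_dec apex_dec)
    next
      fix c w assume "w \<in> B.W 0 c"
      then show "B.wd (coface (Suc 0) 0) ((\<lambda>(e, v). ((), apex v)) w) = ((), vtx c)"
        using apex_first by (cases w) (auto simp: W wd)
    qed (simp add: W)
  qed
  have gi: "(point SD q, (), Id SD q) \<in> B.I (0, q)" for q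
    by (simp add: B.I_iff B.point_nerve point_sel pt_sset_sel forget_obj)
  have gh: "B.gn (0, q) (point SD q, (), Id SD q) \<in> hom (gobj L q) (gobj B.Z (0, q))" for q
    using B.gn_hom[OF gi[of q]] by (simp add: B.GI_sel point_sel)
  have ag: "B.aug L (\<lambda>_ x. x) (0, q) (B.gn (0, q) (point SD q, (), Id SD q) y) = y" if y: "y \<in> carrier (gobj L q)" for q y
    using B.aug_gen[OF L pt_unit gi[of q], of y] y B.map_Id[of q y] by (simp add: point_sel)
  show "homotopy_map (sg L) n (B.aug L (\<lambda>_ x. x) (n, n)) \<in> iso (homotopy_group (sg (precomp B.Z diagF)) n) (homotopy_group (sg L) n)"
    by (rule B.aug_equivalence[OF L pt_unit gh ag]) (simp_all add: forget_obj)
qed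


section \<open>Factorization categories\<close>

lemma delta_fun_sel: "fobj delta_fun (m, \<sigma>) = fmap \<sigma> (0, m)"
  "fmap delta_fun ((m, \<sigma>), (m', g, n'), (n, \<tau>)) =
    (fmap \<sigma> (0, m), (fmap \<tau> (0, g 0), fmap \<tau> (g m, n)), fmap \<tau> (0, n))"
  by (simp_all add: delta_fun_def)

lemma bar_fact:
  assumes C: "category C" and G: "natural_system C \<G>"
  shows "bar (op_cat (fact_cat C)) \<G> (nerve C) delta_fun"
  using category_op[OF category.category_fact[OF C]] G nerve_simplicial_set[of C] is_functor_op[OF category.delta_functor[OF C]]
  by (simp add: bar_def bar_axioms_def replacement_setup_def replacement_setup_axioms_def)

lemma bar_fact_proj_iso:
  fixes C :: "('o, 'm) cat"
  assumes C: "category C" and G: "natural_system C \<G>"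
  shows "bar.proj_iso (op_cat (fact_cat C)) \<G> (nerve C) delta_fun"
proof -
  interpret C: category C by (rule C)
  interpret B: bar "op_cat (fact_cat C)" \<G> "nerve C" delta_fun by (rule bar_fact[OF C G])
  \<comment> \<open>An arrow from f to \<delta>(\<sigma>) in the opposite category is an arrow
    \<delta>(\<sigma>) -> f of factorizations, whence the equation for f.\<close>
  have W: "(\<sigma>, f0, (\<alpha>, \<beta>), g) \<in> B.W q f \<longleftrightarrow> \<sigma> \<in> simplices (nerve C) q \<and> g = f \<and> f0 = fmap \<sigma> (0, q) \<and>
      f0 \<in> Arr C \<and> f \<in> Arr C \<and> \<alpha> \<in> Arr C \<and> \<beta> \<in> Arr C \<and> Dom C \<alpha> = Dom C f \<and> Cod C \<alpha> = Dom C f0 \<and>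
      Dom C \<beta> = Cod C f0 \<and> Cod C \<beta> = Cod C f \<and> f = Comp C \<beta> (Comp C f0 \<alpha>)" for \<sigma> f0 \<alpha> \<beta> g q f
    by (auto simp: B.W_def delta_fun_sel)
  have wd: "B.wd (m, g, n) (\<sigma>, f0, (\<alpha>, \<beta>), f) =
      (act (nerve C) (m, g, n) \<sigma>, fmap (act (nerve C) (m, g, n) \<sigma>) (0, m), (Comp C (fmap \<sigma> (0, g 0)) \<alpha>, Comp C \<beta> (fmap \<sigma> (g m, n))), f)"
    for m g n \<sigma> f0 \<alpha> \<beta> f
    by (simp add: B.wd_def B.sarr_def delta_fun_sel)
  \<comment> \<open>\<open>f = \<beta> \<circ> \<sigma> \<circ> \<alpha>\<close> is refactored by making \<open>\<beta>\<close> the last arrow of the simplex.\<close>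
  define T :: "nat \<Rightarrow> ('o, 'm) nsimplex \<times> 'm \<times> ('m \<times> 'm) \<times> 'm \<Rightarrow> ('o, 'm) nsimplex \<times> 'm \<times> ('m \<times> 'm) \<times> 'm"
    where "T q = (\<lambda>(\<sigma>, f0, (\<alpha>, \<beta>), f). (snoc C q \<sigma> \<beta>, Comp C \<beta> f0, (\<alpha>, Id C (Cod C f)), f))" for q
  \<comment> \<open>The base vertex is the factorization f = id o id o f through the codomain. It is
    what remains of \<open>T 0 w\<close> without its first vertex, because the dropped arrow is
    absorbed into \<alpha>.\<close>
  define P where "P f = (point C (Cod C f), Id C (Cod C f), (f, Id C (Cod C f)), f)" for f
  \<comment> \<open>Compatibility is shown with \<open>dec \<gamma>\<close> for every \<gamma>; the
    face identities are the instances given by \<open>coface_dec\<close>.\<close>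
  have T: "T q w \<in> B.W (Suc q) f" "B.wd (coface (Suc q) (Suc q)) (T q w) = w"
    "\<gamma> \<in> Arr Delta \<Longrightarrow> Cod Delta \<gamma> = q \<Longrightarrow> B.wd (dec \<gamma>) (T q w) = T (Dom Delta \<gamma>) (B.wd \<gamma> w)"
    "q = 0 \<Longrightarrow> B.wd (coface (Suc 0) 0) (T 0 w) = P f" if "w \<in> B.W q f" for q f w \<gamma>
  proof -
    obtain \<sigma> f0 \<alpha> \<beta> g where w: "w = (\<sigma>, f0, (\<alpha>, \<beta>), g)" by (metis surj_pair)
    have s: "\<sigma> \<in> simplices (nerve C) q" and g: "g = f" and f0: "f0 = fmap \<sigma> (0, q)" and a: "f0 \<in> Arr C" "f \<in> Arr C" "\<alpha> \<in> Arr C" "\<beta> \<in> Arr C"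
      and d: "Dom C \<alpha> = Dom C f" "Cod C \<alpha> = Dom C f0" "Dom C \<beta> = Cod C f0" "Cod C \<beta> = Cod C f" and f: "f = Comp C \<beta> (Comp C f0 \<alpha>)"
      using that unfolding w W by blast+
    note n = C.nerve_sel[OF s]
    have b: "Dom C \<beta> = fobj \<sigma> q" using d f0 n(5)[of 0 q] by simp
    have o: "Cod C f \<in> Obj C" using a C.Cod_in by blast
    have ii: "Comp C (Id C (Cod C f)) (Id C (Cod C f)) = Id C (Cod C f)" using C.Id_Comp[OF C.Id_in[OF o]] C.Cod_Id[OF o] by simp
    have as: "Comp C (Comp C \<beta> f0) \<alpha> = f" using f a d C.Comp_assoc[of \<alpha> f0 \<beta>] by simp
    have "Comp C (Id C (Cod C f)) f = f" using C.Id_Comp[OF a(2)] .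
    then show "T q w \<in> B.W (Suc q) f"
      using a d o b by (simp add: T_def w g W C.snoc_nerve[OF s] as snoc_sel f0 C.Comp_in C.Dom_Comp C.Cod_Comp C.Id_in C.Dom_Id C.Cod_Id)
        (use as f0 in simp)
    have c: "fmap \<sigma> (0, 0) = Id C (Dom C f0)" "fmap \<sigma> (q, q) = Id C (Dom C \<beta>)" using n(2)[of 0] n(2)[of q] n(4)[of 0 q] b f0 by simp_all
    have "Comp C (Id C (Dom C f0)) \<alpha> = \<alpha>" "Comp C (Id C (Cod C f)) (Comp C \<beta> (Id C (Dom C \<beta>))) = \<beta>"
      using C.Id_Comp[OF a(3)] C.Comp_Id[OF a(4)] C.Id_Comp[OF a(4)] d by simp_all
    then show "B.wd (coface (Suc q) (Suc q)) (T q w) = w"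
      using C.snoc_last[OF s, of \<beta>] c f0 unfolding coface_def by (simp add: T_def w g wd snoc_sel)
    show "B.wd (dec \<gamma>) (T q w) = T (Dom Delta \<gamma>) (B.wd \<gamma> w)" if \<gamma>: "\<gamma> \<in> Arr Delta" "Cod Delta \<gamma> = q"
    proof -
      obtain m h where h: "\<gamma> = (m, h, q)" and hi: "\<And>i. i \<le> m \<Longrightarrow> h i \<le> q" using \<gamma> by (elim arr_cases) auto
      note sd = C.snoc_dec[OF s a(4) b \<gamma>(1)[unfolded h]]
      show ?thesis
        using sd hi[of 0] ii d(4) unfolding h dec_def by (simp add: T_def w g wd snoc_sel)
    qed
    show "B.wd (coface (Suc 0) 0) (T 0 w) = P f" if "q = 0"
    proof -
      have "Comp C (Comp C \<beta> (fmap \<sigma> (0, 0))) \<alpha> = f" using as f0 that by simp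
      then show ?thesis
        using C.snoc_first[OF a(4), of \<sigma>] ii d(4) that unfolding coface_def
        by (simp add: T_def w g wd snoc_sel P_def point_sel)
    qed
  qed
  show ?thesis unfolding B.proj_iso_def
  proof
    fix n
    show "homotopy_map (sg B.repl) n (B.proj (n, n)) \<in> iso (homotopy_group (sg (precomp B.Z diagF)) n) (homotopy_group (sg B.repl) n)"
    proof (rule B.proj_equivalence[where T = T and B = P])
      show "B.wd (coface (Suc (Suc q)) i) (T (Suc q) w) = T q (B.wd (coface (Suc q) i) w)"
        if "w \<in> B.W (Suc q) f" "i \<le> Suc q" for q f w i
        using T(3)[OF that(1), of "coface (Suc q) i"] that(2) by (simp add: coface_dec)
      show "P f \<in> B.W 0 f" if "f \<in> Obj (op_cat (fact_cat C))" for f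
        using that C.point_nerve[of "Cod C f"] C.Id_Comp[of f] C.Id_Comp[OF C.Id_in, of "Cod C f"]
        by (simp add: P_def W point_sel C.Cod_in C.Id_in C.Dom_Id C.Cod_Id)
    qed (use T in auto)
  qed
qed

lemma (in bar_map) colim_n_map_hom: "colim_n_map K D' t n \<in> hom (colim_n K D n) (colim_n K D' n)"
proof -
  have "smap B.repl B'.repl rmap"
    using rmap_nat B.repl_diagram B'.repl_diagram by (simp add: smap_def sdiagram_def smap_axioms_def)
  from smap.homotopy_map_hom[OF this, of n] show ?thesis
    by (simp add: colim_n_map_def homotopy_map_def[abs_def] B'.repl_homotopic B.colim_n_repl B'.colim_n_repl)
qed

section \<open>The isomorphism between Baues-Wirsching homology and the derived colimits\<close>

abbreviation BW_Lan :: "('o, 'm) cat \<Rightarrow> ('m, 'm \<times> ('m \<times> 'm) \<times> 'm, 'g) diagram \<Rightarrow> (nat, darr, _) diagram" where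
  "BW_Lan C \<G> \<equiv> Lan (op_cat (simplex_cat (nerve C))) SD simplex_forget (precomp \<G> delta_fun)"

abbreviation BW_unit where
  "BW_unit C \<G> \<equiv> Lan_unit (op_cat (simplex_cat (nerve C))) SD simplex_forget (precomp \<G> delta_fun)"

text \<open>Both comparisons end in pi_n of the Kan extension: one over Delta^op with a point, the
  other over the factorization category with the nerve. The second is inverted.\<close>

definition BW_comparison where
  "BW_comparison C \<G> n =
     inv_into (carrier (colim_n (op_cat (fact_cat C)) \<G> n))
       (bar.comparison (op_cat (fact_cat C)) \<G> (nerve C) delta_fun (BW_Lan C \<G>) (BW_unit C \<G>) n) \<circ>
     bar.comparison SD (BW_Lan C \<G>) pt_sset simplex_forget (BW_Lan C \<G>) (\<lambda>_ x. x) n"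

lemma BW_homology_eq: "BW_homology C \<G> n = colim_n SD (BW_Lan C \<G>) n"
  by (simp add: BW_homology_def GZ_homology_def)

lemma BW_Lan_diagram: "category C \<Longrightarrow> natural_system C \<G> \<Longrightarrow> group_diagram SD (BW_Lan C \<G>)"
  using Lan_setup.Lan_diagram[OF bar.Lan_setup[OF bar_fact]] .

lemma BW_comparison_isos:
  assumes C: "category C" and G: "natural_system C \<G>"
  shows "bar.comparison SD (BW_Lan C \<G>) pt_sset simplex_forget (BW_Lan C \<G>) (\<lambda>_ x. x) n \<in>
      iso (BW_homology C \<G> n) (homotopy_group (sg (BW_Lan C \<G>)) n)"
    and "bar.comparison (op_cat (fact_cat C)) \<G> (nerve C) delta_fun (BW_Lan C \<G>) (BW_unit C \<G>) n \<in>
      iso (colim_n (op_cat (fact_cat C)) \<G> n) (homotopy_group (sg (BW_Lan C \<G>)) n)"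
  using bar.comparison_iso[OF bar_pt bar_pt_isos, OF BW_Lan_diagram[OF C G] BW_Lan_diagram[OF C G] BW_Lan_diagram[OF C G]]
    bar.comparison_iso[OF bar_fact[OF C G] bar_fact_proj_iso[OF C G] bar.Lan_equivalence[OF bar_fact[OF C G]]]
  by (simp_all add: BW_homology_eq)

lemma BW_comparison_iso:
  assumes C: "category C" and G: "natural_system C \<G>"
  shows "BW_comparison C \<G> n \<in> iso (BW_homology C \<G> n) (colim_n (op_cat (fact_cat C)) \<G> n)"
  unfolding BW_comparison_def
  using BW_comparison_isos[OF C G] group.iso_set_sym[OF colim_n_group[OF category_op[OF category.category_fact[OF C]] G]]
  by (blast intro: iso_set_trans)

text \<open>\<open>comparison_natural\<close> applies to both halves over the same map
  \<open>?s\<close> of Kan extensions, so the two squares can be pasted after inverting the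
  second.\<close>

lemma BW_comparison_natural:
  assumes C: "category C" and G: "natural_system C \<G>" and G': "natural_system C \<G>'"
    and t: "nat_trans (op_cat (fact_cat C)) \<G> \<G>' t" and x: "x \<in> carrier (BW_homology C \<G> n)"
  shows "BW_comparison C \<G>' n (BW_map C \<G>' t n x) = colim_n_map (op_cat (fact_cat C)) \<G>' t n (BW_comparison C \<G> n x)"
proof -
  let ?E = "op_cat (simplex_cat (nerve C))" and ?F = "op_cat (fact_cat C)"
  let ?s = "Lan_map ?E SD simplex_forget (precomp \<G>' delta_fun) (\<lambda>c. t (fobj delta_fun c))"
  interpret M: bar_map ?F \<G> "nerve C" delta_fun \<G>' t
    using bar_fact[OF C G] bar_fact[OF C G'] t by (simp add: bar_map_def bar_map_axioms_def)
  interpret La: Lan_setup ?E SD simplex_forget "precomp \<G> delta_fun" by (rule M.B.Lan_setup)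
  interpret La': Lan_setup ?E SD simplex_forget "precomp \<G>' delta_fun" by (rule M.B'.Lan_setup)
  have t': "nat_trans ?E (precomp \<G> delta_fun) (precomp \<G>' delta_fun) (\<lambda>c. t (fobj delta_fun c))"
    by (rule precomp_nat_trans[OF M.B.S M.B.E_cat t])
  note Lm = Lan_map[OF M.B.Lan_setup M.B'.Lan_setup t']
  note Y = BW_Lan_diagram[OF C G] BW_Lan_diagram[OF C G']
  interpret N: bar_map SD "BW_Lan C \<G>" pt_sset simplex_forget "BW_Lan C \<G>'" ?s
    using bar_pt[OF Y(1)] bar_pt[OF Y(2)] Lm(1) by (simp add: bar_map_def bar_map_axioms_def)
  let ?c1 = "bar.comparison SD (BW_Lan C \<G>) pt_sset simplex_forget (BW_Lan C \<G>) (\<lambda>_ x. x) n"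
  let ?c1' = "bar.comparison SD (BW_Lan C \<G>') pt_sset simplex_forget (BW_Lan C \<G>') (\<lambda>_ x. x) n"
  let ?c2 = "bar.comparison ?F \<G> (nerve C) delta_fun (BW_Lan C \<G>) (BW_unit C \<G>) n"
  let ?c2' = "bar.comparison ?F \<G>' (nerve C) delta_fun (BW_Lan C \<G>') (BW_unit C \<G>') n"
  have m: "BW_map C \<G>' t n x = colim_n_map SD (BW_Lan C \<G>') ?s n x"
    by (simp add: BW_map_def GZ_map_def)
  have 1: "?c1' (BW_map C \<G>' t n x) = homotopy_map (sg (BW_Lan C \<G>')) n (?s n) (?c1 x)"
    unfolding m
    by (rule N.comparison_natural[OF bar_pt_isos(1)[OF Y(1)] bar_pt_isos(1)[OF Y(2)] Y(1) pt_unit Y(2) pt_unit Lm(1)])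
      (use x in \<open>simp_all add: BW_homology_eq forget_obj\<close>)
  \<comment> \<open>The unit is a generator at an identity arrow, where \<open>Lan_map\<close> acts
    by \<open>t\<close> alone.\<close>
  have u: "?s q (BW_unit C \<G> (q, e) x) = BW_unit C \<G>' (q, e) (t (fobj delta_fun (q, e)) x)"
    if e: "e \<in> simplices (nerve C) q" and x: "x \<in> carrier (gobj \<G> (fobj delta_fun (q, e)))" for q e x
  proof -
    have "((q, e), Id SD q) \<in> La.I q" unfolding La.I_iff M.B.E_sel(5) using e by (simp add: forget_obj)
    from Lm(2)[OF this, of x] x show ?thesis
      using La.unit_eq[of "(q, e)" x] La'.unit_eq[of "(q, e)" "t (fobj delta_fun (q, e)) x"] by (simp add: forget_obj)
  qed
  have 2: "?c2' (colim_n_map ?F \<G>' t n a) = homotopy_map (sg (BW_Lan C \<G>')) n (?s n) (?c2 a)" if "a \<in> carrier (colim_n ?F \<G> n)" for a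
    by (rule M.comparison_natural[OF bar_fact_proj_iso[OF C G] bar_fact_proj_iso[OF C G'] Y(1) La.unit_natural Y(2) La'.unit_natural Lm(1) u that])
  have "?c1 x \<in> carrier (homotopy_group (sg (BW_Lan C \<G>)) n)"
    using BW_comparison_isos(1)[OF C G, of n] x by (auto simp: iso_def hom_def)
  from inv_square[OF BW_comparison_isos(2)[OF C G] BW_comparison_isos(2)[OF C G'] M.colim_n_map_hom 2 this]
  show ?thesis by (simp add: BW_comparison_def 1)
qed

theorem mainTheorem7:
  fixes C :: "('o, 'm) cat"
  assumes "category C"
  shows "\<exists>\<Phi>.
    (\<forall>(\<G> :: ('m, 'm \<times> ('m \<times> 'm) \<times> 'm, 'g) diagram) n. natural_system C \<G> \<longrightarrow>
       \<Phi> \<G> n \<in> iso (BW_homology C \<G> n) (colim_n (op_cat (fact_cat C)) \<G> n)) \<and>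
    (\<forall>\<G> \<G>' t n. natural_system C \<G> \<longrightarrow> natural_system C \<G>' \<longrightarrow>
       nat_trans (op_cat (fact_cat C)) \<G> \<G>' t \<longrightarrow>
       (\<forall>x \<in> carrier (BW_homology C \<G> n).
          \<Phi> \<G>' n (BW_map C \<G>' t n x) = colim_n_map (op_cat (fact_cat C)) \<G>' t n (\<Phi> \<G> n x)))"
  by (rule exI[of _ "BW_comparison C"]) (use BW_comparison_iso[OF assms] BW_comparison_natural[OF assms] in blast)

end
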